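(* Let $(T(t))_{t\ge 0}$ be a bounded $C_0$-semigroup on a Hilbert space $X$ with generator $-A$, and assume that $\sigma(A)\cap i\mathbb{R}=\{0\}$. If there exist $\alpha\ge 1$ and $\beta>0$ such that $$\|(is+A)^{-1}\|=\begin{cases}O(|s|^{-\alpha}), & s\to 0,\\ O(|s|^{\beta}), & |s|\to\infty,\end{cases}\qquad( * )$$ then $$\|T(t)A^{\alpha}(I+A)^{-(\alpha+\beta)}\|=O(t^{-1}),\qquad t\to\infty,$$ and $$\|T(t)A(I+A)^{-2}\|=O(t^{-1/\gamma}),\qquad t\to\infty,\qquad( ** )$$ where $\gamma=\max(\alpha,\beta)$. Conversely, if $( ** )$ holds for some $\gamma>0$, then $( * )$ holds for $\alpha=\max(1,\gamma)$ and $\beta=\gamma$.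
   Context: The generator of the semigroup is denoted by $-A$ (not $A$), so $A$ is a sectorial operator; $A^{\alpha}$ and $(I+A)^{-(\alpha+\beta)}$ are the usual fractional powers of sectorial operators, and $s$ ranges over nonzero reals. Spaces are complex. *)

theory Defs
  imports "HOL-Analysis.Analysis" "HOL-Library.Landau_Symbols"
begin

section \<open>Complex Hilbert spaces\<close>

text \<open>The real inner product inherited from the library is the real part of the complex one;
  the norm and completeness come from \<^class>\<open>real_inner\<close> and \<^class>\<open>banach\<close>.\<close>

class complex_hilbert_space = real_inner + banach +
  fixes scaleC :: "complex \<Rightarrow> 'a \<Rightarrow> 'a"  (infixr "*\<^sub>C" 75)
    and cinner :: "'a \<Rightarrow> 'a \<Rightarrow> complex"
  assumes scaleC_add_right: "c *\<^sub>C (x + y) = c *\<^sub>C x + c *\<^sub>C y"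
    and scaleC_add_left: "(c + d) *\<^sub>C x = c *\<^sub>C x + d *\<^sub>C x"
    and scaleC_scaleC: "c *\<^sub>C (d *\<^sub>C x) = (c * d) *\<^sub>C x"
    and scaleC_of_real: "complex_of_real r *\<^sub>C x = r *\<^sub>R x"
    and cinner_commute: "cinner x y = cnj (cinner y x)"
    and cinner_add_left: "cinner (x + y) z = cinner x z + cinner y z"
    and cinner_scaleC_left: "cinner (c *\<^sub>C x) y = c * cinner x y"
    and Re_cinner: "Re (cinner x y) = inner x y"

instantiation complex :: complex_hilbert_space
begin

definition scaleC_complex :: "complex \<Rightarrow> complex \<Rightarrow> complex"
  where "scaleC_complex c x = c * x"

definition cinner_complex :: "complex \<Rightarrow> complex \<Rightarrow> complex"
  where "cinner_complex x y = x * cnj y"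

instance
  by standard
    (simp_all add: scaleC_complex_def cinner_complex_def algebra_simps scaleR_conv_of_real
      inner_complex_def)

end


section \<open>Unbounded operators\<close>

text \<open>A possibly unbounded operator is identified with its graph: \<open>(x, y) \<in> A\<close> means that
  \<open>x\<close> is in the domain of \<open>A\<close> and \<open>A x = y\<close>. The inverse of an operator is then the
  converse relation, its integer powers are the relational powers, and products carry their
  natural (maximal) domain.\<close>

type_synonym 'a operator = "('a \<times> 'a) set"

definition graph_of :: "('a \<Rightarrow> 'a) \<Rightarrow> 'a operator"
  where "graph_of f = {(x, f x) |x. True}"

definition op_prod :: "'a operator \<Rightarrow> 'a operator \<Rightarrow> 'a operator"  (infixr "\<odot>" 70)
  where "S \<odot> R = {(x, z). \<exists>y. (x, y) \<in> R \<and> (y, z) \<in> S}"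

definition op_neg :: "'a::complex_hilbert_space operator \<Rightarrow> 'a operator"
  where "op_neg A = {(x, - y) |x y. (x, y) \<in> A}"

text \<open>\<open>op_shift z A\<close> is $z I + A$.\<close>

definition op_shift :: "complex \<Rightarrow> 'a::complex_hilbert_space operator \<Rightarrow> 'a operator"
  where "op_shift z A = {(x, z *\<^sub>C x + y) |x y. (x, y) \<in> A}"

definition op_apply :: "'a operator \<Rightarrow> 'a \<Rightarrow> 'a"
  where "op_apply A x = (THE y. (x, y) \<in> A)"

definition bounded_clinear :: "('a::complex_hilbert_space \<Rightarrow> 'a) \<Rightarrow> bool"
  where "bounded_clinear f \<longleftrightarrow> bounded_linear f \<and> (\<forall>c x. f (c *\<^sub>C x) = c *\<^sub>C f x)"

definition bounded_operator :: "'a::complex_hilbert_space operator \<Rightarrow> bool"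
  where "bounded_operator A \<longleftrightarrow> (\<exists>f. bounded_clinear f \<and> A = graph_of f)"

text \<open>Meaningful only for \<open>A\<close> satisfying \<^const>\<open>bounded_operator\<close>.\<close>

definition op_norm :: "'a::complex_hilbert_space operator \<Rightarrow> real"
  where "op_norm A = onorm (op_apply A)"

definition spectrum :: "'a::complex_hilbert_space operator \<Rightarrow> complex set"
  where "spectrum A = {z. \<not> bounded_operator ((op_shift z (op_neg A))\<inverse>)}"


section \<open>Semigroups\<close>

definition C0_semigroup :: "(real \<Rightarrow> 'a::complex_hilbert_space \<Rightarrow> 'a) \<Rightarrow> bool"
  where "C0_semigroup T \<longleftrightarrow>
    (\<forall>t\<ge>0. bounded_clinear (T t)) \<and>
    T 0 = id \<and>
    (\<forall>s\<ge>0. \<forall>t\<ge>0. T (s + t) = T s \<circ> T t) \<and>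
    (\<forall>x. ((\<lambda>t. T t x) \<longlongrightarrow> x) (at_right 0))"

definition bounded_C0_semigroup :: "(real \<Rightarrow> 'a::complex_hilbert_space \<Rightarrow> 'a) \<Rightarrow> bool"
  where "bounded_C0_semigroup T \<longleftrightarrow> C0_semigroup T \<and> (\<exists>M. \<forall>t\<ge>0. onorm (T t) \<le> M)"

definition generator :: "(real \<Rightarrow> 'a::complex_hilbert_space \<Rightarrow> 'a) \<Rightarrow> 'a operator"
  where "generator T = {(x, y). ((\<lambda>t. (T t x - x) /\<^sub>R t) \<longlongrightarrow> y) (at_right 0)}"


section \<open>Fractional powers\<close>

text \<open>The Balakrishnan operator of order $a > 0$: for $n = \lfloor a \rfloor + 1$ and $x \in D(A^n)$,
  \[ J^a x = \frac{\Gamma(n)}{\Gamma(a)\,\Gamma(n-a)}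
       \int_0^\infty \lambda^{a-1} \bigl(A(\lambda+A)^{-1}\bigr)^n x \, d\lambda . \]
  The integral is the Henstock--Kurzweil one because the library's Bochner integral requires a
  second countable space; for \<open>A\<close> sectorial the integrand is continuous and absolutely
  integrable.\<close>

definition balakrishnan :: "'a::complex_hilbert_space operator \<Rightarrow> real \<Rightarrow> 'a operator"
  where "balakrishnan A a =
    (let n = nat \<lfloor>a\<rfloor> + 1 in
      {(x, (Gamma (real n) / (Gamma a * Gamma (real n - a))) *\<^sub>R y) |x y.
        x \<in> Domain (A ^^ n) \<and>
        ((\<lambda>r::real. (r powr (a - 1)) *\<^sub>R
            (op_apply (A \<odot> (op_shift (complex_of_real r) A)\<inverse>) ^^ n) x)
          has_integral y) {0<..}})"

text \<open>For a densely defined sectorial operator \<open>A\<close> (negative generators of bounded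
  semigroups are densely defined), $A^a$ with $a > 0$ is the smallest closed extension of the
  Balakrishnan operator, and $A^{-a} = (A^a)^{-1}$ for injective \<open>A\<close>. If \<open>A\<close> is not densely
  defined, this closure need not be the usual fractional power.\<close>

definition frac_power :: "'a::complex_hilbert_space operator \<Rightarrow> real \<Rightarrow> 'a operator"
  where "frac_power A a =
    (if a > 0 then closure (balakrishnan A a)
     else if a = 0 then Id
     else (closure (balakrishnan A (- a)))\<inverse>)"


section \<open>Growth of the resolvent on the imaginary axis\<close>

definition resolvent_growth :: "'a::complex_hilbert_space operator \<Rightarrow> real \<Rightarrow> real \<Rightarrow> bool"
  where "resolvent_growth A \<alpha> \<beta> \<longleftrightarrow>
    (\<lambda>s::real. op_norm ((op_shift (\<i> * complex_of_real s) A)\<inverse>))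
      \<in> O[at 0](\<lambda>s. \<bar>s\<bar> powr (- \<alpha>)) \<and>
    (\<lambda>s::real. op_norm ((op_shift (\<i> * complex_of_real s) A)\<inverse>))
      \<in> O[at_infinity](\<lambda>s. \<bar>s\<bar> powr \<beta>)"

end

theory Submission
  imports Defs
begin

text \<open>Write \<open>R s = (i s + A)\<^sup>-\<^sup>1\<close>, \<open>U = (1 + A)\<^sup>-\<^sup>1\<close> and \<open>Q = A (1 + A)\<^sup>-\<^sup>2\<close>. All decay comes from one fact
(\<open>decay_of_resolvent_bound\<close>): on a Hilbert space, if \<open>B\<close> commutes with the semigroup and
\<open>(z + A)\<^sup>-\<^sup>1 B\<close> is bounded uniformly in the half plane \<open>Re z > 0\<close>, then \<open>T t B\<close> has norm \<open>O(1 / t)\<close>. By the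
resolvent identity it suffices to bound \<open>R s B\<close> for real \<open>s \<noteq> 0\<close>
(\<open>res_imaginary_bound\<close>).

The fact itself is Plancherel's theorem in a discrete form. By the exponential formula, \<open>T t\<close> is the
strong limit of the powers \<open>E\<^sup>N\<close> of \<open>E = p (p + A)\<^sup>-\<^sup>1\<close> with \<open>p = N / t\<close>. For a complex number
\<open>\<omega>\<close> of modulus 1 other than 1, the sum \<open>G = \<Sum>n<N. \<omega>\<^sup>n E\<^sup>n\<^sup>+\<^sup>1\<close> is a geometric one and equals
\<open>p (p (1 - \<omega>) + A)\<^sup>-\<^sup>1 (1 - \<omega>\<^sup>N E\<^sup>N)\<close>; hence the norm of \<open>G\<^sup>2 B x\<close> is at most a constant times
\<open>p \<parallel>G x\<parallel>\<close>. The square \<open>G\<^sup>2\<close> combines powers of \<open>E\<close> with weights that grow linearly, since such a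
weight counts the ways to write the exponent as a sum of two exponents in \<open>G\<close>. Summing squared norms over the \<open>2 N\<close>-th roots of -1 and
applying Parseval's identity to both sides compares \<open>\<Sum>k<N. k\<^sup>2 \<parallel>E\<^sup>k B x\<parallel>\<^sup>2\<close> with
\<open>p\<^sup>2 (\<Sum>n<N. \<parallel>E\<^sup>n x\<parallel>\<^sup>2)\<close>, and power boundedness of \<open>E\<close> turns this into
\<open>\<parallel>E\<^sup>N B x\<parallel> = O(p / N) = O(1 / t)\<close>.

On the range of \<open>R s\<close> the operator \<open>A\<close> acts as the scalar \<open>- i s\<close>, up to errors that do not involve
the size of \<open>R s\<close> (\<open>res_R\<close>). Thus \<open>A\<^sup>\<alpha> (1 + A)\<^sup>-\<^sup>\<alpha>\<close> supplies a factor \<open>\<bar>s\<bar>\<^sup>\<alpha>\<close> as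
\<open>s\<close> tends to 0, and \<open>(1 + A)\<^sup>-\<^sup>\<beta>\<close> a factor \<open>\<bar>s\<bar>\<^sup>-\<^sup>\<beta>\<close> at infinity, which are the
factors that make \<open>R s A\<^sup>\<alpha> (1 + A)\<^sup>-\<^sup>\<alpha>\<^sup>-\<^sup>\<beta>\<close> bounded (\<open>fractional_decay\<close>). For the rate
\<open>t\<^sup>-\<^sup>1\<^sup>/\<^sup>\<gamma>\<close> of \<open>T t Q\<close>, the operator \<open>Q\<close> is truncated to the
frequencies between \<open>e\<close> and \<open>1 / e\<close>: the truncation costs \<open>O(e)\<close>, the truncated operator \<open>B\<close> has
\<open>R s B = O(e powr (1 - \<gamma>))\<close>, and \<open>e = t powr (- 1 / \<gamma>)\<close> balances \<open>e\<close> against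
\<open>e powr (1 - \<gamma>) / t\<close> (\<open>decay_of_resolvent_growth\<close>). Conversely, \<open>T t R s\<close> differs from
\<open>exp (i s t) R s\<close> by \<open>O(t)\<close> and \<open>Q R s\<close> from a multiple of \<open>R s\<close> of size \<open>\<bar>s\<bar> / (1 + s\<^sup>2)\<close> by \<open>O(1)\<close>,
so that \<open>R s\<close> is controlled at a time \<open>t\<close> at which \<open>\<parallel>T t Q\<parallel>\<close> is half of that scalar
(\<open>resolvent_growth_of_decay\<close>).

It remains to know the fractional powers. For \<open>p > 0\<close> the operator \<open>(p + A)\<^sup>-\<^sup>a\<close> is the integral \<open>K p a\<close> of the
semigroup against a Gamma density; the convolution of these densities is the semigroup law
(\<open>K_add\<close>), and Fubini's theorem evaluates the Balakrishnan integral of \<open>p + A\<close>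
(\<open>has_integral_powr_K\<close>). Letting \<open>p\<close> tend to 0 identifies \<open>A\<^sup>a (1 + A)\<^sup>-\<^sup>a\<close> with the absolutely
convergent binomial series of \<open>(1 - U)\<^sup>a\<close> (\<open>balakrishnan_integral_0\<close>, \<open>frac_power_product\<close>).\<close>

section \<open>Complex-linear bounded operators\<close>

text \<open>The norm belongs to the real part of \<open>cinner\<close>, so homogeneity for complex scalars has to come from \<open>cinner\<close> itself.\<close>

lemma norm_scaleC: "norm (c *\<^sub>C x) = cmod c * norm (x::'a::complex_hilbert_space)"
proof -
  have "cinner (c *\<^sub>C x) (c *\<^sub>C x) = c * cnj (c * cinner x x)"
    by (metis cinner_commute cinner_scaleC_left)
  also have "\<dots> = of_real ((cmod c)\<^sup>2) * cnj (cinner x x)"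
    by (simp only: complex_norm_square complex_cnj_mult mult.assoc)
  finally have "Re (cinner (c *\<^sub>C x) (c *\<^sub>C x)) = (cmod c)\<^sup>2 * inner x x"
    by (simp add: Re_cinner[symmetric])
  then have "(norm (c *\<^sub>C x))\<^sup>2 = (cmod c * norm x)\<^sup>2"
    by (simp add: Re_cinner power_mult_distrib flip: power2_norm_eq_inner)
  then show ?thesis
    by (metis abs_norm_cancel mult_nonneg_nonneg norm_ge_zero power2_eq_iff_nonneg)
qed

lemma bounded_bilinear_scaleC:
  "bounded_bilinear (\<lambda>c (x::'a::complex_hilbert_space). c *\<^sub>C x)"
proof
  fix a b :: complex and x y :: 'a and r :: real
  show "(a + b) *\<^sub>C x = a *\<^sub>C x + b *\<^sub>C x" by (rule scaleC_add_left)
  show "a *\<^sub>C (x + y) = a *\<^sub>C x + a *\<^sub>C y" by (rule scaleC_add_right)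
  show "(r *\<^sub>R a) *\<^sub>C x = r *\<^sub>R (a *\<^sub>C x)"
    by (simp add: scaleR_conv_of_real flip: scaleC_scaleC scaleC_of_real)
  show "a *\<^sub>C (r *\<^sub>R x) = r *\<^sub>R (a *\<^sub>C x)"
    by (metis mult.commute scaleC_of_real scaleC_scaleC)
  show "\<exists>K. \<forall>a (x::'a). norm (a *\<^sub>C x) \<le> norm a * norm x * K"
    by (rule exI[of _ 1]) (simp add: norm_scaleC)
qed

interpretation scaleC: bounded_bilinear "\<lambda>c (x::'a::complex_hilbert_space). c *\<^sub>C x"
  by (rule bounded_bilinear_scaleC)

lemma scaleC_one [simp]: "1 *\<^sub>C (x::'a::complex_hilbert_space) = x"
  using scaleC_of_real[of 1 x] by simp

lemma bounded_clinearI: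
  assumes "\<And>x y. f (x + y) = f x + f y" "\<And>c x. f (c *\<^sub>C x) = c *\<^sub>C f x"
    and "\<And>x. norm (f x) \<le> norm x * K"
  shows "bounded_clinear f"
proof -
  have "f (r *\<^sub>R x) = r *\<^sub>R f x" for r x
    using assms(2)[of "of_real r" x] by (simp add: scaleC_of_real)
  then have "bounded_linear f"
    using assms(1,3) by (intro bounded_linear_intro) auto
  then show ?thesis using assms(2) by (simp add: bounded_clinear_def)
qed

lemma bounded_clinear_compose:
  "bounded_clinear f \<Longrightarrow> bounded_clinear g \<Longrightarrow> bounded_clinear (\<lambda>x. f (g x))"
  by (auto simp: bounded_clinear_def intro: bounded_linear_compose)

lemma bounded_clinear_add:
  "bounded_clinear f \<Longrightarrow> bounded_clinear g \<Longrightarrow> bounded_clinear (\<lambda>x. f x + g x)"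
  by (auto simp: bounded_clinear_def scaleC_add_right intro: bounded_linear_add)

lemma bounded_clinear_sub:
  "bounded_clinear f \<Longrightarrow> bounded_clinear g \<Longrightarrow> bounded_clinear (\<lambda>x. f x - g x)"
  by (auto simp: bounded_clinear_def scaleC.diff_right intro: bounded_linear_sub)

lemma bounded_clinear_scaleC: "bounded_clinear f \<Longrightarrow> bounded_clinear (\<lambda>x. c *\<^sub>C f x)"
  by (auto simp: bounded_clinear_def scaleC_scaleC mult.commute
      intro: bounded_linear_compose[OF scaleC.bounded_linear_right])

lemma bounded_clinear_scaleR: "bounded_clinear f \<Longrightarrow> bounded_clinear (\<lambda>x. r *\<^sub>R f x)"
  using bounded_clinear_scaleC[of f "of_real r"] by (simp add: scaleC_of_real)

lemma bounded_clinear_id: "bounded_clinear (\<lambda>x. x)"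
  by (simp add: bounded_clinear_def)

lemma bounded_clinear_funpow: "bounded_clinear f \<Longrightarrow> bounded_clinear (f ^^ n)"
  by (induction n) (auto simp: bounded_clinear_id id_def o_def intro: bounded_clinear_compose)

lemmas bounded_clinear_intros =
  bounded_clinear_compose bounded_clinear_add bounded_clinear_sub bounded_clinear_scaleC
  bounded_clinear_scaleR bounded_clinear_id bounded_clinear_funpow

lemma bounded_clinear_linear: "bounded_clinear f \<Longrightarrow> bounded_linear f"
  by (simp add: bounded_clinear_def)

lemma bounded_clinearD:
  assumes "bounded_clinear f"
  shows "f (x + y) = f x + f y" "f (x - y) = f x - f y" "f (c *\<^sub>C x) = c *\<^sub>C f x"
    "f (r *\<^sub>R x) = r *\<^sub>R f x" "f 0 = 0" "f (- x) = - f x"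
proof -
  interpret bounded_linear f using assms by (rule bounded_clinear_linear)
  show "f (x + y) = f x + f y" "f (x - y) = f x - f y" "f (r *\<^sub>R x) = r *\<^sub>R f x"
    "f 0 = 0" "f (- x) = - f x"
    by (rule add diff scaleR zero neg)+
  show "f (c *\<^sub>C x) = c *\<^sub>C f x" using assms by (simp add: bounded_clinear_def)
qed

lemma bounded_clinear_bound:
  assumes "bounded_clinear f"
  obtains C where "C > 0" "\<And>x. norm (f x) \<le> C * norm x"
  using bounded_linear.pos_bounded[OF bounded_clinear_linear[OF assms]]
  by (auto simp: mult.commute)

lemma bounded_clinear_tendsto:
  "bounded_clinear f \<Longrightarrow> (g \<longlongrightarrow> l) F \<Longrightarrow> ((\<lambda>t. f (g t)) \<longlongrightarrow> f l) F"
  by (rule bounded_linear.tendsto[OF bounded_clinear_linear])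

lemma op_apply_graph_of [simp]: "op_apply (graph_of f) = f"
  by (auto simp: op_apply_def graph_of_def)

lemma op_norm_graph_of [simp]: "op_norm (graph_of f) = onorm f"
  by (simp add: op_norm_def)

lemma graph_of_prod [simp]: "graph_of f \<odot> graph_of g = graph_of (\<lambda>x. f (g x))"
  by (auto simp: op_prod_def graph_of_def)

lemma onorm_le_of_bound:
  assumes "\<And>x. norm (f x) \<le> K * norm x" "0 \<le> K"
  shows "onorm f \<le> K"
  by (rule onorm_bound) (use assms in \<open>auto\<close>)

lemma op_shift_iff: "(x, y) \<in> op_shift z A \<longleftrightarrow> (x, y - z *\<^sub>C x) \<in> A"
proof -
  have "y = z *\<^sub>C x + (y - z *\<^sub>C x)" by simp
  then show ?thesis unfolding op_shift_def by fastforce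
qed

lemma op_shift_shift: "op_shift z (op_shift w A) = op_shift (z + w) A"
  by (auto simp: op_shift_iff scaleC_add_left diff_diff_eq)

text \<open>Difference quotients at 0 only have to be rewritten for positive increments.\<close>

lemma tendsto_at_right_transform:
  assumes "(f \<longlongrightarrow> l) (at_right (0::real))" "\<And>h. h > 0 \<Longrightarrow> f h = g h"
  shows "(g \<longlongrightarrow> l) (at_right 0)"
  by (rule Lim_transform_eventually[OF assms(1) eventually_mono[OF eventually_at_right_less]])
    (use assms(2) in auto)

section \<open>Bounded semigroups and their generators\<close>

text \<open>The lower bound 1 for \<open>M\<close> costs no generality and makes \<open>M\<close> bound the powers of all operators below, the zeroth ones included.\<close>

locale bounded_semigroup =
  fixes T :: "real \<Rightarrow> 'a::complex_hilbert_space \<Rightarrow> 'a" and A :: "'a operator" and M :: real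
  assumes T_clinear: "t \<ge> 0 \<Longrightarrow> bounded_clinear (T t)"
    and T_0: "T 0 x = x"
    and T_add: "s \<ge> 0 \<Longrightarrow> t \<ge> 0 \<Longrightarrow> T (s + t) x = T s (T t x)"
    and T_at_0: "((\<lambda>t. T t x) \<longlongrightarrow> x) (at_right 0)"
    and M_ge_1: "1 \<le> M"
    and T_bound: "t \<ge> 0 \<Longrightarrow> norm (T t x) \<le> M * norm x"
    and generator_T: "generator T = op_neg A"
begin

lemma in_A_iff: "(x, y) \<in> A \<longleftrightarrow> ((\<lambda>h. (T h x - x) /\<^sub>R h) \<longlongrightarrow> - y) (at_right 0)"
proof -
  have "(x, y) \<in> A \<longleftrightarrow> (x, - y) \<in> op_neg A" by (auto simp: op_neg_def)
  then show ?thesis by (simp add: generator_T[symmetric] generator_def)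
qed

lemma T_continuous: "continuous_on {0..} (\<lambda>t. T t x)"
proof -
  have M0: "M > 0" using M_ge_1 by simp
  have *: "norm (T s x - T t x) \<le> M * norm (T (s - t) x - x)" if "0 \<le> t" "t \<le> s" for s t
  proof -
    have "T s x = T t (T (s - t) x)" using T_add[of t "s - t" x] that by simp
    then have "T s x - T t x = T t (T (s - t) x - x)"
      using bounded_clinearD(2)[OF T_clinear] that by simp
    then show ?thesis using T_bound that by simp
  qed
  show ?thesis unfolding continuous_on_iff
  proof (intro ballI allI impI)
    fix t e :: real assume t: "t \<in> {0..}" and e: "e > 0"
    have "\<forall>\<^sub>F h in at_right 0. dist (T h x) x < e / M"
      using T_at_0[of x] e M0 by (intro tendstoD) auto
    then obtain d where d: "d > 0" "\<And>h. 0 < h \<Longrightarrow> h < d \<Longrightarrow> norm (T h x - x) < e / M"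
      unfolding eventually_at_right_field by (auto simp: dist_norm)
    have d': "norm (T h x - x) < e / M" if "0 \<le> h" "h < d" for h
      using d(2)[of h] that e M0 by (cases "h = 0") (auto simp: T_0)
    have "dist (T s x) (T t x) < e" if s: "s \<in> {0..}" "dist s t < d" for s
    proof (cases "t \<le> s")
      case True
      then have "norm (T s x - T t x) \<le> M * norm (T (s - t) x - x)" using * t by auto
      also have "\<dots> < M * (e / M)"
        using d'[of "s - t"] s True M0 by (intro mult_strict_left_mono) (auto simp: dist_real_def)
      finally show ?thesis using M0 by (simp add: dist_norm)
    next
      case False
      then have "norm (T t x - T s x) \<le> M * norm (T (t - s) x - x)" using * s by auto
      also have "\<dots> < M * (e / M)"
        using d'[of "t - s"] s False M0 by (intro mult_strict_left_mono) (auto simp: dist_real_def)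
      finally show ?thesis using M0 by (simp add: dist_norm norm_minus_commute)
    qed
    then show "\<exists>d>0. \<forall>s\<in>{0..}. dist s t < d \<longrightarrow> dist (T s x) (T t x) < e"
      using d(1) by blast
  qed
qed

lemma T_continuous_interval: "0 \<le> a \<Longrightarrow> continuous_on {a..b} (\<lambda>t. T t x)"
  by (rule continuous_on_subset[OF T_continuous]) auto

lemma T_integrable: "0 \<le> a \<Longrightarrow> (\<lambda>t. T t x) integrable_on {a..b}"
  by (rule integrable_continuous_real[OF T_continuous_interval])

lemma T_commute: "s \<ge> 0 \<Longrightarrow> t \<ge> 0 \<Longrightarrow> T s (T t x) = T t (T s x)"
  by (metis T_add add.commute)

lemma average_tendsto:
  assumes "t \<ge> 0"
  shows "((\<lambda>h. integral {t..t + h} (\<lambda>s. T s x) /\<^sub>R h) \<longlongrightarrow> T t x) (at_right 0)"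
proof -
  have "((\<lambda>u. integral {t..u} (\<lambda>s. T s x)) has_vector_derivative T t x) (at t within {t..t+1})"
    by (rule integral_has_vector_derivative) (use assms in \<open>auto intro: T_continuous_interval\<close>)
  then have "((\<lambda>u. (integral {t..u} (\<lambda>s. T s x) - (u - t) *\<^sub>R T t x) /\<^sub>R norm (u - t)) \<longlongrightarrow> 0)
      (at_right t)"
    by (simp add: has_vector_derivative_def has_derivative_at_within at_within_Icc_at_right)
  then have "((\<lambda>h. (integral {t..h + t} (\<lambda>s. T s x) - h *\<^sub>R T t x) /\<^sub>R norm h) \<longlongrightarrow> 0) (at_right 0)"
    by (subst (asm) filterlim_at_right_to_0) simp
  then have "((\<lambda>h. (integral {t..h + t} (\<lambda>s. T s x) - h *\<^sub>R T t x) /\<^sub>R norm h + T t x) \<longlongrightarrow> 0 + T t x)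
      (at_right 0)"
    by (intro tendsto_intros)
  then have "((\<lambda>h. (integral {t..h + t} (\<lambda>s. T s x) - h *\<^sub>R T t x) /\<^sub>R norm h + T t x) \<longlongrightarrow> T t x)
      (at_right 0)" by simp
  then show ?thesis
    by (rule tendsto_at_right_transform) (simp add: scaleR_diff_right add.commute)
qed

lemma T_apply_integral:
  assumes "h \<ge> 0" "t \<ge> 0"
  shows "T h (integral {0..t} (\<lambda>s. T s x)) = integral {h..t + h} (\<lambda>s. T s x)"
proof -
  have "((\<lambda>s. T s x) has_integral integral {h..t + h} (\<lambda>s. T s x)) (cbox (0 + h) (t + h))"
    using T_integrable[of h x "t + h"] assms by (simp add: integrable_integral)
  then have "((\<lambda>s. T s x) \<circ> (+) h has_integral integral {h..t + h} (\<lambda>s. T s x)) (cbox 0 t)"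
    by (subst has_integral_shift_cbox_iff)
  then have "((\<lambda>s. T h (T s x)) has_integral integral {h..t + h} (\<lambda>s. T s x)) {0..t}"
    unfolding box_real by (rule has_integral_eq[rotated]) (use assms in \<open>auto simp: T_add o_def\<close>)
  moreover have "((\<lambda>s. T h (T s x)) has_integral T h (integral {0..t} (\<lambda>s. T s x))) {0..t}"
    using has_integral_linear[OF integrable_integral[OF T_integrable] bounded_clinear_linear[OF T_clinear]]
      assms by (auto simp: o_def)
  ultimately show ?thesis by (rule has_integral_unique[rotated])
qed

lemma diff_quotient_integral:
  assumes "t \<ge> 0"
  shows "((\<lambda>h. (T h (integral {0..t} (\<lambda>s. T s x)) - integral {0..t} (\<lambda>s. T s x)) /\<^sub>R h)
    \<longlongrightarrow> T t x - x) (at_right 0)"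
proof -
  have "((\<lambda>h. integral {t..t + h} (\<lambda>s. T s x) /\<^sub>R h - integral {0..0 + h} (\<lambda>s. T s x) /\<^sub>R h)
    \<longlongrightarrow> T t x - T 0 x) (at_right 0)"
    by (intro tendsto_diff average_tendsto) (use assms in auto)
  then show ?thesis unfolding T_0
  proof (rule tendsto_at_right_transform)
    fix h :: real assume h: "0 < h"
    have 1: "integral {0..t} (\<lambda>s. T s x) + integral {t..t+h} (\<lambda>s. T s x) = integral {0..t+h} (\<lambda>s. T s x)"
      by (rule Henstock_Kurzweil_Integration.integral_combine) (use assms h in \<open>auto intro: T_integrable\<close>)
    have 2: "integral {0..h} (\<lambda>s. T s x) + integral {h..t+h} (\<lambda>s. T s x) = integral {0..t+h} (\<lambda>s. T s x)"
      by (rule Henstock_Kurzweil_Integration.integral_combine) (use assms h in \<open>auto intro: T_integrable\<close>)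
    have "integral {h..t+h} (\<lambda>s. T s x) - integral {0..t} (\<lambda>s. T s x)
      = integral {t..t+h} (\<lambda>s. T s x) - integral {0..h} (\<lambda>s. T s x)"
      using 1[folded 2] by (simp add: algebra_simps)
    then show "integral {t..t + h} (\<lambda>s. T s x) /\<^sub>R h - integral {0..0 + h} (\<lambda>s. T s x) /\<^sub>R h
      = (T h (integral {0..t} (\<lambda>s. T s x)) - integral {0..t} (\<lambda>s. T s x)) /\<^sub>R h"
      using assms h by (simp add: T_apply_integral flip: scaleR_diff_right)
  qed
qed

lemma integral_in_A:
  assumes "t \<ge> 0"
  shows "(integral {0..t} (\<lambda>s. T s x), x - T t x) \<in> A"
  using diff_quotient_integral[OF assms] by (simp add: in_A_iff)

text \<open>The orbit integral commutes with \<open>T h\<close>, so the difference quotients of \<open>\<integral>T s x\<close>, which tend to \<open>T t x - x\<close>, are the orbit integrals of the difference quotients of \<open>x\<close>.\<close>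

lemma T_minus_id:
  assumes "(x, y) \<in> A" "t \<ge> 0"
  shows "x - T t x = integral {0..t} (\<lambda>s. T s y)"
proof -
  have q: "((\<lambda>h. (T h x - x) /\<^sub>R h + y) \<longlongrightarrow> 0) (at_right 0)"
    using tendsto_add[OF iffD1[OF in_A_iff assms(1)] tendsto_const[of y]] by simp
  let ?I = "\<lambda>x. integral {0..t} (\<lambda>s. T s x)"
  have I: "norm (?I z) \<le> M * norm z * t" for z
    using integral_bound[of 0 t "\<lambda>s. T s z" "M * norm z"] T_continuous_interval T_bound assms by auto
  have lin: "?I (z + w) = ?I z + ?I w" "?I (z - w) = ?I z - ?I w" "?I (r *\<^sub>R z) = r *\<^sub>R ?I z" for z w r
  proof -
    have "?I (z + w) = integral {0..t} (\<lambda>s. T s z + T s w)"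
      by (intro integral_cong) (auto simp: bounded_clinearD[OF T_clinear])
    then show "?I (z + w) = ?I z + ?I w" by (simp add: integral_add T_integrable)
    have "?I (z - w) = integral {0..t} (\<lambda>s. T s z - T s w)"
      by (intro integral_cong) (auto simp: bounded_clinearD[OF T_clinear])
    then show "?I (z - w) = ?I z - ?I w" by (simp add: integral_diff T_integrable)
    have "?I (r *\<^sub>R z) = integral {0..t} (\<lambda>s. r *\<^sub>R T s z)"
      by (intro integral_cong) (auto simp: bounded_clinearD[OF T_clinear])
    then show "?I (r *\<^sub>R z) = r *\<^sub>R ?I z" by simp
  qed
  have TI: "T h (?I x) = ?I (T h x)" if "h \<ge> 0" for h
  proof -
    have "T h (?I x) = integral {0..t} (T h \<circ> (\<lambda>s. T s x))"
      using integral_linear[OF T_integrable bounded_clinear_linear[OF T_clinear]] that by simp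
    also have "\<dots> = ?I (T h x)"
      by (intro integral_cong) (use that T_commute in auto)
    finally show ?thesis .
  qed
  have "((\<lambda>h. (T h (?I x) - ?I x) /\<^sub>R h + ?I y) \<longlongrightarrow> 0) (at_right 0)"
  proof (rule Lim_null_comparison)
    have "((\<lambda>h. M * norm ((T h x - x) /\<^sub>R h + y) * t) \<longlongrightarrow> M * norm (0::'a) * t) (at_right 0)"
      by (intro tendsto_intros q)
    then show "((\<lambda>h. M * norm ((T h x - x) /\<^sub>R h + y) * t) \<longlongrightarrow> 0) (at_right 0)" by simp
    show "\<forall>\<^sub>F h in at_right 0. norm ((T h (?I x) - ?I x) /\<^sub>R h + ?I y)
        \<le> M * norm ((T h x - x) /\<^sub>R h + y) * t"
    proof (rule eventually_mono[OF eventually_at_right_less[of 0]])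
      fix h :: real assume "0 < h"
      then have "(T h (?I x) - ?I x) /\<^sub>R h + ?I y = ?I ((T h x - x) /\<^sub>R h + y)"
        by (simp add: TI lin)
      then show "norm ((T h (?I x) - ?I x) /\<^sub>R h + ?I y) \<le> M * norm ((T h x - x) /\<^sub>R h + y) * t"
        using I by simp
    qed
  qed
  moreover have "((\<lambda>h. (T h (?I x) - ?I x) /\<^sub>R h + ?I y) \<longlongrightarrow> T t x - x + ?I y) (at_right 0)"
    by (intro tendsto_add diff_quotient_integral tendsto_const assms)
  ultimately have "T t x - x + ?I y = 0"
    using tendsto_unique trivial_limit_at_right_real by blast
  then show ?thesis by (simp add: algebra_simps add_eq_0_iff)
qed

text \<open>Integrating along orbits turns membership in \<open>A\<close> into the identity \<open>x - T t x = \<integral>T s y\<close>, which is stable under limits and can be differentiated back at 0.\<close>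

lemma A_closed:
  assumes "\<And>n::nat. (x n, y n) \<in> A" "x \<longlonglongrightarrow> a" "y \<longlonglongrightarrow> b"
  shows "(a, b) \<in> A"
proof -
  have *: "a - T t a = integral {0..t} (\<lambda>s. T s b)" if t: "t \<ge> 0" for t
  proof -
    have "(\<lambda>n. x n - T t (x n)) \<longlonglongrightarrow> a - T t a"
      by (intro tendsto_diff assms bounded_clinear_tendsto[OF T_clinear[OF t]])
    moreover have "(\<lambda>n. integral {0..t} (\<lambda>s. T s (y n)) - integral {0..t} (\<lambda>s. T s b)) \<longlonglongrightarrow> 0"
    proof (rule Lim_null_comparison[OF always_eventually[OF allI]])
      fix n
      have "integral {0..t} (\<lambda>s. T s (y n)) - integral {0..t} (\<lambda>s. T s b)
        = integral {0..t} (\<lambda>s. T s (y n) - T s b)"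
        by (simp add: integral_diff T_integrable)
      also have "norm \<dots> \<le> (M * norm (y n - b)) * (t - 0)"
      proof (rule integral_bound[OF t])
        show "continuous_on {0..t} (\<lambda>s. T s (y n) - T s b)"
          by (intro continuous_intros T_continuous_interval) auto
        fix s assume "s \<in> {0..t}"
        then show "norm (T s (y n) - T s b) \<le> M * norm (y n - b)"
          using T_bound[of s "y n - b"] by (simp add: bounded_clinearD[OF T_clinear])
      qed
      finally show "norm (integral {0..t} (\<lambda>s. T s (y n)) - integral {0..t} (\<lambda>s. T s b))
        \<le> (M * norm (y n - b)) * t" by simp
    next
      have "(\<lambda>n. M * norm (y n - b) * t) \<longlonglongrightarrow> M * norm (b - b) * t"
        by (intro tendsto_intros assms)
      then show "(\<lambda>n. M * norm (y n - b) * t) \<longlonglongrightarrow> 0" by simp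
    qed
    ultimately have "(\<lambda>n. x n - T t (x n) - (integral {0..t} (\<lambda>s. T s (y n)) - integral {0..t} (\<lambda>s. T s b)))
       \<longlonglongrightarrow> a - T t a - 0" by (rule tendsto_diff)
    moreover have "x n - T t (x n) = integral {0..t} (\<lambda>s. T s (y n))" for n
      using T_minus_id[OF assms(1) t] .
    ultimately show ?thesis by (simp add: LIMSEQ_const_iff)
  qed
  have "((\<lambda>h. - (integral {0..0 + h} (\<lambda>s. T s b) /\<^sub>R h)) \<longlongrightarrow> - T 0 b) (at_right 0)"
    by (intro tendsto_minus average_tendsto) simp
  then have "((\<lambda>h. (T h a - a) /\<^sub>R h) \<longlongrightarrow> - b) (at_right 0)"
    unfolding T_0
  proof (rule tendsto_at_right_transform)
    fix h :: real assume "0 < h"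
    then show "- (integral {0..0 + h} (\<lambda>s. T s b) /\<^sub>R h) = (T h a - a) /\<^sub>R h"
      by (simp flip: * scaleR_minus_right)
  qed
  then show ?thesis by (simp add: in_A_iff)
qed

lemma A_scaleC: "(x, y) \<in> A \<Longrightarrow> (c *\<^sub>C x, c *\<^sub>C y) \<in> A"
  and A_single_valued: "(x, y) \<in> A \<Longrightarrow> (x, y') \<in> A \<Longrightarrow> y = y'"
proof -
  show "(c *\<^sub>C x, c *\<^sub>C y) \<in> A" if "(x, y) \<in> A"
  proof -
    have "((\<lambda>h. c *\<^sub>C ((T h x - x) /\<^sub>R h)) \<longlongrightarrow> c *\<^sub>C (- y)) (at_right 0)"
      by (intro scaleC.tendsto tendsto_const) (use that in_A_iff in auto)
    then have "((\<lambda>h. (T h (c *\<^sub>C x) - c *\<^sub>C x) /\<^sub>R h) \<longlongrightarrow> c *\<^sub>C (- y)) (at_right 0)"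
      by (rule tendsto_at_right_transform)
        (auto simp: bounded_clinearD[OF T_clinear] scaleC.scaleR_right scaleC.diff_right)
    then show ?thesis by (simp add: in_A_iff scaleC.minus_right)
  qed
  show "y = y'" if "(x, y) \<in> A" "(x, y') \<in> A"
    using that tendsto_unique[OF trivial_limit_at_right_real] unfolding in_A_iff
    by (metis neg_equal_iff_equal)
qed

text \<open>The range of the averages of orbits is contained in the domain, which is therefore dense.\<close>

lemma domain_dense:
  obtains w where "\<And>n::nat. w n \<in> Domain A" "w \<longlonglongrightarrow> x"
proof
  let ?w = "\<lambda>n. integral {0..0 + 1 / Suc n} (\<lambda>s. T s x) /\<^sub>R (1 / real (Suc n))"
  show "?w n \<in> Domain A" for n
  proof -
    have "(real (Suc n) *\<^sub>R integral {0..1 / real (Suc n)} (\<lambda>s. T s x),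
        real (Suc n) *\<^sub>R (x - T (1 / real (Suc n)) x)) \<in> A"
      using A_scaleC[OF integral_in_A[of "1 / real (Suc n)" x], of "complex_of_real (real (Suc n))"]
      unfolding scaleC_of_real by simp
    then show ?thesis unfolding add_0_left inverse_divide div_by_1 by (rule DomainI)
  qed
  have "(\<lambda>n. 1 / real (Suc n)) \<longlonglongrightarrow> 0" by (rule LIMSEQ_Suc[OF lim_1_over_n])
  then have "filterlim (\<lambda>n. 1 / real (Suc n)) (at_right 0) sequentially"
    by (auto simp: filterlim_at simp del: of_nat_Suc)
  then show "?w \<longlonglongrightarrow> x"
    by (rule filterlim_compose[OF average_tendsto[of 0 x, OF order_refl, unfolded T_0]])
qed

end

section \<open>Dominated improper integrals\<close>

text \<open>Continuity off the endpoint replaces measurability of the vector-valued function. The increments of its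
  antiderivative are dominated by those of the antiderivative of \<open>g\<close>; so the antiderivative extends
  continuously to 0, and the fundamental theorem of calculus asks for a derivative only in the interior.\<close>

lemma integrable_on_Icc_dominated:
  fixes f :: "real \<Rightarrow> 'b::banach"
  assumes b: "0 < b" and f: "continuous_on {0<..b} f" and g: "g integrable_on {0..b}"
    and le: "\<And>t. 0 < t \<Longrightarrow> t \<le> b \<Longrightarrow> norm (f t) \<le> g t"
  shows "f integrable_on {0..b}"
proof -
  have fc: "continuous_on {r..c} f" if "0 < r" "c \<le> b" for r c
    by (rule continuous_on_subset[OF f]) (use that in auto)
  have fi: "f integrable_on {r..c}" if "0 < r" "c \<le> b" for r c
    by (intro integrable_continuous_real fc that)
  define G where "G r = integral {0..r} g" for r
  define I where "I r = integral {r..b} f" for r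
  have G: "continuous_on {0..b} G"
    unfolding G_def by (rule indefinite_integral_continuous_1[OF g])
  have gi: "g integrable_on {r..c}" if "0 \<le> r" "c \<le> b" for r c
    by (rule integrable_subinterval_real[OF g]) (use that in auto)
  have inc: "norm (I r - I c) \<le> \<bar>G c - G r\<bar>" if "0 < r" "r \<le> c" "c \<le> b" for r c
  proof -
    have "integral {r..c} f + integral {c..b} f = integral {r..b} f"
      by (rule Henstock_Kurzweil_Integration.integral_combine) (use that fi in auto)
    moreover have "integral {0..r} g + integral {r..c} g = integral {0..c} g"
      by (rule Henstock_Kurzweil_Integration.integral_combine) (use that gi in auto)
    moreover have "norm (integral {r..c} f) \<le> integral {r..c} g"
      by (rule Henstock_Kurzweil_Integration.integral_norm_bound_integral)
        (use that fi gi le in auto)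
    ultimately have "norm (I r - I c) \<le> G c - G r"
      unfolding I_def G_def by (metis add_diff_cancel_left' add_diff_cancel_right')
    then show ?thesis by simp
  qed
  have inc': "norm (I r - I c) \<le> \<bar>G c - G r\<bar>" if "0 < r" "0 < c" "r \<le> b" "c \<le> b" for r c
    using inc[of r c] inc[of c r] that by (cases "r \<le> c") (auto simp: norm_minus_commute)
  define x where "x n = b / real (Suc n)" for n
  have x: "0 < x n" "x n \<le> b" for n using b by (auto simp: x_def field_simps)
  have x0: "x \<longlonglongrightarrow> 0"
    unfolding x_def by (rule LIMSEQ_Suc[OF lim_const_over_n])
  have Gx: "(\<lambda>n. G (x n)) \<longlonglongrightarrow> G 0"
    by (rule continuous_on_tendsto_compose[OF G x0]) (use x b in \<open>auto intro!: always_eventually less_imp_le\<close>)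
  \<comment> \<open>The value of the antiderivative at 0 is its limit along one sequence.\<close>
  have "Cauchy (\<lambda>n. I (x n))"
  proof (rule metric_CauchyI)
    fix e :: real assume "0 < e"
    then obtain N where "\<And>m n. m \<ge> N \<Longrightarrow> n \<ge> N \<Longrightarrow> dist (G (x m)) (G (x n)) < e"
      using LIMSEQ_imp_Cauchy[OF Gx] metric_CauchyD by metis
    then have "dist (I (x m)) (I (x n)) < e" if "m \<ge> N" "n \<ge> N" for m n
      using inc'[OF x(1) x(1) x(2) x(2), of m n] that
      by (metis dist_commute dist_norm dist_real_def order.strict_trans1)
    then show "\<exists>N. \<forall>m\<ge>N. \<forall>n\<ge>N. dist (I (x m)) (I (x n)) < e" by blast
  qed
  then obtain L where L: "(\<lambda>n. I (x n)) \<longlonglongrightarrow> L" using Cauchy_convergent_iff convergent_def by blast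
  have IL: "norm (I r - L) \<le> \<bar>G 0 - G r\<bar>" if "0 < r" "r \<le> b" for r
    by (rule LIMSEQ_le[OF tendsto_norm[OF tendsto_diff[OF tendsto_const L]]
          tendsto_rabs[OF tendsto_diff[OF Gx tendsto_const]]])
      (use inc' x that in auto)
  define F where "F r = - (if r = 0 then L else I r)" for r
  have "continuous_on {0..b} F"
    unfolding continuous_on_eq_continuous_within
  proof
    fix r assume r: "r \<in> {0..b}"
    show "continuous (at r within {0..b}) F"
    proof (cases "r = 0")
      case True
      have "((\<lambda>r. \<bar>G 0 - G r\<bar>) \<longlongrightarrow> \<bar>G 0 - G 0\<bar>) (at 0 within {0..b})"
        using G b by (intro tendsto_intros) (simp add: continuous_on_def)
      then have "((\<lambda>r. \<bar>G 0 - G r\<bar>) \<longlongrightarrow> 0) (at 0 within {0..b})" by simp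
      moreover have "\<forall>\<^sub>F r in at 0 within {0..b}. norm (F r - F 0) \<le> \<bar>G 0 - G r\<bar>"
        using IL by (auto simp: F_def eventually_at_topological norm_minus_commute intro!: exI[of _ UNIV])
      ultimately have "((\<lambda>r. F r - F 0) \<longlongrightarrow> 0) (at 0 within {0..b})"
        by (rule Lim_null_comparison[rotated])
      then show ?thesis using True LIM_zero_cancel by (auto simp: continuous_within)
    next
      case False
      then have r0: "0 < r" using r by auto
      have "(I has_vector_derivative - f r) (at r within {r/2..b})"
        unfolding I_def by (rule integral_has_vector_derivative'[OF fc]) (use r0 r in auto)
      then have "continuous (at r within {r/2..b}) I"
        by (rule has_vector_derivative_continuous)
      then have "continuous (at r within {r/2..b}) F"
        by (rule continuous_transform_within[OF continuous_minus, of _ _ _ 1])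
          (use r0 r in \<open>auto simp: F_def\<close>)
      moreover have "at r within {0..b} = at r within {r/2..b}"
        by (rule at_within_nhd[of _ "{r/2<..}"]) (use r0 in auto)
      ultimately show ?thesis by simp
    qed
  qed
  moreover have "(F has_vector_derivative f r) (at r)" if "r \<in> {0<..<b}" for r
  proof -
    have "((\<lambda>u. - I u) has_vector_derivative - (- f r)) (at r within {r/2..b})"
      unfolding I_def
      by (intro has_vector_derivative_minus integral_has_vector_derivative'[OF fc]) (use that in auto)
    then have "((\<lambda>u. - I u) has_vector_derivative f r) (at r within {r/2<..<b})"
      by (auto intro: has_vector_derivative_within_subset)
    then have "((\<lambda>u. - I u) has_vector_derivative f r) (at r)"
      using that by (subst (asm) at_within_open) auto
    then show ?thesis
      by (rule has_vector_derivative_transform_within_open[where S="{0<..<b}"])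
        (use that in \<open>auto simp: F_def\<close>)
  qed
  ultimately have "(f has_integral F b - F 0) {0..b}"
    using b by (intro fundamental_theorem_of_calculus_interior) auto
  then show ?thesis by blast
qed

lemma integrable_on_halfline_dominated:
  fixes f :: "real \<Rightarrow> 'b::banach"
  assumes f: "continuous_on {0<..} f" and g: "g integrable_on {0<..}"
    and le: "\<And>t. 0 < t \<Longrightarrow> norm (f t) \<le> g t"
  shows "f integrable_on {0<..}"
proof (rule integrable_on_all_intervals_integrable_bound[OF _ _ g])
  fix a b :: real
  have f0: "f integrable_on {0..b}" if "0 < b"
  proof (rule integrable_on_Icc_dominated[OF that])
    have "(\<lambda>t. if t \<in> {0<..} then g t else 0) integrable_on {0..b}"
      using integrable_on_subinterval[OF integrable_restrict_UNIV[THEN iffD2, OF g], of 0 b] by simp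
    then show "(\<lambda>t. if 0 < t then g t else 0) integrable_on {0..b}" by simp
  qed (use le in \<open>auto intro: continuous_on_subset[OF f]\<close>)
  have "f integrable_on ({0<..} \<inter> {a..b})"
  proof (cases "0 < a \<or> b \<le> 0")
    case True
    then show ?thesis
    proof
      assume "0 < a"
      then have "{0<..} \<inter> {a..b} = {a..b}" by auto
      then show ?thesis
        using \<open>0 < a\<close> by (auto intro!: integrable_continuous_real continuous_on_subset[OF f])
    next
      assume "b \<le> 0"
      then have "{0<..} \<inter> {a..b} = {}" by auto
      then show ?thesis by (simp add: integrable_on_empty)
    qed
  next
    case False
    then have ab: "a \<le> 0" "0 < b" by auto
    have 1: "negligible {t \<in> {0..b} - ({0<..} \<inter> {a..b}). f t \<noteq> 0}"
      by (rule negligible_subset[of "{0}"]) (use ab in auto)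
    have 2: "negligible {t \<in> {0<..} \<inter> {a..b} - {0..b}. f t \<noteq> 0}"
      by (rule negligible_subset[of "{}"]) auto
    show ?thesis
      by (rule integrable_spike_set[OF f0[OF ab(2)] 1 2])
  qed
  then show "(\<lambda>x. if x \<in> {0<..} then f x else 0) integrable_on cbox a b"
    unfolding integrable_restrict_Int box_real .
qed (use le in auto)

section \<open>Gamma densities\<close>

text \<open>The density on the positive half-line with Laplace transform \<open>z \<mapsto> (p + z) powr - a\<close>; it is extended by 0 so that
  convolutions can be integrated over the whole line.\<close>

definition kern :: "real \<Rightarrow> real \<Rightarrow> real \<Rightarrow> real" where
  "kern p a t = (if 0 < t then t powr (a - 1) * exp (- (p * t)) / Gamma a else 0)"

lemma kern_nonneg: "a > 0 \<Longrightarrow> 0 \<le> kern p a t"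
  by (auto simp: kern_def Gamma_real_pos less_imp_le)

lemma kern_measurable [measurable]: "kern p a \<in> borel_measurable borel"
  unfolding kern_def by measurable

lemma kern_continuous: "continuous_on {0<..} (kern p a)"
proof -
  have "continuous_on {0<..} (\<lambda>t. t powr (a - 1) * exp (- (p * t)) / Gamma a)"
    unfolding divide_inverse by (intro continuous_intros) auto
  then show ?thesis by (rule continuous_on_eq) (auto simp: kern_def)
qed

lemma has_bochner_integral_kern:
  assumes "p > 0" "a > 0"
  shows "has_bochner_integral lborel (kern p a) (p powr - a)"
proof -
  \<comment> \<open>The Gamma integral, after the substitution of \<open>p t\<close> for \<open>t\<close>.\<close>
  have "has_bochner_integral lborel (\<lambda>t. indicator {0..} t * t powr (a - 1) / exp t) (Gamma a)"
    by (rule has_bochner_integral_nn_integral)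
      (use Gamma_conv_nn_integral_real[OF assms(2)] Gamma_real_pos[OF assms(2)] in auto)
  then have "has_bochner_integral lborel
      (\<lambda>t. indicator {0..} (0 + p * t) * (0 + p * t) powr (a - 1) / exp (0 + p * t)) (Gamma a / \<bar>p\<bar>)"
    using lborel_has_bochner_integral_real_affine_iff[of p "\<lambda>t. indicator {0..} t * t powr (a - 1) / exp t" "Gamma a" 0]
      assms by (simp add: divide_inverse mult.commute)
  then have "has_bochner_integral lborel
      (\<lambda>t. (p powr (1 - a) / Gamma a) * (indicator {0..} (0 + p * t) * (0 + p * t) powr (a - 1) / exp (0 + p * t)))
      ((p powr (1 - a) / Gamma a) * (Gamma a / \<bar>p\<bar>))"
    by (intro has_bochner_integral_mult_right) auto
  moreover have "(\<lambda>t. (p powr (1 - a) / Gamma a) * (indicator {0..} (0 + p * t) * (0 + p * t) powr (a - 1) / exp (0 + p * t))) = kern p a"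
  proof
    fix t
    have "p powr (1 - a) * (p * t) powr (a - 1) = t powr (a - 1)" if "t > 0"
      using that assms by (simp add: powr_mult flip: powr_add mult.assoc)
    then show "(p powr (1 - a) / Gamma a) * (indicator {0..} (0 + p * t) * (0 + p * t) powr (a - 1) / exp (0 + p * t)) = kern p a t"
      using assms by (cases t "0::real" rule: linorder_cases)
        (auto simp: kern_def indicator_def exp_minus field_simps zero_le_mult_iff)
  qed
  moreover have "(p powr (1 - a) / Gamma a) * (Gamma a / \<bar>p\<bar>) = p powr - a"
    using assms(1) Gamma_real_pos[OF assms(2), THEN less_imp_neq]
    by (simp add: powr_diff powr_minus field_simps)
  ultimately show ?thesis by simp
qed

lemma has_integral_halfline_of_lborel:
  fixes f :: "real \<Rightarrow> real"
  assumes "has_bochner_integral lborel f I" "\<And>t. t \<le> 0 \<Longrightarrow> f t = 0"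
  shows "(f has_integral I) {0<..}"
proof -
  have "(f has_integral I) UNIV"
    using has_integral_integral_lborel assms(1) by (auto simp: has_bochner_integral_iff)
  moreover have "(\<lambda>t. if t \<in> {0<..} then f t else 0) = f"
    using assms(2) by (auto simp: not_less)
  ultimately show ?thesis by (metis has_integral_restrict_UNIV)
qed

lemma has_integral_kern:
  assumes "p > 0" "a > 0"
  shows "(kern p a has_integral p powr - a) {0<..}"
  by (rule has_integral_halfline_of_lborel[OF has_bochner_integral_kern[OF assms]]) (simp add: kern_def)

lemma integral_halfline_limit:
  fixes f :: "real \<Rightarrow> 'b::banach"
  assumes "f integrable_on {0<..}"
  shows "(\<lambda>n. integral {0..real n} f) \<longlonglongrightarrow> integral {0<..} f"
proof (rule LIMSEQ_I)
  fix e :: real assume "e > 0"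
  let ?f = "\<lambda>x. if x \<in> {0<..} then f x else 0"
  obtain B where "B > 0" and B: "\<And>a b. ball 0 B \<subseteq> cbox a b \<Longrightarrow>
      norm (integral (cbox a b) ?f - integral {0<..} f) < e"
    using integrable_integral[OF assms] \<open>e > 0\<close> unfolding has_integral_alt' by metis
  have "norm (integral {0..real n} f - integral {0<..} f) < e" if "n \<ge> nat \<lceil>B\<rceil>" for n
  proof -
    have "ball 0 B \<subseteq> cbox (- real n) (real n)"
      using that by (auto simp: dist_real_def abs_if split: if_splits)
    then have "norm (integral (cbox (- real n) (real n)) ?f - integral {0<..} f) < e" by (rule B)
    moreover have "integral (cbox (- real n) (real n)) ?f = integral ({0<..} \<inter> {- real n..real n}) f"
      unfolding integral_restrict_Int box_real ..
    moreover have "\<dots> = integral {0..real n} f"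
    proof (rule integral_spike_set)
      show "negligible {x \<in> {0<..} \<inter> {- real n..real n} - {0..real n}. f x \<noteq> 0}"
        by (rule negligible_subset[of "{}"]) auto
      show "negligible {x \<in> {0..real n} - {0<..} \<inter> {- real n..real n}. f x \<noteq> 0}"
        by (rule negligible_subset[of "{0}"]) auto
    qed
    ultimately show ?thesis by simp
  qed
  then show "\<exists>N. \<forall>n\<ge>N. norm (integral {0..real n} f - integral {0<..} f) < e" by blast
qed

context bounded_semigroup
begin

section \<open>Negative powers as Gamma integrals of the semigroup\<close>

text \<open>Every \<open>L\<^sup>1\<close> function on the half-line that is continuous there yields a bounded operator; differences of Gamma
  densities enter through this estimate as well.\<close>

lemma kernel_integral:
  fixes f :: "real \<Rightarrow> real"
  assumes f: "continuous_on {0<..} f" and I: "((\<lambda>t. \<bar>f t\<bar>) has_integral I) {0<..}"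
  shows "(\<lambda>t. f t *\<^sub>R T t x) integrable_on {0<..}"
    and "norm (integral {0<..} (\<lambda>t. f t *\<^sub>R T t x)) \<le> I * (M * norm x)"
proof -
  have g: "((\<lambda>t. \<bar>f t\<bar> * (M * norm x)) has_integral I * (M * norm x)) {0<..}"
    by (rule has_integral_mult_left[OF I])
  have le: "norm (f t *\<^sub>R T t x) \<le> \<bar>f t\<bar> * (M * norm x)" if "0 < t" for t
    using T_bound[of t x] that by (auto intro!: mult_left_mono)
  show 1: "(\<lambda>t. f t *\<^sub>R T t x) integrable_on {0<..}"
  proof (rule integrable_on_halfline_dominated[OF _ has_integral_integrable[OF g] le])
    show "continuous_on {0<..} (\<lambda>t. f t *\<^sub>R T t x)"
      by (intro continuous_intros f continuous_on_subset[OF T_continuous]) auto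
  qed
  show "norm (integral {0<..} (\<lambda>t. f t *\<^sub>R T t x)) \<le> I * (M * norm x)"
    using Henstock_Kurzweil_Integration.integral_norm_bound_integral
      [OF 1 has_integral_integrable[OF g]] le integral_unique[OF g] by auto
qed

text \<open>The operator \<open>(p + A)\<^sup>-\<^sup>a\<close>.\<close>

definition K :: "real \<Rightarrow> real \<Rightarrow> 'a \<Rightarrow> 'a" where
  "K p a x = integral {0<..} (\<lambda>t. kern p a t *\<^sub>R T t x)"

lemma kern_abs_integral: "p > 0 \<Longrightarrow> a > 0 \<Longrightarrow> ((\<lambda>t. \<bar>kern p a t\<bar>) has_integral p powr - a) {0<..}"
  using has_integral_kern kern_nonneg by simp

lemma K_has_integral:
  assumes "p > 0" "a > 0"
  shows "((\<lambda>t. kern p a t *\<^sub>R T t x) has_integral K p a x) {0<..}"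
  unfolding K_def
  by (rule integrable_integral[OF kernel_integral(1)[OF kern_continuous kern_abs_integral[OF assms]]])

lemma K_bound: "p > 0 \<Longrightarrow> a > 0 \<Longrightarrow> norm (K p a x) \<le> M * p powr - a * norm x"
  using kernel_integral(2)[OF kern_continuous kern_abs_integral, of p a x]
  by (simp add: K_def mult_ac)

lemma K_unique: "p > 0 \<Longrightarrow> a > 0 \<Longrightarrow>
    ((\<lambda>t. kern p a t *\<^sub>R T t x) has_integral y) {0<..} \<Longrightarrow> K p a x = y"
  using K_has_integral has_integral_unique by blast

lemma K_clinear:
  assumes "p > 0" "a > 0"
  shows "bounded_clinear (K p a)"
proof (rule bounded_clinearI)
  fix x y :: 'a and c :: complex
  have "((\<lambda>t. kern p a t *\<^sub>R T t (x + y)) has_integral K p a x + K p a y) {0<..}"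
    by (rule has_integral_eq[OF _ has_integral_add[OF K_has_integral[OF assms] K_has_integral[OF assms]]])
      (simp add: bounded_clinearD[OF T_clinear] scaleR_add_right)
  then show "K p a (x + y) = K p a x + K p a y" by (rule K_unique[OF assms])
  have "((\<lambda>t. kern p a t *\<^sub>R T t (c *\<^sub>C x)) has_integral c *\<^sub>C K p a x) {0<..}"
    by (rule has_integral_eq[OF _ has_integral_linear[OF K_has_integral[OF assms] scaleC.bounded_linear_right]])
      (simp add: bounded_clinearD[OF T_clinear] scaleC.scaleR_right)
  then show "K p a (c *\<^sub>C x) = c *\<^sub>C K p a x" by (rule K_unique[OF assms])
  show "norm (K p a x) \<le> norm x * (M * p powr - a)"
    using K_bound[OF assms] by (simp add: mult_ac)
qed

lemma K_commute:
  assumes "p > 0" "a > 0" "bounded_linear S" "\<And>t x. t \<ge> 0 \<Longrightarrow> S (T t x) = T t (S x)"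
  shows "S (K p a x) = K p a (S x)"
proof -
  interpret S: bounded_linear S by fact
  have "((\<lambda>t. kern p a t *\<^sub>R T t (S x)) has_integral S (K p a x)) {0<..}"
    by (rule has_integral_eq[OF _ has_integral_linear[OF K_has_integral[OF assms(1,2)] assms(3)]])
      (use assms(4) S.scaleR in auto)
  then show ?thesis using K_unique[OF assms(1,2)] by simp
qed

section \<open>The resolvent\<close>

text \<open>Multiplying orbits by \<open>exp (- z t)\<close> adds \<open>z\<close> to \<open>A\<close>. This reduces resolvents at complex points to
  resolvents at real ones, and shifts of \<open>A\<close> to \<open>A\<close>.\<close>

lemma rescaled:
  assumes "Re z \<ge> 0"
  shows "bounded_semigroup (\<lambda>t x. exp (- (z * of_real t)) *\<^sub>C T t x) (op_shift z A) M"
proof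
  let ?S = "\<lambda>t x. exp (- (z * of_real t)) *\<^sub>C T t x"
  show "bounded_clinear (?S t)" if "t \<ge> 0" for t
    by (rule bounded_clinear_scaleC[OF T_clinear[OF that]])
  show "?S 0 x = x" for x by (simp add: T_0)
  show "?S (s + t) x = ?S s (?S t x)" if "s \<ge> 0" "t \<ge> 0" for s t x
  proof -
    have "exp (- (z * of_real (s + t))) = exp (- (z * of_real s)) * exp (- (z * of_real t))"
      by (simp add: ring_distribs flip: exp_add)
    then show ?thesis
      using that by (simp only: T_add bounded_clinearD(3)[OF T_clinear] scaleC_scaleC)
  qed
  have "((\<lambda>t. exp (- (z * of_real t)) *\<^sub>C T t x) \<longlongrightarrow> exp (- (z * of_real 0)) *\<^sub>C x) (at_right 0)" for x
    by (intro scaleC.tendsto T_at_0 tendsto_intros)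
  then show "((\<lambda>t. ?S t x) \<longlongrightarrow> x) (at_right 0)" for x by simp
  show "1 \<le> M" by (rule M_ge_1)
  show "norm (?S t x) \<le> M * norm x" if "t \<ge> 0" for t x
  proof -
    have "exp (- (Re z * t)) * norm (T t x) \<le> 1 * (M * norm x)"
      using assms that by (intro mult_mono T_bound) auto
    then show ?thesis by (simp add: norm_scaleC)
  qed
  have q: "((\<lambda>h. (exp (w * of_real h) - 1) / of_real h) \<longlongrightarrow> w) (at_right (0::real))" for w :: complex
  proof -
    have "((\<lambda>h::real. exp (w * of_real h)) has_vector_derivative w * exp (w * of_real 0)) (at 0 within {0<..})"
      by (rule has_vector_derivative_real_field) (auto intro!: derivative_eq_intros)
    then have "((\<lambda>h::real. (exp (w * of_real h) - 1 - h *\<^sub>R w) /\<^sub>R norm h + w) \<longlongrightarrow> 0 + w) (at_right 0)"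
      by (intro tendsto_add tendsto_const) (auto simp: has_vector_derivative_def has_derivative_at_within)
    then show ?thesis
      unfolding add_0_left
      by (rule tendsto_at_right_transform)
        (simp add: scaleR_conv_of_real divide_inverse algebra_simps)
  qed
  have D: "(\<lambda>h. (exp (w * of_real h) *\<^sub>C v h - x) /\<^sub>R h) = (\<lambda>h. exp (w * of_real h) *\<^sub>C ((v h - x) /\<^sub>R h) +
      ((exp (w * of_real h) - 1) / of_real h) *\<^sub>C x)" for w and v :: "real \<Rightarrow> 'a" and x
  proof
    fix h :: real
    have "((exp (w * of_real h) - 1) / of_real h) *\<^sub>C x = (exp (w * of_real h) *\<^sub>C x - x) /\<^sub>R h"
      by (simp add: divide_inverse mult.commute scaleC.diff_left scaleC_of_real
          flip: scaleC_scaleC of_real_inverse)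
    then show "(exp (w * of_real h) *\<^sub>C v h - x) /\<^sub>R h = exp (w * of_real h) *\<^sub>C ((v h - x) /\<^sub>R h) +
      ((exp (w * of_real h) - 1) / of_real h) *\<^sub>C x"
      by (simp add: scaleC.scaleR_right scaleC.diff_right flip: scaleR_add_right)
  qed
  have lim: "((\<lambda>h. (exp (w * of_real h) *\<^sub>C v h - x) /\<^sub>R h) \<longlongrightarrow> u + w *\<^sub>C x) (at_right 0)"
    if "((\<lambda>h. (v h - x) /\<^sub>R h) \<longlongrightarrow> u) (at_right 0)" for w and v :: "real \<Rightarrow> 'a" and x u
  proof -
    have "((\<lambda>h. exp (w * of_real h) *\<^sub>C ((v h - x) /\<^sub>R h) +
      ((exp (w * of_real h) - 1) / of_real h) *\<^sub>C x) \<longlongrightarrow> exp (w * of_real 0) *\<^sub>C u + w *\<^sub>C x) (at_right 0)"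
      by (intro tendsto_add scaleC.tendsto tendsto_const that q tendsto_intros)
    then have "((\<lambda>h. exp (w * of_real h) *\<^sub>C ((v h - x) /\<^sub>R h) +
      ((exp (w * of_real h) - 1) / of_real h) *\<^sub>C x) \<longlongrightarrow> u + w *\<^sub>C x) (at_right 0)" by simp
    then show ?thesis by (simp only: D)
  qed
  have "((\<lambda>h. (?S h x - x) /\<^sub>R h) \<longlongrightarrow> v) (at_right 0) \<longleftrightarrow> (x, v) \<in> op_neg (op_shift z A)" for x v
  proof -
    have "(x, v) \<in> op_neg (op_shift z A) \<longleftrightarrow> (x, - v) \<in> op_shift z A"
      by (auto simp: op_neg_def) (metis minus_minus)
    also have "\<dots> \<longleftrightarrow> ((\<lambda>h. (T h x - x) /\<^sub>R h) \<longlongrightarrow> v + z *\<^sub>C x) (at_right 0)"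
      by (simp add: op_shift_iff in_A_iff add.commute)
    also have "\<dots> \<longleftrightarrow> ((\<lambda>h. (?S h x - x) /\<^sub>R h) \<longlongrightarrow> v) (at_right 0)"
    proof
      assume "((\<lambda>h. (T h x - x) /\<^sub>R h) \<longlongrightarrow> v + z *\<^sub>C x) (at_right 0)"
      from lim[OF this, of "- z"] show "((\<lambda>h. (?S h x - x) /\<^sub>R h) \<longlongrightarrow> v) (at_right 0)"
        by (simp add: scaleC.minus_left)
    next
      assume "((\<lambda>h. (?S h x - x) /\<^sub>R h) \<longlongrightarrow> v) (at_right 0)"
      from lim[OF this, of z] show "((\<lambda>h. (T h x - x) /\<^sub>R h) \<longlongrightarrow> v + z *\<^sub>C x) (at_right 0)"
        by (simp add: scaleC_scaleC flip: exp_add)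
    qed
    finally show ?thesis by simp
  qed
  then show "generator ?S = op_neg (op_shift z A)" by (auto simp: generator_def)
qed

text \<open>Both inverse properties come from letting \<open>t\<close> tend to infinity in \<open>x - S t x = \<integral>S u y\<close> for the rescaled
  semigroup \<open>S\<close>, whose orbits decay.\<close>

lemma resolvent_real:
  assumes p: "p > 0"
  shows "(op_shift (of_real p) A)\<inverse> = graph_of (K p 1)"
proof -
  let ?S = "\<lambda>t x. exp (- (of_real p * of_real t)) *\<^sub>C T t x"
  interpret S: bounded_semigroup ?S "op_shift (of_real p) A" M
    by (rule rescaled) (use p in simp)
  have S: "?S t x = exp (- (p * t)) *\<^sub>R T t x" for t x
    by (metis exp_of_real of_real_minus of_real_mult scaleC_of_real)
  have f: "((\<lambda>t. ?S t x) has_integral K p 1 x) {0<..}" for x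
    by (rule has_integral_eq[OF _ K_has_integral[OF p zero_less_one]]) (simp add: S kern_def)
  have I: "(\<lambda>n. integral {0..real n} (\<lambda>t. ?S t x)) \<longlonglongrightarrow> K p 1 x" for x
    using integral_halfline_limit[OF has_integral_integrable[OF f]] integral_unique[OF f] by simp
  have S0: "(\<lambda>n. ?S (real n) x) \<longlonglongrightarrow> 0" for x
  proof (rule Lim_null_comparison[OF always_eventually[OF allI]])
    show "norm (?S (real n) x) \<le> exp (- p) ^ n * (M * norm x)" for n
      unfolding S norm_scaleR using T_bound[of "real n" x]
      by (simp add: mult_left_mono mult.commute flip: exp_of_nat_mult)
    have "(\<lambda>n. exp (- p) ^ n * (M * norm x)) \<longlonglongrightarrow> 0 * (M * norm x)"
      by (intro tendsto_intros LIMSEQ_realpow_zero) (use p in auto)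
    then show "(\<lambda>n. exp (- p) ^ n * (M * norm x)) \<longlonglongrightarrow> 0" by simp
  qed
  have 1: "(K p 1 y, y) \<in> op_shift (of_real p) A" for y
  proof (rule S.A_closed[OF S.integral_in_A I])
    show "(\<lambda>n. y - ?S (real n) y) \<longlonglongrightarrow> y" using tendsto_diff[OF tendsto_const S0] by simp
  qed simp
  have 2: "x = K p 1 y" if "(x, y) \<in> op_shift (of_real p) A" for x y
  proof -
    have "(\<lambda>n. integral {0..real n} (\<lambda>t. ?S t y)) \<longlonglongrightarrow> x - 0"
      using tendsto_diff[OF tendsto_const S0, of x x] by (simp only: S.T_minus_id[OF that] of_nat_0_le_iff)
    then have "x - 0 = K p 1 y" by (rule LIMSEQ_unique[OF _ I])
    then show ?thesis by simp
  qed
  have "(y, x) \<in> (op_shift (of_real p) A)\<inverse> \<longleftrightarrow> x = K p 1 y" for x y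
    unfolding converse_iff using 1[of y] 2[of x y] by metis
  then show ?thesis unfolding graph_of_def by (intro set_eqI) (auto simp only: split_paired_all mem_Collect_eq prod.inject)
qed

end

section \<open>The semigroup law and the Balakrishnan integral of negative powers\<close>

lemma has_bochner_integral_Beta:
  assumes "a > 0" "b > (0::real)"
  shows "has_bochner_integral lborel
    (\<lambda>t. indicator {0<..<1} t * (t powr (a - 1) * (1 - t) powr (b - 1))) (Beta a b)"
proof -
  let ?f = "\<lambda>t. t powr (a - 1) * (1 - t) powr (b - 1)"
  have i: "integrable lborel (\<lambda>t. indicator {0..1} t *\<^sub>R ?f t)"
    using integrable_Beta[OF assms] by (simp add: set_integrable_def)
  have "(LINT t|lborel. indicator {0..1} t *\<^sub>R ?f t) = Beta a b"
    using set_borel_integral_eq_integral(2)[OF integrable_Beta[OF assms]]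
      integral_unique[OF has_integral_Beta_real[OF assms]]
    by (simp add: set_lebesgue_integral_def)
  then have "has_bochner_integral lborel (\<lambda>t. indicator {0..1} t *\<^sub>R ?f t) (Beta a b)"
    using i by (simp add: has_bochner_integral_iff)
  then show ?thesis
    by (rule has_bochner_integral_cong[THEN iffD1, rotated -1]) (auto simp: indicator_def)
qed

text \<open>After the substitution \<open>s = u v\<close> the convolution is the Beta integral.\<close>

lemma has_bochner_integral_kern_convolution:
  assumes "p > 0" "a > 0" "b > 0"
  shows "has_bochner_integral lborel (\<lambda>s. kern p a s * kern p b (u - s)) (kern p (a + b) u)"
proof (cases "u > 0")
  case False
  then have "(\<lambda>s. kern p a s * kern p b (u - s)) = (\<lambda>s. 0)" by (auto simp: kern_def)
  then show ?thesis using False by (simp add: kern_def has_bochner_integral_zero)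
next
  case u: True
  define C where "C = u powr (a + b - 2) * exp (- (p * u)) / (Gamma a * Gamma b)"
  have G: "Gamma a > 0" "Gamma b > 0" "Gamma (a + b) > 0" using assms by (auto intro: Gamma_real_pos)
  have "kern p a (0 + u * v) * kern p b (u - (0 + u * v))
    = C * (indicator {0<..<1} v * (v powr (a - 1) * (1 - v) powr (b - 1)))" for v
  proof (cases "v \<in> {0<..<1}")
    case True
    have 1: "u - u * v = u * (1 - v)" by (simp add: algebra_simps)
    have 2: "exp (- (p * (u * v))) * exp (- (p * (u * (1 - v)))) = exp (- (p * u))"
      by (simp add: algebra_simps flip: exp_add)
    have "(u * v) powr (a - 1) * (u * (1 - v)) powr (b - 1)
      = (u powr (a - 1) * u powr (b - 1)) * (v powr (a - 1) * (1 - v) powr (b - 1))"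
      using True u by (simp add: powr_mult mult_ac)
    also have "u powr (a - 1) * u powr (b - 1) = u powr (a + b - 2)"
      by (simp flip: powr_add)
    finally have 3: "(u * v) powr (a - 1) * (u * (1 - v)) powr (b - 1)
      = u powr (a + b - 2) * (v powr (a - 1) * (1 - v) powr (b - 1))" .
    have "kern p a (u * v) * kern p b (u * (1 - v))
      = ((u * v) powr (a - 1) * (u * (1 - v)) powr (b - 1))
        * (exp (- (p * (u * v))) * exp (- (p * (u * (1 - v))))) / (Gamma a * Gamma b)"
      using True u by (simp add: kern_def)
    then show ?thesis using True unfolding 2 3 by (simp add: C_def 1)
  next
    case False
    then have "kern p a (0 + u * v) * kern p b (u - (0 + u * v)) = 0"
      using u by (auto simp: kern_def zero_less_mult_iff)
    then show ?thesis using False by simp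
  qed
  then have "has_bochner_integral lborel
      (\<lambda>v. kern p a (0 + u * v) * kern p b (u - (0 + u * v))) (C * Beta a b)"
    using has_bochner_integral_mult_right[of C, OF has_bochner_integral_Beta[OF assms(2,3)]] by simp
  moreover have "C * Beta a b = kern p (a + b) u /\<^sub>R \<bar>u\<bar>"
    using u G by (simp add: C_def kern_def Beta_def powr_diff field_simps power2_eq_square)
  ultimately show ?thesis
    using lborel_has_bochner_integral_real_affine_iff[of u "\<lambda>s. kern p a s * kern p b (u - s)" _ 0] u
    by simp
qed

text \<open>The scalar form of Fubini's theorem used for both operator identities below: a bounded orbit function is
  integrated against a nonnegative kernel with integrable marginal.\<close>

lemma Fubini_weighted:
  fixes k :: "real \<Rightarrow> real \<Rightarrow> real"
  assumes [measurable]: "case_prod k \<in> borel_measurable (lborel \<Otimes>\<^sub>M lborel)"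
    "\<phi> \<in> borel_measurable lborel"
    and nonneg: "\<And>r t. 0 \<le> k r t" and bound: "\<And>t. \<bar>\<phi> t\<bar> \<le> B"
    and c: "\<And>t. has_bochner_integral lborel (\<lambda>r. k r t) (c t)" "integrable lborel c"
  shows "integrable lborel (\<lambda>r. LINT t|lborel. k r t * \<phi> t)"
    and "(LINT r|lborel. LINT t|lborel. k r t * \<phi> t) = (LINT t|lborel. c t * \<phi> t)"
proof -
  have k[measurable]: "(\<lambda>x. k (fst x) (snd x)) \<in> borel_measurable (lborel \<Otimes>\<^sub>M lborel)"
    using assms(1) by (simp add: case_prod_beta)
  have k'[measurable]: "(\<lambda>x. k (snd x) (fst x)) \<in> borel_measurable (lborel \<Otimes>\<^sub>M lborel)"
    using measurable_compose[OF measurable_pair_swap'[of lborel lborel] assms(1)]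
    by (simp add: case_prod_beta)
  have "integrable (lborel \<Otimes>\<^sub>M lborel) (\<lambda>x. k (snd x) (fst x) * \<phi> (fst x))"
  proof (rule lborel_pair.Fubini_integrable)
    show "(\<lambda>x. k (snd x) (fst x) * \<phi> (fst x)) \<in> borel_measurable (lborel \<Otimes>\<^sub>M lborel)"
      by measurable
    show "AE t in lborel. integrable lborel (\<lambda>r. k (snd (t, r)) (fst (t, r)) * \<phi> (fst (t, r)))"
      using c(1) by (auto intro!: AE_I2 integrable_mult_left simp: has_bochner_integral_iff)
    have "(LINT r|lborel. norm (k (snd (t, r)) (fst (t, r)) * \<phi> (fst (t, r)))) = c t * \<bar>\<phi> t\<bar>" for t
      using c(1)[of t] nonneg by (simp add: abs_mult has_bochner_integral_iff)
    moreover have "integrable lborel (\<lambda>t. c t * \<bar>\<phi> t\<bar>)"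
    proof (rule Bochner_Integration.integrable_bound)
      show "integrable lborel (\<lambda>t. B * c t)" using c(2) by simp
      show "(\<lambda>t. c t * \<bar>\<phi> t\<bar>) \<in> borel_measurable lborel"
        using c(2) by (intro borel_measurable_times borel_measurable_abs assms(2)) auto
      show "AE t in lborel. norm (c t * \<bar>\<phi> t\<bar>) \<le> norm (B * c t)"
      proof (rule AE_I2)
        fix t
        have "\<bar>c t\<bar> * \<bar>\<phi> t\<bar> \<le> \<bar>c t\<bar> * \<bar>B\<bar>"
          by (rule mult_left_mono) (use bound[of t] in auto)
        then show "norm (c t * \<bar>\<phi> t\<bar>) \<le> norm (B * c t)" by (simp add: abs_mult mult.commute)
      qed
    qed
    ultimately show "integrable lborel (\<lambda>t. LINT r|lborel. norm (k (snd (t, r)) (fst (t, r)) * \<phi> (fst (t, r))))"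
      by simp
  qed
  then have i: "integrable (lborel \<Otimes>\<^sub>M lborel) (\<lambda>(t, r). k r t * \<phi> t)"
    by (simp only: case_prod_beta')
  from lborel_pair.integrable_snd[OF this]
  show "integrable lborel (\<lambda>r. LINT t|lborel. k r t * \<phi> t)" .
  from lborel_pair.Fubini_integral[OF i]
  have "(LINT r|lborel. LINT t|lborel. k r t * \<phi> t) = (LINT t|lborel. LINT r|lborel. k r t * \<phi> t)" .
  also have "\<dots> = (LINT t|lborel. c t * \<phi> t)"
    using c(1) by (intro Bochner_Integration.integral_cong) (auto simp: has_bochner_integral_iff)
  finally show "(LINT r|lborel. LINT t|lborel. k r t * \<phi> t) = (LINT t|lborel. c t * \<phi> t)" .
qed

text \<open>The symmetry behind the Balakrishnan integral: \<open>exp (- r t)\<close> belongs to the density in \<open>t\<close> with rate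
  \<open>p + r\<close>, or to the density in \<open>r\<close> with rate \<open>t\<close>.\<close>

lemma kern_mult_swap:
  assumes "a > 0"
  shows "r powr (a - 1) * kern (p + r) n t * of_bool (r > 0) = Gamma a * kern t a r * kern p n t"
proof -
  have "exp (- ((p + r) * t)) = exp (- (t * r)) * exp (- (p * t))"
    by (simp add: algebra_simps flip: exp_add)
  then show ?thesis using Gamma_real_pos[OF assms] by (simp add: kern_def)
qed

lemma kern_mult_powr:
  assumes "a > 0" "n > a" "t > 0"
  shows "t powr - a * kern p n t = Gamma (n - a) / Gamma n * kern p (n - a) t"
proof -
  have "t powr - a * t powr (n - 1) = t powr (n - a - 1)" by (simp flip: powr_add add: algebra_simps)
  moreover have "Gamma n \<noteq> 0" "Gamma (n - a) \<noteq> 0"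
    using assms by (auto intro!: less_imp_neq[OF Gamma_real_pos, symmetric])
  ultimately show ?thesis using assms by (simp add: kern_def)
qed

text \<open>The dominating functions of all improper integrals below: a power singularity at 0 and a power tail.\<close>

lemma has_integral_powr_split:
  fixes a n s :: real
  assumes "0 < a" "a < n" "0 < s"
  shows "((\<lambda>r. if r \<le> s then C * r powr (a - 1) else D * r powr (a - 1 - n)) has_integral
    C * (s powr a / a) + D * (s powr (a - n) / (n - a))) {0<..}"
proof -
  let ?g = "\<lambda>r. if r \<le> s then C * r powr (a - 1) else D * r powr (a - 1 - n)"
  have "((\<lambda>r. C * r powr (a - 1)) has_integral C * (s powr a / a)) {0..s}"
    using has_integral_mult_right[OF has_integral_powr_from_0[of "a - 1" s], of C] assms by simp
  then have 1: "(?g has_integral C * (s powr a / a)) {0..s}"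
    by (rule has_integral_eq[rotated]) simp
  have "((\<lambda>r. D * r powr (a - 1 - n)) has_integral D * (- (s powr (a - 1 - n + 1)) / (a - 1 - n + 1))) {s..}"
    by (intro has_integral_mult_right has_integral_powr_to_inf) (use assms in auto)
  also have "- (s powr (a - 1 - n + 1)) / (a - 1 - n + 1) = s powr (a - n) / (n - a)"
  proof -
    have e: "a - 1 - n + 1 = a - n" by simp
    show ?thesis unfolding e by (metis minus_diff_eq minus_divide_divide)
  qed
  finally have 2: "(?g has_integral D * (s powr (a - n) / (n - a))) {s..}"
    by (rule has_integral_spike[of "{s}", rotated 2]) auto
  have "negligible ({0..s} \<inter> {s..})" by (rule negligible_subset[of "{s}"]) auto
  moreover have "{0..s} \<union> {s..} = {0..}" using assms(3) by auto
  ultimately have 3: "(?g has_integral C * (s powr a / a) + D * (s powr (a - n) / (n - a))) {0..}"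
    using has_integral_Un[OF 1 2] by simp
  have n1: "negligible {x \<in> {0..} - {0<..}. ?g x \<noteq> 0}"
    by (rule negligible_subset[of "{0}"]) auto
  have n2: "negligible {x \<in> {0<..} - {0..}. ?g x \<noteq> 0}"
    by (rule negligible_subset[of "{}"]) auto
  show ?thesis by (rule iffD1[OF has_integral_spike_set_eq[OF n1 n2] 3])
qed

lemma eq_if_inner_eq:
  fixes x z :: "'b::real_inner"
  assumes "\<And>y. inner x y = inner z y"
  shows "x = z"
  using assms[of "x - z"] by (metis inner_diff_left inner_eq_zero_iff right_minus_eq)

context bounded_semigroup
begin

text \<open>A scalar orbit. Testing against vectors reduces identities between vector-valued integrals to Lebesgue integrals of
  real functions, to which Fubini's theorem applies.\<close>

definition orb :: "'a \<Rightarrow> 'a \<Rightarrow> real \<Rightarrow> real" where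
  "orb x y t = indicator {0..} t * inner (T t x) y"

lemma orb_measurable [measurable]: "orb x y \<in> borel_measurable borel"
proof -
  have "(\<lambda>t. indicator {0..} t *\<^sub>R inner (T t x) y) \<in> borel_measurable borel"
    by (rule borel_measurable_continuous_on_indicator) (auto intro!: continuous_intros T_continuous)
  then show ?thesis by (simp add: orb_def[abs_def])
qed

lemma orb_bound: "\<bar>orb x y t\<bar> \<le> M * norm x * norm y"
proof (cases "t \<ge> 0")
  case True
  have "\<bar>inner (T t x) y\<bar> \<le> norm (T t x) * norm y" by (rule Cauchy_Schwarz_ineq2)
  also have "\<dots> \<le> M * norm x * norm y" by (intro mult_right_mono T_bound True) auto
  finally show ?thesis using True by (simp add: orb_def)
qed (use M_ge_1 in \<open>simp add: orb_def\<close>)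

lemma K_inner:
  assumes "p > 0" "a > 0"
  shows "inner (K p a x) y = (LINT t|lborel. kern p a t * orb x y t)"
proof -
  have i: "integrable lborel (\<lambda>t. kern p a t * orb x y t)"
  proof (rule Bochner_Integration.integrable_bound)
    show "integrable lborel (\<lambda>t. (M * norm x * norm y) * kern p a t)"
      using has_bochner_integral_kern[OF assms] by (simp add: has_bochner_integral_iff)
    show "AE t in lborel. norm (kern p a t * orb x y t) \<le> norm ((M * norm x * norm y) * kern p a t)"
      using orb_bound kern_nonneg[OF assms(2)] M_ge_1
      by (auto simp: abs_mult mult.commute intro!: AE_I2 mult_left_mono)
  qed measurable
  have "((\<lambda>t. kern p a t * orb x y t) has_integral (LINT t|lborel. kern p a t * orb x y t)) {0<..}"
    using i by (intro has_integral_halfline_of_lborel) (auto simp: has_bochner_integral_iff kern_def)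
  moreover have "((\<lambda>t. kern p a t * orb x y t) has_integral inner (K p a x) y) {0<..}"
    by (rule has_integral_eq[OF _ has_integral_linear[OF K_has_integral[OF assms] bounded_linear_inner_left]])
      (simp add: orb_def)
  ultimately show ?thesis by (rule has_integral_unique[rotated])
qed

text \<open>Tested against a vector, the left-hand side is the integral of a scalar orbit against the convolution of two Gamma
  densities; the inner integral is brought to this form by translating the orbit.\<close>

theorem K_add:
  assumes "p > 0" "a > 0" "b > 0"
  shows "K p a (K p b x) = K p (a + b) x"
proof (rule eq_if_inner_eq)
  fix y
  have *: "orb (K p b x) y s = (LINT u|lborel. kern p b (u - s) * orb x y u)" if "s > 0" for s
  proof -
    have "orb (K p b x) y s = inner (K p b (T s x)) y"
      using K_commute[of p b "T s" x] assms that T_commute bounded_clinear_linear[OF T_clinear]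
      by (simp add: orb_def)
    also have "\<dots> = (LINT t|lborel. kern p b t * orb (T s x) y t)"
      by (rule K_inner) (use assms in auto)
    also have "\<dots> = (LINT t|lborel. kern p b (s + 1 * t - s) * orb x y (s + 1 * t))"
      by (rule Bochner_Integration.integral_cong)
        (use that in \<open>auto simp: kern_def orb_def T_add indicator_def T_commute add.commute\<close>)
    also have "\<dots> = (LINT u|lborel. kern p b (u - s) * orb x y u)"
      using lborel_integral_real_affine[of 1 "\<lambda>u. kern p b (u - s) * orb x y u" s] by simp
    finally show ?thesis .
  qed
  have "inner (K p a (K p b x)) y = (LINT s|lborel. kern p a s * orb (K p b x) y s)"
    by (rule K_inner) (use assms in auto)
  also have "\<dots> = (LINT s|lborel. LINT u|lborel. (kern p a s * kern p b (u - s)) * orb x y u)"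
  proof (rule Bochner_Integration.integral_cong)
    fix s :: real
    show "kern p a s * orb (K p b x) y s = (LINT u|lborel. (kern p a s * kern p b (u - s)) * orb x y u)"
      by (cases "s > 0") (simp_all add: * kern_def[of p a] mult.assoc)
  qed simp
  also have "\<dots> = (LINT u|lborel. kern p (a + b) u * orb x y u)"
  proof (rule Fubini_weighted(2))
    show "(\<lambda>(s, u). kern p a s * kern p b (u - s)) \<in> borel_measurable (lborel \<Otimes>\<^sub>M lborel)"
      by measurable
    show "integrable lborel (kern p (a + b))"
      using has_bochner_integral_kern[of p "a + b"] assms by (simp add: has_bochner_integral_iff)
  qed (use assms orb_bound in \<open>auto intro: has_bochner_integral_kern_convolution kern_nonneg mult_nonneg_nonneg\<close>)
  also have "\<dots> = inner (K p (a + b) x) y"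
    by (rule K_inner[symmetric]) (use assms in auto)
  finally show "inner (K p a (K p b x)) y = inner (K p (a + b) x) y" .
qed

text \<open>The density is decreasing in the rate, so the \<open>L\<^sup>1\<close> distance of two densities is the difference of their integrals.\<close>

lemma K_diff_bound:
  assumes "0 < p" "p \<le> q" "a > 0"
  shows "norm (K p a x - K q a x) \<le> (p powr - a - q powr - a) * (M * norm x)"
proof -
  have le: "kern q a t \<le> kern p a t" for t
    using assms Gamma_real_pos[of a] mult_right_mono[of p q t]
    by (auto simp: kern_def divide_right_mono mult_left_mono)
  have k: "((\<lambda>t. \<bar>kern p a t - kern q a t\<bar>) has_integral p powr - a - q powr - a) {0<..}"
    using has_integral_diff[OF has_integral_kern[of p a] has_integral_kern[of q a]] assms le by simp
  have "K p a x - K q a x = integral {0<..} (\<lambda>t. (kern p a t - kern q a t) *\<^sub>R T t x)"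
    using has_integral_diff[OF K_has_integral[of p a x] K_has_integral[of q a x]] assms
    by (simp add: scaleR_diff_left integral_unique)
  then show ?thesis
    using kernel_integral(2)[OF continuous_on_diff[OF kern_continuous kern_continuous] k] by simp
qed

lemma K_continuous:
  assumes "p > 0" "a > 0"
  shows "continuous_on {0<..} (\<lambda>r. K (p + r) a x)"
  unfolding continuous_on_def
proof
  fix r :: real assume r: "r \<in> {0<..}"
  have le: "norm (K (p + s) a x - K (p + r) a x)
      \<le> \<bar>(p + s) powr - a - (p + r) powr - a\<bar> * (M * norm x)" if "s > 0" for s
  proof (cases "s \<le> r")
    case True
    have "norm (K (p + s) a x - K (p + r) a x) \<le> ((p + s) powr - a - (p + r) powr - a) * (M * norm x)"
      by (rule K_diff_bound) (use True r that assms in auto)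
    also have "\<dots> \<le> \<bar>(p + s) powr - a - (p + r) powr - a\<bar> * (M * norm x)"
      using M_ge_1 by (intro mult_right_mono) auto
    finally show ?thesis .
  next
    case False
    have "norm (K (p + r) a x - K (p + s) a x) \<le> ((p + r) powr - a - (p + s) powr - a) * (M * norm x)"
      by (rule K_diff_bound) (use False r that assms in auto)
    also have "\<dots> \<le> \<bar>(p + s) powr - a - (p + r) powr - a\<bar> * (M * norm x)"
      using M_ge_1 by (intro mult_right_mono) auto
    finally show ?thesis by (simp add: norm_minus_commute)
  qed
  have "((\<lambda>s. \<bar>(p + s) powr - a - (p + r) powr - a\<bar> * (M * norm x)) \<longlongrightarrow>
      \<bar>(p + r) powr - a - (p + r) powr - a\<bar> * (M * norm x)) (at r within {0<..})"
    by (intro tendsto_intros) (use r assms in auto)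
  then have 0: "((\<lambda>s. \<bar>(p + s) powr - a - (p + r) powr - a\<bar> * (M * norm x)) \<longlongrightarrow> 0) (at r within {0<..})"
    by simp
  have "((\<lambda>s. K (p + s) a x - K (p + r) a x) \<longlongrightarrow> 0) (at r within {0<..})"
    by (rule Lim_null_comparison[OF _ 0]) (use le in \<open>auto simp: eventually_at_topological intro!: exI[of _ UNIV]\<close>)
  then show "((\<lambda>s. K (p + s) a x) \<longlongrightarrow> K (p + r) a x) (at r within {0<..})"
    by (rule LIM_zero_cancel)
qed

text \<open>The operator form of \<open>\<integral>r powr (a - 1) * (p + r + x) powr - n dr = c * (p + x) powr (a - n)\<close>, where \<open>c\<close> is a Beta value; it
  is obtained by exchanging the \<open>r\<close>-integral with the integral that defines \<open>K\<close>.\<close>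

theorem has_integral_powr_K:
  assumes "p > 0" "0 < a" "a < n"
  shows "((\<lambda>r. r powr (a - 1) *\<^sub>R K (p + r) n w) has_integral
    (Gamma a * Gamma (n - a) / Gamma n) *\<^sub>R K p (n - a) w) {0<..}"
proof -
  let ?f = "\<lambda>r. r powr (a - 1) *\<^sub>R K (p + r) n w"
  have int: "?f integrable_on {0<..}"
  proof (rule integrable_on_halfline_dominated)
    show "continuous_on {0<..} ?f"
      by (intro continuous_intros K_continuous) (use assms in auto)
    let ?C = "M * p powr - n * norm w" and ?D = "M * norm w"
    show "(\<lambda>r. if r \<le> 1 then ?C * r powr (a - 1) else ?D * r powr (a - 1 - n)) integrable_on {0<..}"
      by (rule has_integral_integrable[OF has_integral_powr_split]) (use assms in auto)
    fix r :: real assume r: "0 < r"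
    have "norm (?f r) \<le> r powr (a - 1) * (M * (p + r) powr - n * norm w)"
      using K_bound[of "p + r" n w] assms r by (simp add: mult_left_mono)
    also have "\<dots> \<le> r powr (a - 1) * (M * p powr - n * norm w)"
      using assms r M_ge_1 by (intro mult_left_mono mult_right_mono powr_mono2') auto
    finally have 1: "norm (?f r) \<le> ?C * r powr (a - 1)" by (simp add: mult_ac)
    have "norm (?f r) \<le> r powr (a - 1) * (M * (p + r) powr - n * norm w)"
      using K_bound[of "p + r" n w] assms r by (simp add: mult_left_mono)
    also have "\<dots> \<le> r powr (a - 1) * (M * r powr - n * norm w)"
      using assms r M_ge_1 by (intro mult_left_mono mult_right_mono powr_mono2') auto
    also have "\<dots> = ?D * (r powr (a - 1) * r powr - n)" by simp
    also have "r powr (a - 1) * r powr - n = r powr (a - 1 - n)" by (simp flip: powr_add)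
    finally show "norm (?f r) \<le> (if r \<le> 1 then ?C * r powr (a - 1) else ?D * r powr (a - 1 - n))"
      using 1 by simp
  qed
  have "integral {0<..} ?f = (Gamma a * Gamma (n - a) / Gamma n) *\<^sub>R K p (n - a) w"
  proof (rule eq_if_inner_eq)
    fix y
    let ?k = "\<lambda>r t. Gamma a * kern t a r * kern p n t"
    let ?c = "\<lambda>t. (Gamma a * Gamma (n - a) / Gamma n) * kern p (n - a) t"
    have c: "has_bochner_integral lborel (\<lambda>r. ?k r t) (?c t)" for t
    proof (cases "t > 0")
      case True
      have "has_bochner_integral lborel (\<lambda>r. (Gamma a * kern p n t) * kern t a r) ((Gamma a * kern p n t) * t powr - a)"
        by (intro has_bochner_integral_mult_right has_bochner_integral_kern True assms)
      moreover have "(Gamma a * kern p n t) * t powr - a = ?c t"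
        using kern_mult_powr[of a n t p] assms True by (simp add: mult_ac)
      ultimately show ?thesis by (simp add: mult_ac)
    next
      case False
      then show ?thesis by (simp add: kern_def has_bochner_integral_zero)
    qed
    have eq: "(LINT t|lborel. ?k r t * orb w y t) = of_bool (r > 0) * (r powr (a - 1) * inner (K (p + r) n w) y)" for r
    proof (cases "r > 0")
      case True
      have "(LINT t|lborel. ?k r t * orb w y t) = (LINT t|lborel. r powr (a - 1) * (kern (p + r) n t * orb w y t))"
        using kern_mult_swap[of a r p n, symmetric] assms True by (simp add: mult_ac)
      then show ?thesis using True assms by (simp add: K_inner)
    qed (simp add: kern_def)
    have m: "(\<lambda>(r, t). ?k r t) \<in> borel_measurable (lborel \<Otimes>\<^sub>M lborel)"
      unfolding kern_def by measurable
    have ic: "integrable lborel ?c"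
      using has_bochner_integral_kern[of p "n - a"] assms by (simp add: has_bochner_integral_iff)
    have nn: "0 \<le> ?k r t" for r t
      using assms by (auto intro!: mult_nonneg_nonneg kern_nonneg less_imp_le[OF Gamma_real_pos])
    have om: "orb w y \<in> borel_measurable lborel" by simp
    note F = Fubini_weighted[OF m om nn orb_bound c ic, unfolded eq]
    have "((\<lambda>r. of_bool (r > 0) * (r powr (a - 1) * inner (K (p + r) n w) y)) has_integral
       (LINT t|lborel. ?c t * orb w y t)) {0<..}"
      using F by (intro has_integral_halfline_of_lborel) (auto simp: has_bochner_integral_iff)
    moreover have "((\<lambda>r. of_bool (r > 0) * (r powr (a - 1) * inner (K (p + r) n w) y)) has_integral
       inner (integral {0<..} ?f) y) {0<..}"
      by (rule has_integral_eq[OF _ has_integral_linear[OF integrable_integral[OF int] bounded_linear_inner_left]]) simp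
    ultimately have "inner (integral {0<..} ?f) y = (LINT t|lborel. ?c t * orb w y t)"
      by (rule has_integral_unique[rotated])
    also have "\<dots> = (Gamma a * Gamma (n - a) / Gamma n) * inner (K p (n - a) w) y"
      using assms by (simp add: K_inner mult.assoc)
    finally show "inner (integral {0<..} ?f) y = inner ((Gamma a * Gamma (n - a) / Gamma n) *\<^sub>R K p (n - a) w) y"
      by simp
  qed
  then show ?thesis using integrable_integral[OF int] by simp
qed

section \<open>Resolvents at complex points\<close>

text \<open>With the sign convention of \<open>(z + A)\<^sup>-\<^sup>1\<close>, the half plane \<open>Re z > 0\<close> consists of good points. The value is meaningful for
  \<open>resolvable\<close> points only.\<close>

definition res :: "complex \<Rightarrow> 'a \<Rightarrow> 'a" where
  "res z = op_apply ((op_shift z A)\<inverse>)"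

definition resolvable :: "complex \<Rightarrow> bool" where
  "resolvable z \<longleftrightarrow> bounded_operator ((op_shift z A)\<inverse>)"

lemma resolvable_graph:
  assumes "resolvable z"
  shows "(op_shift z A)\<inverse> = graph_of (res z)" "bounded_clinear (res z)"
proof -
  obtain f where f: "bounded_clinear f" "(op_shift z A)\<inverse> = graph_of f"
    using assms unfolding resolvable_def bounded_operator_def by blast
  then have "res z = f" by (simp add: res_def)
  then show "(op_shift z A)\<inverse> = graph_of (res z)" "bounded_clinear (res z)" using f by auto
qed

lemma res_in_A: "resolvable z \<Longrightarrow> (res z y, y - z *\<^sub>C res z y) \<in> A"
proof -
  assume "resolvable z"
  then have "(y, res z y) \<in> (op_shift z A)\<inverse>" by (simp add: resolvable_graph graph_of_def)
  then show ?thesis by (simp add: op_shift_iff)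
qed

lemma res_unique:
  assumes "resolvable z" "(x, y - z *\<^sub>C x) \<in> A"
  shows "res z y = x"
proof -
  have "(y, x) \<in> (op_shift z A)\<inverse>" using assms(2) by (simp add: op_shift_iff)
  then show ?thesis using assms(1) by (simp add: resolvable_graph graph_of_def)
qed

lemma res_left: "resolvable z \<Longrightarrow> (x, y) \<in> A \<Longrightarrow> res z (z *\<^sub>C x + y) = x"
  by (rule res_unique) auto

lemma resolvable_Re_pos:
  assumes "Re z > 0"
  shows "resolvable z" "norm (res z x) \<le> M / Re z * norm x"
proof -
  interpret S: bounded_semigroup "\<lambda>t x. exp (- ((\<i> * of_real (Im z)) * of_real t)) *\<^sub>C T t x"
      "op_shift (\<i> * of_real (Im z)) A" M
    by (rule rescaled) simp
  have "op_shift (of_real (Re z)) (op_shift (\<i> * of_real (Im z)) A) = op_shift z A"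
    by (simp add: op_shift_shift flip: complex_eq)
  then have eq: "(op_shift z A)\<inverse> = graph_of (S.K (Re z) 1)"
    using S.resolvent_real[OF assms] by simp
  then show "resolvable z"
    unfolding resolvable_def bounded_operator_def using S.K_clinear[of "Re z" 1] assms by auto
  show "norm (res z x) \<le> M / Re z * norm x"
    using S.K_bound[of "Re z" 1 x] assms by (simp add: res_def eq powr_minus divide_inverse)
qed

lemma res_real: "p > 0 \<Longrightarrow> res (of_real p) = K p 1"
  by (simp add: res_def resolvent_real)

lemma resolvable_real: "p > 0 \<Longrightarrow> resolvable (of_real p)"
  by (rule resolvable_Re_pos) simp

lemma res_pow_real:
  assumes "p > 0"
  shows "(res (of_real p) ^^ Suc n) x = K p (real (Suc n)) x"
proof (induction n)
  case 0
  then show ?case using assms by (simp add: res_real)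
next
  case (Suc n)
  have "(res (of_real p) ^^ Suc (Suc n)) x = K p 1 ((res (of_real p) ^^ Suc n) x)"
    using assms by (simp add: res_real)
  also have "\<dots> = K p (1 + real (Suc n)) x"
    unfolding Suc by (rule K_add) (use assms in auto)
  finally show ?case by (simp add: add.commute)
qed

text \<open>The constant does not grow with \<open>n\<close>: the power is a Gamma integral whose density has integral \<open>1 / p ^ n\<close>.\<close>

lemma res_pow_bound:
  assumes "p > 0"
  shows "norm ((res (of_real p) ^^ n) x) \<le> M / p ^ n * norm x"
proof (cases n)
  case 0
  then show ?thesis using mult_right_mono[OF M_ge_1, of "norm x"] by simp
next
  case (Suc m)
  then show ?thesis
    using K_bound[of p "real (Suc m)" x] res_pow_real[OF assms, of m x] assms
    by (simp add: powr_minus powr_realpow divide_inverse del: of_nat_Suc funpow.simps)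
qed

section \<open>Operators commuting with the semigroup\<close>

text \<open>All operators below are functions of \<open>A\<close>. Commuting with the semigroup is enough to commute with \<open>A\<close>, its resolvents and
  the operators \<open>K p a\<close>, and it is preserved by all constructions used.\<close>

definition commuting :: "('a \<Rightarrow> 'a) \<Rightarrow> bool" where
  "commuting S \<longleftrightarrow> bounded_clinear S \<and> (\<forall>t\<ge>0. \<forall>x. S (T t x) = T t (S x))"

lemma commuting_clinear: "commuting S \<Longrightarrow> bounded_clinear S"
  and commuting_T: "commuting S \<Longrightarrow> t \<ge> 0 \<Longrightarrow> S (T t x) = T t (S x)"
  by (auto simp: commuting_def)

lemma commuting_A:
  assumes "commuting S" "(x, y) \<in> A"
  shows "(S x, S y) \<in> A"
proof -
  have "((\<lambda>h. S ((T h x - x) /\<^sub>R h)) \<longlongrightarrow> S (- y)) (at_right 0)"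
    by (rule bounded_clinear_tendsto) (use assms in_A_iff commuting_clinear in auto)
  then have "((\<lambda>h. (T h (S x) - S x) /\<^sub>R h) \<longlongrightarrow> S (- y)) (at_right 0)"
    by (rule tendsto_at_right_transform)
      (use assms in \<open>simp add: bounded_clinearD[OF commuting_clinear] commuting_T\<close>)
  then show ?thesis
    using assms by (simp add: in_A_iff bounded_clinearD[OF commuting_clinear])
qed

lemma commuting_res:
  assumes "commuting S" "resolvable z"
  shows "S (res z x) = res z (S x)"
proof -
  have "(S (res z x), S (x - z *\<^sub>C res z x)) \<in> A"
    by (rule commuting_A[OF assms(1) res_in_A[OF assms(2)]])
  then have "res z (S x) = S (res z x)"
    using assms by (intro res_unique) (auto simp: bounded_clinearD[OF commuting_clinear])
  then show ?thesis by simp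
qed

lemma commuting_K: "commuting S \<Longrightarrow> p > 0 \<Longrightarrow> a > 0 \<Longrightarrow> S (K p a x) = K p a (S x)"
  by (rule K_commute) (auto simp: commuting_def bounded_clinear_linear)

lemma T_commuting: "t \<ge> 0 \<Longrightarrow> commuting (T t)"
  by (auto simp: commuting_def T_clinear T_commute)

lemma res_commuting:
  assumes "resolvable z"
  shows "commuting (res z)"
  unfolding commuting_def
  using commuting_res[OF T_commuting assms] resolvable_graph(2)[OF assms] by simp

lemma K_commuting: "p > 0 \<Longrightarrow> a > 0 \<Longrightarrow> commuting (K p a)"
  unfolding commuting_def using commuting_K[OF T_commuting] K_clinear by simp

lemma commuting_id: "commuting (\<lambda>x. x)"
  and commuting_compose: "commuting f \<Longrightarrow> commuting g \<Longrightarrow> commuting (\<lambda>x. f (g x))"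
  and commuting_add: "commuting f \<Longrightarrow> commuting g \<Longrightarrow> commuting (\<lambda>x. f x + g x)"
  and commuting_sub: "commuting f \<Longrightarrow> commuting g \<Longrightarrow> commuting (\<lambda>x. f x - g x)"
  and commuting_scaleC: "commuting f \<Longrightarrow> commuting (\<lambda>x. c *\<^sub>C f x)"
  and commuting_scaleR: "commuting f \<Longrightarrow> commuting (\<lambda>x. r *\<^sub>R f x)"
  by (auto simp: commuting_def bounded_clinearD[OF T_clinear] intro: bounded_clinear_intros)

lemma commuting_funpow: "commuting f \<Longrightarrow> commuting (f ^^ n)"
  by (induction n) (auto simp: id_def o_def intro: commuting_id commuting_compose)

lemma res_commute: "resolvable z \<Longrightarrow> resolvable w \<Longrightarrow> res z (res w x) = res w (res z x)"
  by (rule commuting_res[OF res_commuting])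

lemma resolvent_identity:
  assumes "resolvable z" "resolvable w"
  shows "res z x - res w x = (w - z) *\<^sub>C res z (res w x)"
proof -
  note lin = bounded_clinearD[OF resolvable_graph(2)[OF assms(1)]]
  have "res w x = res z (z *\<^sub>C res w x + (x - w *\<^sub>C res w x))"
    by (rule res_left[OF assms(1) res_in_A[OF assms(2)], symmetric])
  also have "\<dots> = z *\<^sub>C res z (res w x) + (res z x - w *\<^sub>C res z (res w x))"
    by (simp add: lin)
  finally show ?thesis by (simp add: scaleC.diff_left algebra_simps)
qed

lemma AU_in_A: "(res 1 x, x - res 1 x) \<in> A"
  using res_in_A[of 1 x] resolvable_real[of 1] by simp

section \<open>Approximation by powers of resolvents\<close>

text \<open>One backward Euler step of length \<open>1 / p\<close> for the equation \<open>u' = - A u\<close>.\<close>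

definition euler :: "real \<Rightarrow> 'a \<Rightarrow> 'a" where
  "euler p v = p *\<^sub>R res (of_real p) v"

lemma euler_commuting: "p > 0 \<Longrightarrow> commuting (euler p)"
  unfolding euler_def[abs_def] by (intro commuting_scaleR res_commuting resolvable_real)

lemma euler_pow:
  assumes "p > 0"
  shows "(euler p ^^ k) v = p ^ k *\<^sub>R (res (of_real p) ^^ k) v"
  using bounded_clinearD(4)[OF resolvable_graph(2)[OF resolvable_real[OF assms]]]
  by (induction k) (simp_all add: euler_def mult.commute)

lemma euler_pow_bound:
  assumes "p > 0"
  shows "norm ((euler p ^^ k) v) \<le> M * norm v"
  using res_pow_bound[OF assms, of k v] assms by (simp add: euler_pow field_simps)

lemma euler_bound: "p > 0 \<Longrightarrow> norm (euler p v) \<le> M * norm v"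
  using euler_pow_bound[of p 1 v] by simp

lemma euler_minus_id:
  assumes "p > 0" "(x, y) \<in> A"
  shows "euler p x - x = - res (of_real p) y"
proof -
  have "x = res (of_real p) (of_real p *\<^sub>C x + y)"
    by (rule res_left[symmetric]) (use assms resolvable_real in auto)
  also have "\<dots> = euler p x + res (of_real p) y"
    using bounded_clinearD[OF resolvable_graph(2)[OF resolvable_real[OF assms(1)]]]
    by (simp add: scaleC_of_real euler_def)
  finally have 1: "x = euler p x + res (of_real p) y" .
  have 2: "u = v + w \<Longrightarrow> v - u = - w" for u v w :: 'a by simp
  show ?thesis by (rule 2[OF 1])
qed

text \<open>The convergence is of order \<open>1 / p\<close> on the domain; density and uniform boundedness extend it.\<close>

lemma euler_tendsto_id: "((\<lambda>p. euler p x) \<longlongrightarrow> x) at_top"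
proof -
  have dom: "norm (euler p x - x) \<le> M / p * norm y" if "p > 0" "(x, y) \<in> A" for p x y
    using resolvable_Re_pos(2)[of "of_real p" y] that by (simp add: euler_minus_id)
  show ?thesis
  proof (rule tendstoI)
    fix e :: real assume e: "e > 0"
    obtain w where w: "\<And>n::nat. w n \<in> Domain A" "w \<longlonglongrightarrow> x" using domain_dense by metis
    have "e / (2 * (M + 1)) > 0" using e M_ge_1 by simp
    then obtain n where n: "norm (x - w n) < e / (2 * (M + 1))"
      using w(2) unfolding lim_sequentially by (metis dist_commute dist_norm order_refl)
    obtain y where y: "(w n, y) \<in> A" using w(1) by blast
    have "((\<lambda>p. M / p * norm y) \<longlongrightarrow> 0) at_top"
      by (intro tendsto_mult_left_zero tendsto_divide_0[OF tendsto_const] filterlim_at_top_imp_at_infinity filterlim_ident)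
    then have "\<forall>\<^sub>F p in at_top. M / p * norm y < e / 2"
      using e by (intro order_tendstoD) auto
    then show "\<forall>\<^sub>F p in at_top. dist (euler p x) x < e"
      using eventually_gt_at_top[of 0]
    proof eventually_elim
      case (elim p)
      have "euler p x - x = euler p (x - w n) - (x - w n)
          + (euler p (w n) - w n)"
        using bounded_clinearD(2)[OF commuting_clinear[OF euler_commuting[OF elim(2)]]] by simp
      then have "norm (euler p x - x) \<le> norm (euler p (x - w n)) + norm (x - w n)
          + norm (euler p (w n) - w n)"
        by (simp only: order_trans[OF norm_triangle_ineq add_right_mono[OF norm_triangle_ineq4]])
      also have "\<dots> \<le> M * norm (x - w n) + norm (x - w n) + M / p * norm y"
        by (intro add_mono euler_bound dom y elim order_refl)
      also have "\<dots> = (M + 1) * norm (x - w n) + M / p * norm y" by (simp add: algebra_simps)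
      also have "\<dots> < (M + 1) * (e / (2 * (M + 1))) + e / 2"
        using n M_ge_1 elim by (intro add_strict_mono mult_strict_left_mono) auto
      also have "\<dots> = e" using M_ge_1 by (simp add: field_simps)
      finally show ?case by (simp add: dist_norm)
    qed
  qed
qed

text \<open>By telescoping, the error after \<open>n\<close> steps of length \<open>t / n\<close> is at most a constant times \<open>n\<close> times the error
  of one step, and the latter is \<open>o(t / n)\<close> on the domain because both sides have derivative \<open>- y\<close> at 0.\<close>

theorem exponential_formula:
  assumes t: "t > 0" and xy: "(x, y) \<in> A"
  shows "(\<lambda>n. (euler (real n / t) ^^ n) x) \<longlonglongrightarrow> T t x"
proof -
  have tele: "(euler p ^^ k) x - T (real k / p) x
      = (\<Sum>j<k. T (real j / p) ((euler p ^^ (k - 1 - j)) (euler p x - T (1 / p) x)))"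
    if p: "p > 0" for p k
  proof (induction k)
    case 0
    then show ?case by (simp add: T_0)
  next
    case (Suc k)
    have TS: "T (real (Suc j) / p) v = T (1 / p) (T (real j / p) v)" for j v
      using p by (simp add: T_add[symmetric] add_divide_distrib)
    interpret T1: bounded_linear "T (1 / p)"
      using p by (intro bounded_clinear_linear T_clinear) simp
    have "(euler p ^^ Suc k) x - T (real (Suc k) / p) x
        = (euler p ^^ k) (euler p x - T (1 / p) x) + T (1/p) ((euler p ^^ k) x - T (real k / p) x)"
    proof -
      have "(euler p ^^ k) (euler p x - T (1 / p) x) = (euler p ^^ k) (euler p x) - T (1 / p) ((euler p ^^ k) x)"
        using p commuting_T[OF commuting_funpow[OF euler_commuting[OF p]], of "1 / p" k x]
          bounded_clinearD(2)[OF commuting_clinear[OF commuting_funpow[OF euler_commuting[OF p]]], of k "euler p x" "T (1 / p) x"]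
        by simp
      moreover have "(euler p ^^ Suc k) x = (euler p ^^ k) (euler p x)"
        by (simp only: funpow_Suc_right o_apply)
      moreover have "a - c = (a - b) + (b - c)" for a b c :: 'a by simp
      ultimately show ?thesis unfolding TS[of k x] T1.diff by metis
    qed
    also have "T (1/p) ((euler p ^^ k) x - T (real k / p) x)
        = (\<Sum>j<k. T (real (Suc j) / p) ((euler p ^^ (k - 1 - j)) (euler p x - T (1 / p) x)))"
      unfolding Suc T1.sum TS ..
    finally show ?case
      by (subst sum.lessThan_Suc_shift) (simp add: T_0 del: funpow.simps)
  qed
  have err: "norm ((euler p ^^ k) x - T (real k / p) x) \<le> real k * (M * (M * norm (euler p x - T (1 / p) x)))"
    if p: "p > 0" for p k
  proof -
    have "norm ((euler p ^^ k) x - T (real k / p) x) \<le> (\<Sum>j<k. M * (M * norm (euler p x - T (1 / p) x)))"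
      unfolding tele[OF p]
    proof (rule order_trans[OF norm_sum sum_mono])
      fix j
      have "norm (T (real j / p) ((euler p ^^ (k - 1 - j)) (euler p x - T (1 / p) x)))
        \<le> M * norm ((euler p ^^ (k - 1 - j)) (euler p x - T (1 / p) x))"
        by (rule T_bound) (use p in simp)
      also have "\<dots> \<le> M * (M * norm (euler p x - T (1 / p) x))"
        by (intro mult_left_mono euler_pow_bound p) (use M_ge_1 in simp)
      finally show "norm (T (real j / p) ((euler p ^^ (k - 1 - j)) (euler p x - T (1 / p) x)))
        \<le> M * (M * norm (euler p x - T (1 / p) x))" .
    qed
    then show ?thesis by simp
  qed
  have step: "((\<lambda>p. p *\<^sub>R (euler p x - T (1 / p) x)) \<longlongrightarrow> 0) at_top"
  proof -
    have "((\<lambda>p. (T (1 / p) x - x) /\<^sub>R (1 / p)) \<longlongrightarrow> - y) at_top"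
      using filterlim_compose[OF iffD1[OF in_A_iff xy] filterlim_inverse_at_right_top]
      by (simp add: inverse_eq_divide)
    moreover have "((\<lambda>p. - euler p y) \<longlongrightarrow> - y) at_top"
      by (intro tendsto_minus euler_tendsto_id)
    ultimately have "((\<lambda>p. - euler p y - (T (1 / p) x - x) /\<^sub>R (1 / p)) \<longlongrightarrow> - y - - y) at_top"
      by (intro tendsto_diff)
    then have lim: "((\<lambda>p. - euler p y - (T (1 / p) x - x) /\<^sub>R (1 / p)) \<longlongrightarrow> 0) at_top" by simp
    show ?thesis
    proof (rule Lim_transform_eventually[OF lim])
      show "\<forall>\<^sub>F p in at_top. - euler p y - (T (1 / p) x - x) /\<^sub>R (1 / p) = p *\<^sub>R (euler p x - T (1 / p) x)"
        using eventually_gt_at_top[of 0]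
      proof eventually_elim
        case (elim p)
        have "p *\<^sub>R (euler p x - x) = - euler p y"
          unfolding euler_minus_id[OF elim xy] by (simp add: euler_def)
        then have 1: "- euler p y = p *\<^sub>R euler p x - p *\<^sub>R x" by (simp only: scaleR_diff_right)
        show ?case unfolding 1 using elim by (simp add: scaleR_diff_right)
      qed
    qed
  qed
  show ?thesis
  proof -
    have p: "filterlim (\<lambda>n. real n / t) at_top sequentially"
      using filterlim_tendsto_pos_mult_at_top[OF tendsto_const[of "inverse t"] _ filterlim_real_sequentially] t
      by (simp add: divide_inverse mult.commute)
    have "(\<lambda>n. (t * (M * M)) * norm ((real n / t) *\<^sub>R (euler (real n / t) x - T (1 / (real n / t)) x)))
       \<longlonglongrightarrow> (t * (M * M)) * norm (0::'a)"
      by (intro tendsto_intros filterlim_compose[OF step p])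
    then have 0: "(\<lambda>n. (t * (M * M)) * norm ((real n / t) *\<^sub>R (euler (real n / t) x - T (1 / (real n / t)) x)))
       \<longlonglongrightarrow> 0" by simp
    have "(\<lambda>n. (euler (real n / t) ^^ n) x - T t x) \<longlonglongrightarrow> 0"
    proof (rule Lim_null_comparison[OF _ 0])
      show "\<forall>\<^sub>F n in sequentially. norm ((euler (real n / t) ^^ n) x - T t x)
        \<le> (t * (M * M)) * norm ((real n / t) *\<^sub>R (euler (real n / t) x - T (1 / (real n / t)) x))"
        using eventually_gt_at_top[of 0]
      proof eventually_elim
        case (elim n)
        then show ?case using err[of "real n / t" n] t M_ge_1 by (simp add: mult_ac)
      qed
    qed
    then show ?thesis by (rule LIM_zero_cancel)
  qed
qed

end

section \<open>Resolvent bounds and decay on Hilbert space\<close>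

lemma cinner_sum_left:
  fixes y :: "'a::complex_hilbert_space"
  shows "cinner (\<Sum>i\<in>I. f i) y = (\<Sum>i\<in>I. cinner (f i) y)"
proof (induction I rule: infinite_finite_induct)
  have "cinner 0 y = cinner (0 *\<^sub>C 0) y" by (simp only: scaleC.zero_left)
  then have 0: "cinner 0 y = 0" by (simp only: cinner_scaleC_left mult_zero_left)
  { case (infinite A) then show ?case using 0 by simp }
  { case empty then show ?case using 0 by simp }
  case (insert x F)
  then show ?case by (simp add: cinner_add_left)
qed

lemma cinner_sum_right: "cinner y (\<Sum>i\<in>I. f i) = (\<Sum>i\<in>I. cinner y (f i))"
  by (subst cinner_commute, subst cinner_sum_left) (simp add: cinner_commute[of y])

lemma cinner_scaleC_right: "cinner y (c *\<^sub>C x) = cnj c * cinner y x"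
  by (metis cinner_commute cinner_scaleC_left complex_cnj_mult complex_cnj_cnj)

text \<open>The \<open>L\<close>-th roots of -1. They are as orthogonal as the roots of 1, but avoid the number 1, at which the geometric sum
  below has no resolvent formula.\<close>

definition odd_root :: "nat \<Rightarrow> nat \<Rightarrow> complex" where
  "odd_root L j = cis ((2 * real j + 1) * pi / real L)"

lemma odd_root_power: "odd_root L j ^ n = cis (real n * ((2 * real j + 1) * pi / real L))"
  by (simp only: odd_root_def Complex.DeMoivre)

lemma odd_root_neq_1: "j < L \<Longrightarrow> odd_root L j \<noteq> 1"
proof
  assume L: "j < L" and "odd_root L j = 1"
  then have "cos ((2 * real j + 1) * pi / real L) = 1" by (simp add: odd_root_def complex_eq_iff)
  then obtain k :: int where k: "(2 * real j + 1) * pi / real L = real_of_int k * (2 * pi)"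
    using cos_one_2pi_int by auto
  then have "pi * (2 * real j + 1) = pi * (real_of_int k * 2 * real L)" using L by (simp add: field_simps)
  then have "2 * real j + 1 = real_of_int k * 2 * real L" by (simp only: mult_cancel_left pi_neq_zero simp_thms)
  then have "real_of_int (2 * int j + 1) = real_of_int (2 * (k * int L))" by simp
  then have "2 * int j + 1 = 2 * (k * int L)" by (simp only: of_int_eq_iff)
  then show False by presburger
qed

lemma odd_root_orthogonal:
  assumes "n < L" "m < L"
  shows "(\<Sum>j<L. odd_root L j ^ n * cnj (odd_root L j ^ m)) = (if n = m then of_nat L else 0)"
proof (cases "n = m")
  case True
  have "odd_root L j ^ n * cnj (odd_root L j ^ n) = 1" for j
    by (simp add: odd_root_power cis_cnj cis_mult)
  then show ?thesis using True by simp
next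
  case False
  define d where "d = real n - real m"
  define q where "q = cis (d * (2 * pi / real L))"
  have "odd_root L j ^ n * cnj (odd_root L j ^ m) = cis (d * (pi / real L)) * q ^ j" for j
  proof -
    have "real n * ((2 * real j + 1) * pi / real L) - real m * ((2 * real j + 1) * pi / real L)
      = d * (pi / real L) + real j * (d * (2 * pi / real L))"
      by (simp add: d_def algebra_simps diff_divide_distrib add_divide_distrib)
    then show ?thesis
      by (simp only: odd_root_power cis_cnj cis_mult q_def Complex.DeMoivre add_uminus_conv_diff)
  qed
  then have "(\<Sum>j<L. odd_root L j ^ n * cnj (odd_root L j ^ m)) = cis (d * (pi / real L)) * (\<Sum>j<L. q ^ j)"
    by (simp add: sum_distrib_left)
  moreover have "q ^ L = 1"
  proof -
    have "real L * (d * (2 * pi / real L)) = 2 * pi * d" using assms by (simp add: field_simps)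
    moreover have "cis (2 * pi * d) = 1"
      by (rule cis_multiple_2pi) (simp add: d_def)
    ultimately show ?thesis by (simp add: q_def Complex.DeMoivre)
  qed
  moreover have "q \<noteq> 1"
  proof
    assume "q = 1"
    then have "cos (d * (2 * pi / real L)) = 1" by (simp add: q_def complex_eq_iff)
    then obtain k :: int where k: "d * (2 * pi / real L) = real_of_int k * (2 * pi)"
      using cos_one_2pi_int by auto
    then have "d = real_of_int k * real L" using assms by (simp add: field_simps)
    then have "real_of_int (int n - int m) = real_of_int (k * int L)" by (simp add: d_def)
    then have e: "int n - int m = k * int L" by (simp only: of_int_eq_iff)
    then have "int L dvd int n - int m" by simp
    then have "int n mod int L = int m mod int L" by (simp add: mod_eq_dvd_iff)
    then show False using assms False by simp
  qed
  ultimately show ?thesis using False by (simp add: geometric_sum)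
qed

lemma parseval_odd_roots:
  fixes a :: "nat \<Rightarrow> 'a::complex_hilbert_space"
  shows "(\<Sum>j<L. (norm (\<Sum>n<L. odd_root L j ^ n *\<^sub>C a n))\<^sup>2) = real L * (\<Sum>n<L. (norm (a n))\<^sup>2)"
proof -
  have "(norm (\<Sum>n<L. odd_root L j ^ n *\<^sub>C a n))\<^sup>2
    = Re (\<Sum>n<L. \<Sum>m<L. (odd_root L j ^ n * cnj (odd_root L j ^ m)) * cinner (a n) (a m))" for j
  proof -
    let ?S = "\<Sum>n<L. odd_root L j ^ n *\<^sub>C a n"
    have "cinner ?S ?S = (\<Sum>n<L. \<Sum>m<L. (odd_root L j ^ n * cnj (odd_root L j ^ m)) * cinner (a n) (a m))"
      unfolding cinner_sum_left
      by (intro sum.cong refl, unfold cinner_sum_right, intro sum.cong refl)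
        (simp add: cinner_scaleC_left cinner_scaleC_right)
    then show ?thesis by (simp only: power2_norm_eq_inner Re_cinner[symmetric])
  qed
  then have "(\<Sum>j<L. (norm (\<Sum>n<L. odd_root L j ^ n *\<^sub>C a n))\<^sup>2)
    = Re (\<Sum>j<L. \<Sum>n<L. \<Sum>m<L. (odd_root L j ^ n * cnj (odd_root L j ^ m)) * cinner (a n) (a m))"
    by (simp only: Re_sum)
  also have "(\<Sum>j<L. \<Sum>n<L. \<Sum>m<L. (odd_root L j ^ n * cnj (odd_root L j ^ m)) * cinner (a n) (a m))
    = (\<Sum>n<L. \<Sum>m<L. \<Sum>j<L. (odd_root L j ^ n * cnj (odd_root L j ^ m)) * cinner (a n) (a m))"
    by (subst sum.swap, rule sum.cong[OF refl], rule sum.swap)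
  also have "\<dots> = (\<Sum>n<L. \<Sum>m<L. (if n = m then of_nat L else 0) * cinner (a n) (a m))"
    by (intro sum.cong refl, subst sum_distrib_right[symmetric], subst odd_root_orthogonal) auto
  also have "\<dots> = (\<Sum>n<L. of_nat L * cinner (a n) (a n))"
    by (intro sum.cong refl) (simp add: if_distrib[of "\<lambda>x. x * _"] cong: if_cong)
  also have "Re \<dots> = real L * (\<Sum>n<L. (norm (a n))\<^sup>2)"
    by (simp add: sum_distrib_left power2_norm_eq_inner Re_cinner)
  finally show ?thesis .
qed

text \<open>The coefficients of \<open>(\<Sum>i<N. X ^ i)\<^sup>2\<close>.\<close>

definition grid_count :: "nat \<Rightarrow> nat \<Rightarrow> real" where
  "grid_count N k = real (card {p \<in> {..<N} \<times> {..<N}. fst p + snd p = k})"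

lemma sum_square_grid:
  fixes f :: "nat \<Rightarrow> 'b::real_vector"
  shows "(\<Sum>i<N. \<Sum>j<N. f (i + j)) = (\<Sum>k<2 * N. grid_count N k *\<^sub>R f k)"
proof -
  let ?P = "{..<N} \<times> {..<N}"
  have "(\<Sum>i<N. \<Sum>j<N. f (i + j)) = (\<Sum>p\<in>?P. f (fst p + snd p))"
    by (simp add: sum.cartesian_product case_prod_beta)
  also have "\<dots> = (\<Sum>k<2 * N. \<Sum>p\<in>{p \<in> ?P. fst p + snd p = k}. f (fst p + snd p))"
    by (rule sum.group[symmetric]) auto
  also have "\<dots> = (\<Sum>k<2 * N. grid_count N k *\<^sub>R f k)"
  proof (rule sum.cong[OF refl])
    fix k
    have "(\<Sum>p\<in>{p \<in> ?P. fst p + snd p = k}. f (fst p + snd p)) = (\<Sum>p\<in>{p \<in> ?P. fst p + snd p = k}. f k)"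
      by (rule sum.cong) auto
    then show "(\<Sum>p\<in>{p \<in> ?P. fst p + snd p = k}. f (fst p + snd p)) = grid_count N k *\<^sub>R f k"
      by (simp add: grid_count_def sum_constant_scaleR)
  qed
  finally show ?thesis .
qed

lemma grid_count_lower:
  assumes "k < N"
  shows "real k + 1 \<le> grid_count N k"
proof -
  have "card ((\<lambda>i. (i, k - i)) ` {..k}) \<le> card {p \<in> {..<N} \<times> {..<N}. fst p + snd p = k}"
    using assms by (intro card_mono) auto
  moreover have "card ((\<lambda>i. (i, k - i)) ` {..k}) = k + 1"
    by (subst card_image) (auto simp: inj_on_def)
  ultimately show ?thesis by (simp add: grid_count_def)
qed

lemma sum_squares_lower: "real N ^ 3 / 3 \<le> (\<Sum>k<N. (real k + 1)\<^sup>2)"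
proof (induction N)
  case (Suc N)
  then show ?case by (simp add: power3_eq_cube power2_eq_square algebra_simps)
qed simp

context bounded_semigroup
begin

text \<open>The resolvent identity between \<open>z\<close> and the point \<open>i Im z\<close> costs only the factor \<open>1 + M\<close>, since
  \<open>Re z (z + A)\<^sup>-\<^sup>1\<close> is bounded by \<open>M\<close>. Real \<open>z\<close> are limits of nonreal ones.\<close>

lemma res_imaginary_bound:
  assumes K: "0 \<le> C" and im: "\<And>s. s \<noteq> 0 \<Longrightarrow> resolvable (\<i> * of_real s)"
    and bound: "\<And>s. s \<noteq> 0 \<Longrightarrow> norm (res (\<i> * of_real s) y) \<le> C"
    and z: "Re z > 0"
  shows "norm (res z y) \<le> (1 + M) * C"
proof -
  have 1: "norm (res z y) \<le> (1 + M) * C" if z: "Re z > 0" and "Im z \<noteq> 0" for z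
  proof -
    let ?w = "\<i> * of_real (Im z)"
    have "res z y - res ?w y = (?w - z) *\<^sub>C res z (res ?w y)"
      by (rule resolvent_identity) (use that im resolvable_Re_pos in auto)
    then have "res z y = res ?w y + (?w - z) *\<^sub>C res z (res ?w y)"
      by (simp add: diff_eq_eq add.commute)
    then have "norm (res z y) \<le> norm (res ?w y) + norm ((?w - z) *\<^sub>C res z (res ?w y))"
      using norm_triangle_ineq by metis
    also have "?w - z = - of_real (Re z)" by (simp add: complex_eq_iff)
    also have "norm (- of_real (Re z) *\<^sub>C res z (res ?w y)) \<le> Re z * (M / Re z * norm (res ?w y))"
      using mult_left_mono[OF resolvable_Re_pos(2)[OF z, of "res ?w y"], of "Re z"] z
      by (simp add: norm_scaleC)
    also have "\<dots> = M * norm (res ?w y)" using z by simp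
    also have "norm (res ?w y) + M * norm (res ?w y) = (1 + M) * norm (res ?w y)"
      by (simp add: algebra_simps)
    also have "\<dots> \<le> (1 + M) * C"
      using bound[OF that(2)] M_ge_1 by (intro mult_left_mono) auto
    finally show ?thesis by simp
  qed
  show ?thesis
  proof (cases "Im z = 0")
    case True
    define w where "w n = z + \<i> * of_real (1 / real (Suc n))" for n
    have w: "Re (w n) = Re z" "Im (w n) \<noteq> 0" for n using True by (auto simp: w_def)
    have "norm (res z y - res (w n) y) \<le> (1 / real (Suc n)) * (M / Re z * (M / Re z * norm y))" for n
    proof -
      have "res z y - res (w n) y = (w n - z) *\<^sub>C res z (res (w n) y)"
        by (rule resolvent_identity) (use z w resolvable_Re_pos in auto)
      moreover have "w n - z = \<i> * of_real (1 / real (Suc n))" by (simp add: w_def)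
      then have "cmod (w n - z) = 1 / real (Suc n)"
        by (simp only: norm_mult norm_ii norm_of_real) simp
      moreover have "norm (res z (res (w n) y)) \<le> M / Re z * (M / Re z * norm y)"
        using resolvable_Re_pos(2)[of "w n" y] z w(1)[of n] M_ge_1
        by (intro order_trans[OF resolvable_Re_pos(2)[OF z]] mult_left_mono) auto
      ultimately show ?thesis
        by (simp only: norm_scaleC) (intro mult_left_mono, simp_all)
    qed
    moreover have "(\<lambda>n. (1 / real (Suc n)) * (M / Re z * (M / Re z * norm y))) \<longlonglongrightarrow> 0"
      by (intro tendsto_mult_left_zero LIMSEQ_Suc[OF lim_1_over_n])
    ultimately have "(\<lambda>n. res z y - res (w n) y) \<longlonglongrightarrow> 0"
      by (rule Lim_null_comparison[OF always_eventually[OF allI]])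
    then have "(\<lambda>n. res z y - (res z y - res (w n) y)) \<longlonglongrightarrow> res z y - 0"
      by (intro tendsto_diff tendsto_const)
    then have "(\<lambda>n. res (w n) y) \<longlonglongrightarrow> res z y" by simp
    then show ?thesis
      by (intro LIMSEQ_le_const2[OF tendsto_norm]) (use 1 w z in auto)
  qed (use 1 z in auto)
qed

lemma commuting_sum: "(\<And>i. i \<in> I \<Longrightarrow> commuting (f i)) \<Longrightarrow> commuting (\<lambda>x. \<Sum>i\<in>I. f i x)"
proof (induction I rule: infinite_finite_induct)
  case empty
  show ?case using commuting_scaleR[OF commuting_id, of 0] by simp
next
  case (infinite A)
  show ?case using commuting_scaleR[OF commuting_id, of 0] infinite by simp
next
  case (insert x F)
  then show ?case by (simp add: commuting_add)
qed

text \<open>The squared geometric sum \<open>G\<^sup>2\<close> of the powers of \<open>euler p\<close> has linearly growing coefficients, but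
  the norm of \<open>G\<^sup>2 B x\<close> is only a constant times \<open>p\<close> times the norm of \<open>G x\<close>. Parseval's identity over the roots of -1 turns this gain
  of one power of \<open>k\<close> into decay of the powers, and power boundedness replaces the mean over \<open>k\<close> by
  the last term.\<close>

theorem decay_of_resolvent_bound_discrete:
  assumes B: "commuting B" and C: "0 \<le> C"
    and res: "\<And>z x. Re z > 0 \<Longrightarrow> norm (res z (B x)) \<le> C * norm x"
    and p: "p > 0" and N: "N > 0"
  shows "norm ((euler p ^^ Suc N) (B x)) \<le> 2 * M\<^sup>2 * (1 + M) * C * p / real N * norm x"
proof -
  define U where "U = euler p"
  note U_eq = euler_def[of p, folded U_def]
  have U: "commuting U" unfolding U_def by (rule euler_commuting[OF p])
  have Upow: "norm ((U ^^ k) v) \<le> M * norm v" for k v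
    unfolding U_def by (rule euler_pow_bound[OF p])
  define G where "G \<omega> v = (\<Sum>n<N. \<omega> ^ n *\<^sub>C (U ^^ Suc n) v)" for \<omega> v
  \<comment> \<open>The geometric sum telescopes because \<open>U v = p (p (1 - \<omega>) + A)\<^sup>-\<^sup>1 (v - \<omega> U v)\<close>.\<close>
  have Y: "G \<omega> v = p *\<^sub>R res (of_real p * (1 - \<omega>)) (v - \<omega> ^ N *\<^sub>C (U ^^ N) v)"
    if \<omega>: "cmod \<omega> = 1" "\<omega> \<noteq> 1" for \<omega> v
  proof -
    have "Re \<omega> < 1"
    proof (rule ccontr)
      assume "\<not> Re \<omega> < 1"
      then have "Re \<omega> = 1" using \<omega>(1) complex_Re_le_cmod[of \<omega>] by simp
      then have "\<omega> = 1" using \<omega>(1) by (simp add: cmod_def complex_eq_iff)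
      then show False using \<omega> by simp
    qed
    then have l: "resolvable (of_real p * (1 - \<omega>))" using p by (intro resolvable_Re_pos) simp
    note lin = bounded_clinearD[OF resolvable_graph(2)[OF l]]
    have step: "U v = p *\<^sub>R res (of_real p * (1 - \<omega>)) (v - \<omega> *\<^sub>C U v)" for v
    proof -
      have eq: "(of_real p * (1 - \<omega>)) *\<^sub>C res (of_real p) v + (v - of_real p *\<^sub>C res (of_real p) v) = v - \<omega> *\<^sub>C U v"
        by (simp add: U_eq ring_distribs scaleC.diff_left mult.commute flip: scaleC_scaleC scaleC_of_real)
      show ?thesis
        using res_left[OF l res_in_A[OF resolvable_real[OF p]], of v] unfolding eq by (simp add: U_eq)
    qed
    show ?thesis unfolding G_def
    proof (induction N)
      case 0
      then show ?case by (simp add: lin)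
    next
      case (Suc N)
      have "p *\<^sub>R res (of_real p * (1 - \<omega>)) (v - \<omega> ^ N *\<^sub>C (U ^^ N) v) +
          \<omega> ^ N *\<^sub>C (p *\<^sub>R res (of_real p * (1 - \<omega>)) ((U ^^ N) v - \<omega> *\<^sub>C U ((U ^^ N) v)))
        = p *\<^sub>R res (of_real p * (1 - \<omega>)) (v - \<omega> ^ Suc N *\<^sub>C (U ^^ Suc N) v)"
        by (simp add: lin scaleC.scaleR_right scaleC.diff_right scaleC_scaleC scaleR_diff_right mult.commute)
      then show ?case using Suc step[of "(U ^^ N) v"] by simp
    qed
  qed
  have Gc: "commuting (G \<omega>)" for \<omega>
    unfolding G_def by (intro commuting_sum commuting_scaleC commuting_funpow U)
  \<comment> \<open>One of the two factors \<open>G\<close> is estimated by the resolvent bound, the other one is kept.\<close>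
  have GG: "norm (G \<omega> (G \<omega> (B x))) \<le> (p * C * (1 + M)) * norm (G \<omega> x)"
    if \<omega>: "cmod \<omega> = 1" "\<omega> \<noteq> 1" for \<omega>
  proof -
    let ?v = "G \<omega> x"
    have "Re \<omega> \<noteq> 1" using \<omega> by (auto simp: cmod_def complex_eq_iff power2_eq_square)
    then have R: "Re (of_real p * (1 - \<omega>)) > 0"
      using complex_Re_le_cmod[of \<omega>] \<omega> p by (simp add: less_le)
    have BU: "(U ^^ k) (B v) = B ((U ^^ k) v)" for k v
    proof (induction k)
      case (Suc k)
      have "U (B w) = B (U w)" for w
        using commuting_res[OF B resolvable_real[OF p]] bounded_clinearD[OF commuting_clinear[OF B]]
        by (simp add: U_eq)
      then show ?case using Suc by simp
    qed simp
    have "G \<omega> (B x) = B (G \<omega> x)"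
      unfolding G_def BU
      using bounded_clinearD[OF commuting_clinear[OF B]] 
        bounded_linear.linear[OF bounded_clinear_linear[OF commuting_clinear[OF B]]]
      by (simp add: linear_sum del: funpow.simps)
    then have "G \<omega> (G \<omega> (B x)) = p *\<^sub>R res (of_real p * (1 - \<omega>)) (B (?v - \<omega> ^ N *\<^sub>C (U ^^ N) ?v))"
      using Y[OF \<omega>, of "B ?v"] bounded_clinearD[OF commuting_clinear[OF B]] by (simp add: BU)
    then have "norm (G \<omega> (G \<omega> (B x))) \<le> p * (C * norm (?v - \<omega> ^ N *\<^sub>C (U ^^ N) ?v))"
      using res[OF R] p by simp
    also have "\<dots> \<le> p * (C * ((1 + M) * norm ?v))"
    proof (intro mult_left_mono)
      have "norm (?v - \<omega> ^ N *\<^sub>C (U ^^ N) ?v) \<le> norm ?v + norm (\<omega> ^ N *\<^sub>C (U ^^ N) ?v)"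
        by (rule norm_triangle_ineq4)
      also have "\<dots> \<le> (1 + M) * norm ?v"
        using Upow[of N ?v] \<omega>(1) by (simp add: norm_scaleC norm_power algebra_simps)
      finally show "norm (?v - \<omega> ^ N *\<^sub>C (U ^^ N) ?v) \<le> (1 + M) * norm ?v" .
    qed (use p C in auto)
    finally show ?thesis by (simp add: mult_ac)
  qed
  \<comment> \<open>There are \<open>2 N\<close> roots because \<open>G\<^sup>2\<close> has degree \<open>2 N - 2\<close>; both polynomials are padded to that length.\<close>
  define a where "a k = grid_count N k *\<^sub>R (U ^^ (k + 2)) (B x)" for k
  have GGa: "G \<omega> (G \<omega> (B x)) = (\<Sum>k<2 * N. \<omega> ^ k *\<^sub>C a k)" for \<omega>
  proof -
    note lin = bounded_clinearD[OF commuting_clinear[OF commuting_funpow[OF U]]]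
      linear_sum[OF bounded_linear.linear[OF bounded_clinear_linear[OF commuting_clinear[OF commuting_funpow[OF U]]]]]
    have "G \<omega> (G \<omega> (B x)) = (\<Sum>i<N. \<Sum>j<N. \<omega> ^ (i + j) *\<^sub>C (U ^^ (i + j + 2)) (B x))"
      unfolding G_def lin scaleC.sum_right scaleC_scaleC
      by (intro sum.cong refl) (simp add: power_add add_ac flip: funpow_add[THEN fun_cong, unfolded o_apply] del: funpow.simps)
    also have "\<dots> = (\<Sum>k<2 * N. grid_count N k *\<^sub>R (\<omega> ^ k *\<^sub>C (U ^^ (k + 2)) (B x)))"
      by (rule sum_square_grid)
    finally show ?thesis by (simp add: a_def scaleC.scaleR_right)
  qed
  define b where "b n = (if n < N then (U ^^ Suc n) x else 0)" for n
  have Gb: "G \<omega> x = (\<Sum>n<2 * N. \<omega> ^ n *\<^sub>C b n)" for \<omega>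
    unfolding G_def by (rule sum.mono_neutral_cong_left) (auto simp: b_def scaleC.zero_right)
  have w: "cmod (odd_root (2 * N) j) = 1" for j by (simp add: odd_root_def)
  define c where "c = p * C * (1 + M)"
  have c: "0 \<le> c" using p C M_ge_1 by (simp add: c_def)
  define y where "y = norm ((U ^^ Suc N) (B x))"
  have "(\<Sum>j<2 * N. (norm (\<Sum>k<2 * N. odd_root (2 * N) j ^ k *\<^sub>C a k))\<^sup>2)
     \<le> (\<Sum>j<2 * N. c\<^sup>2 * (norm (\<Sum>n<2 * N. odd_root (2 * N) j ^ n *\<^sub>C b n))\<^sup>2)"
  proof (rule sum_mono)
    fix j assume "j \<in> {..<2 * N}"
    then have "norm (G (odd_root (2 * N) j) (G (odd_root (2 * N) j) (B x))) \<le> c * norm (G (odd_root (2 * N) j) x)"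
      unfolding c_def by (intro GG w odd_root_neq_1) auto
    then show "(norm (\<Sum>k<2 * N. odd_root (2 * N) j ^ k *\<^sub>C a k))\<^sup>2
       \<le> c\<^sup>2 * (norm (\<Sum>n<2 * N. odd_root (2 * N) j ^ n *\<^sub>C b n))\<^sup>2"
      unfolding GGa Gb power_mult_distrib[symmetric] by (rule power_mono) simp
  qed
  then have "real (2 * N) * (\<Sum>k<2 * N. (norm (a k))\<^sup>2) \<le> real (2 * N) * (c\<^sup>2 * (\<Sum>n<2 * N. (norm (b n))\<^sup>2))"
    unfolding sum_distrib_left[symmetric] parseval_odd_roots by (simp add: mult_ac)
  then have 1: "(\<Sum>k<2 * N. (norm (a k))\<^sup>2) \<le> c\<^sup>2 * (\<Sum>n<2 * N. (norm (b n))\<^sup>2)"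
    using N by (simp only: mult_le_cancel_left_pos of_nat_0_less_iff)
  have "(\<Sum>n<2 * N. (norm (b n))\<^sup>2) = (\<Sum>n<N. (norm ((U ^^ Suc n) x))\<^sup>2)"
    by (rule sum.mono_neutral_cong_right) (auto simp: b_def)
  also have "\<dots> \<le> (\<Sum>n<N. (M * norm x)\<^sup>2)"
    by (intro sum_mono power_mono Upow) simp
  also have "\<dots> = real N * (M * norm x)\<^sup>2" by simp
  finally have 2: "(\<Sum>n<2 * N. (norm (b n))\<^sup>2) \<le> real N * (M * norm x)\<^sup>2" .
  have "y\<^sup>2 * (real N ^ 3 / 3) \<le> y\<^sup>2 * (\<Sum>k<N. (real k + 1)\<^sup>2)"
    by (intro mult_left_mono sum_squares_lower) simp
  also have "\<dots> = (\<Sum>k<N. (real k + 1)\<^sup>2 * y\<^sup>2)" by (simp add: sum_distrib_left mult.commute)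
  also have "\<dots> \<le> (\<Sum>k<N. M\<^sup>2 * (norm (a k))\<^sup>2)"
  proof (rule sum_mono)
    fix k assume k: "k \<in> {..<N}"
    \<comment> \<open>Each of the first \<open>N\<close> powers bounds the last one, up to the factor \<open>M\<close>.\<close>
    have "Suc N = (N - 1 - k) + (k + 2)" using k by auto
    then have "(U ^^ Suc N) (B x) = (U ^^ (N - 1 - k)) ((U ^^ (k + 2)) (B x))"
      by (metis funpow_add o_apply)
    then have "y \<le> M * norm ((U ^^ (k + 2)) (B x))" unfolding y_def by (simp only: Upow)
    then have "(real k + 1) * y \<le> grid_count N k * (M * norm ((U ^^ (k + 2)) (B x)))"
      using k grid_count_lower[of k N] by (intro mult_mono) (auto simp: y_def)
    also have "\<dots> = M * norm (a k)" by (simp add: a_def grid_count_def)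
    finally show "(real k + 1)\<^sup>2 * y\<^sup>2 \<le> M\<^sup>2 * (norm (a k))\<^sup>2"
      unfolding power_mult_distrib[symmetric] by (rule power_mono) (simp add: y_def)
  qed
  also have "\<dots> = M\<^sup>2 * (\<Sum>k<N. (norm (a k))\<^sup>2)" by (simp add: sum_distrib_left)
  also have "\<dots> \<le> M\<^sup>2 * (\<Sum>k<2 * N. (norm (a k))\<^sup>2)"
    by (intro mult_left_mono sum_mono2) auto
  also have "\<dots> \<le> M\<^sup>2 * (c\<^sup>2 * (real N * (M * norm x)\<^sup>2))"
    by (intro mult_left_mono order_trans[OF 1] 2) auto
  finally have "y\<^sup>2 * (real N ^ 3 / 3) \<le> M\<^sup>2 * (c\<^sup>2 * (real N * (M * norm x)\<^sup>2))" .
  then have "real N * (y * real N)\<^sup>2 \<le> real N * (3 * (M\<^sup>2 * c * norm x)\<^sup>2)"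
    by (simp add: power2_eq_square power3_eq_cube mult_ac)
  then have "(y * real N)\<^sup>2 \<le> 3 * (M\<^sup>2 * c * norm x)\<^sup>2"
    using N by (simp only: mult_le_cancel_left_pos of_nat_0_less_iff)
  also have "\<dots> \<le> (2 * (M\<^sup>2 * c * norm x))\<^sup>2" by (simp add: power_mult_distrib)
  finally have "y * real N \<le> 2 * (M\<^sup>2 * c * norm x)"
    by (rule power2_le_imp_le) (use c in simp)
  then have "y \<le> 2 * (M\<^sup>2 * c * norm x) / real N" using N by (simp add: field_simps)
  then show ?thesis unfolding y_def U_def c_def by (simp add: mult_ac)
qed

text \<open>Take \<open>p = n / t\<close> in the discrete estimate and let \<open>n\<close> tend to infinity, on the domain of \<open>A\<close> at first. The factor 2
  lost here is the ratio of \<open>N + 1\<close> steps to the bound with \<open>N\<close>.\<close>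

theorem decay_of_resolvent_bound:
  assumes B: "commuting B" and C: "0 \<le> C"
    and res: "\<And>z x. Re z > 0 \<Longrightarrow> norm (res z (B x)) \<le> C * norm x"
    and t: "t > 0"
  shows "norm (T t (B x)) \<le> 4 * M\<^sup>2 * (1 + M) * C / t * norm x"
proof -
  have dom: "norm (T t (B x)) \<le> 4 * M\<^sup>2 * (1 + M) * C / t * norm x" if "(x, y) \<in> A" for x y
  proof -
    let ?E = "\<lambda>n. (euler (real n / t) ^^ n) (B x)"
    have "(\<lambda>n. ?E (Suc (Suc n))) \<longlonglongrightarrow> T t (B x)"
      by (intro LIMSEQ_Suc exponential_formula[OF t commuting_A[OF B that]])
    then show ?thesis
    proof (rule LIMSEQ_le_const2[OF tendsto_norm], intro exI allI impI)
      fix n :: nat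
      have "norm (?E (Suc (Suc n))) \<le> 2 * M\<^sup>2 * (1 + M) * C * (real (Suc (Suc n)) / t) / real (Suc n) * norm x"
        by (rule decay_of_resolvent_bound_discrete[OF B C res]) (use t in auto)
      also have "\<dots> = (real (Suc (Suc n)) / real (Suc n)) * (2 * M\<^sup>2 * (1 + M) * C / t * norm x)"
        using t by (simp add: field_simps)
      also have "\<dots> \<le> 2 * (2 * M\<^sup>2 * (1 + M) * C / t * norm x)"
        using C t M_ge_1 by (intro mult_right_mono) (auto simp: field_simps)
      finally show "norm (?E (Suc (Suc n))) \<le> 4 * M\<^sup>2 * (1 + M) * C / t * norm x" by simp
    qed
  qed
  obtain w where w: "\<And>n::nat. w n \<in> Domain A" "w \<longlonglongrightarrow> x" using domain_dense by metis
  have "(\<lambda>n. T t (B (w n))) \<longlonglongrightarrow> T t (B x)"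
    using t by (intro bounded_clinear_tendsto[OF T_clinear] bounded_clinear_tendsto[OF commuting_clinear[OF B]] w) auto
  moreover have "(\<lambda>n. 4 * M\<^sup>2 * (1 + M) * C / t * norm (w n)) \<longlonglongrightarrow> 4 * M\<^sup>2 * (1 + M) * C / t * norm x"
    by (intro tendsto_intros w)
  ultimately show ?thesis
  proof (rule LIMSEQ_le[OF tendsto_norm], intro exI allI impI)
    fix n
    show "norm (T t (B (w n))) \<le> 4 * M\<^sup>2 * (1 + M) * C / t * norm (w n)"
      using dom w(1)[of n] by blast
  qed
qed

end

section \<open>The resolvent on the imaginary axis\<close>

lemma norm_funpow_le_power:
  fixes f :: "'b::real_normed_vector \<Rightarrow> 'b"
  assumes f: "\<And>w. norm (f w) \<le> L * norm w" and L: "0 \<le> L"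
  shows "norm ((f ^^ n) v) \<le> L ^ n * norm v"
proof (induction n)
  case (Suc n)
  have "norm ((f ^^ Suc n) v) \<le> L * norm ((f ^^ n) v)" using f by simp
  also have "\<dots> \<le> L * (L ^ n * norm v)" by (rule mult_left_mono[OF Suc L])
  finally show ?case by (simp add: mult.assoc)
qed simp

text \<open>If \<open>f\<close> is close to the scalar \<open>q\<close> at the single vector \<open>v\<close>, then \<open>f ^^ m\<close> is close to \<open>q ^ m\<close> there: the error
  terms are images of \<open>f v - q v\<close> under powers of \<open>f\<close>. Only the powers below \<open>m\<close> occur, which allows a bound \<open>L\<close>
  that depends on \<open>m\<close>.\<close>

lemma norm_funpow_minus_power_le:
  assumes f: "bounded_clinear f" and L: "\<And>j w. j < m \<Longrightarrow> norm ((f ^^ j) w) \<le> L * norm w"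
    and q: "cmod q \<le> 1"
  shows "norm ((f ^^ m) v - q ^ m *\<^sub>C v) \<le> real m * L * norm (f v - q *\<^sub>C v)"
  using L
proof (induction m)
  case (Suc m)
  have "(f ^^ Suc m) v - q ^ Suc m *\<^sub>C v
      = (f ^^ m) (f v - q *\<^sub>C v) + q *\<^sub>C ((f ^^ m) v - q ^ m *\<^sub>C v)"
    using bounded_clinearD[OF bounded_clinear_funpow[OF f]]
    by (simp add: funpow_swap1 scaleC.diff_right scaleC_scaleC)
  then have "norm ((f ^^ Suc m) v - q ^ Suc m *\<^sub>C v)
      \<le> norm ((f ^^ m) (f v - q *\<^sub>C v)) + norm (q *\<^sub>C ((f ^^ m) v - q ^ m *\<^sub>C v))"
    by (simp only: norm_triangle_ineq)
  also have "\<dots> \<le> L * norm (f v - q *\<^sub>C v) + 1 * (real m * L * norm (f v - q *\<^sub>C v))"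
    unfolding norm_scaleC by (intro add_mono mult_mono q Suc) (use Suc in auto)
  also have "\<dots> = real (Suc m) * L * norm (f v - q *\<^sub>C v)" by (simp add: ring_distribs)
  finally show ?case .
qed simp

lemma norm_funpow_le:
  assumes f: "bounded_clinear f" and L: "\<And>j w. j < m \<Longrightarrow> norm ((f ^^ j) w) \<le> L * norm w"
    and q: "cmod q \<le> 1"
  shows "norm ((f ^^ m) v) \<le> cmod q ^ m * norm v + real m * L * norm (f v - q *\<^sub>C v)"
proof -
  have "norm ((f ^^ m) v) \<le> norm (q ^ m *\<^sub>C v) + norm ((f ^^ m) v - q ^ m *\<^sub>C v)"
    by (rule norm_triangle_sub)
  then show ?thesis
    using norm_funpow_minus_power_le[OF f, of m L q v] L q by (simp add: norm_scaleC norm_power)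
qed

lemma norm_minus_funpow_le:
  assumes f: "bounded_clinear f" and L: "\<And>j w. j < m \<Longrightarrow> norm ((f ^^ j) w) \<le> L * norm w"
  shows "norm (v - (f ^^ m) v) \<le> real m * L * norm (v - f v)"
  using norm_funpow_minus_power_le[OF f, of m L 1 v] L by (simp add: norm_minus_commute)

text \<open>An integer power of a cutoff factor does the work of the real power \<open>g\<close> when the factor is small, and is harmless when
  the comparison value \<open>r\<close> exceeds 1.\<close>

lemma power_le_powr_cutoff:
  assumes "0 \<le> q" "q \<le> 1" "q \<le> r" "r > 0" "0 \<le> g" "g \<le> real m"
  shows "q ^ m \<le> r powr g"
proof (cases "r \<ge> 1")
  case True
  have "q ^ m \<le> 1" using assms by (simp add: power_le_one)
  also have "1 \<le> r powr g" using True assms by (simp add: ge_one_powr_ge_zero)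
  finally show ?thesis .
next
  case False
  have "q ^ m \<le> r ^ m" using assms by (intro power_mono)
  also have "\<dots> = r powr real m" using assms by (simp add: powr_realpow)
  also have "\<dots> \<le> r powr g" using False assms by (intro powr_mono') auto
  finally show ?thesis .
qed

context bounded_semigroup
begin

abbreviation R :: "real \<Rightarrow> 'a \<Rightarrow> 'a" where "R s \<equiv> res (\<i> * of_real s)"

abbreviation U :: "'a \<Rightarrow> 'a" where "U \<equiv> res 1"

abbreviation Q :: "'a \<Rightarrow> 'a" where "Q x \<equiv> U x - U (U x)"

lemma resolvable_1: "resolvable 1"
  using resolvable_real[of 1] by simp

lemma U_commuting: "commuting (res 1)"
  by (rule res_commuting[OF resolvable_1])

lemma U_bound: "norm (res 1 x) \<le> M * norm x"
  using resolvable_Re_pos(2)[of 1 x] by simp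

lemma id_minus_U_bound: "norm (x - res 1 x) \<le> (1 + M) * norm x"
  using norm_triangle_ineq4[of x "res 1 x"] U_bound[of x] by (simp add: algebra_simps)

lemma Q_commuting: "commuting (\<lambda>x. Q x)"
  by (rule commuting_sub[OF U_commuting commuting_compose[OF U_commuting U_commuting]])

lemma Q_eq: "Q x = res 1 (x - res 1 x)"
  by (simp add: bounded_clinearD[OF resolvable_graph(2)[OF resolvable_1]])

text \<open>On the range of \<open>R s\<close> the resolvent at \<open>z\<close> acts as the scalar \<open>1 / (z - i s)\<close>, up to an error that does not involve
  the size of \<open>R s\<close>.\<close>

lemma res_R:
  assumes "resolvable z" "resolvable (\<i> * of_real s)" "z \<noteq> \<i> * of_real s"
  shows "res z (R s x) = (1 / (z - \<i> * of_real s)) *\<^sub>C (R s x - res z x)"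
proof -
  have "res z x - R s x = (\<i> * of_real s - z) *\<^sub>C res z (R s x)"
    by (rule resolvent_identity[OF assms(1,2)])
  then have "R s x - res z x = (z - \<i> * of_real s) *\<^sub>C res z (R s x)"
    by (metis minus_diff_eq scaleC.minus_left)
  then show ?thesis using assms(3) by (simp add: scaleC_scaleC)
qed

section \<open>From decay to resolvent growth\<close>

text \<open>The rescaled orbit of \<open>R s x\<close> has the derivative \<open>- S t x\<close>, whose norm is at most \<open>M \<parallel>x\<parallel>\<close>.\<close>

lemma R_orbit_bound:
  assumes r: "resolvable (\<i> * of_real s)" and t: "t \<ge> 0"
  shows "norm (exp (\<i> * of_real (s * t)) *\<^sub>C R s x - T t (R s x)) \<le> M * t * norm x"
proof -
  let ?e = "exp (\<i> * of_real (s * t))"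
  let ?S = "\<lambda>t x. exp (- ((\<i> * of_real s) * of_real t)) *\<^sub>C T t x"
  interpret S: bounded_semigroup ?S "op_shift (\<i> * of_real s) A" M
    by (rule rescaled) simp
  have "(R s x, x) \<in> op_shift (\<i> * of_real s) A"
    using res_in_A[OF r] by (simp add: op_shift_iff)
  then have "R s x - ?S t (R s x) = integral {0..t} (\<lambda>u. ?S u x)"
    by (rule S.T_minus_id[OF _ t])
  then have n: "norm (R s x - ?S t (R s x)) \<le> (M * norm x) * (t - 0)"
    using integral_bound[OF t S.T_continuous_interval] S.T_bound by auto
  have "?e * exp (- ((\<i> * of_real s) * of_real t)) = 1" by (simp flip: exp_add)
  then have "?e *\<^sub>C (R s x - ?S t (R s x)) = ?e *\<^sub>C R s x - T t (R s x)"
    by (simp add: scaleC.diff_right scaleC_scaleC)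
  then have "norm (?e *\<^sub>C R s x - T t (R s x)) = norm (R s x - ?S t (R s x))"
    by (metis mult_1 norm_exp_i_times norm_scaleC)
  then show ?thesis using n by (simp add: mult_ac)
qed

text \<open>Since \<open>Q = q + O(1)\<close> on the range of \<open>R s\<close>, with the scalar \<open>q = u - u\<^sup>2\<close> of modulus
  \<open>\<bar>s\<bar> / (1 + s\<^sup>2)\<close>, and since \<open>T t R s\<close> differs from \<open>exp (i s t) R s\<close> by \<open>O(t)\<close>, a small norm of
  \<open>T t Q\<close> bounds \<open>R s\<close>. The error \<open>O(t)\<close> is multiplied by \<open>Q\<close>; its factor \<open>A\<close> improves it to \<open>O(1 + \<bar>s\<bar> t)\<close>,
  which is the better estimate for small \<open>s\<close>, and its factor \<open>U\<close> to \<open>O(\<bar>u\<bar> (1 + t))\<close>, the better one for large \<open>s\<close>.\<close>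

lemma R_bound_by_decay:
  fixes s t :: real
  assumes r: "resolvable (\<i> * of_real s)" and t: "t \<ge> 0"
  defines "u \<equiv> 1 / (1 - \<i> * of_real s)"
  shows "\<bar>s\<bar> / (1 + s\<^sup>2) * norm (R s x) \<le> norm (T t (Q (R s x))) + 7 * M ^ 3 * (1 + \<bar>s\<bar> * t) * norm x"
    and "\<bar>s\<bar> / (1 + s\<^sup>2) * norm (R s x) \<le> norm (T t (Q (R s x))) + cmod u * (7 * M ^ 3 * (1 + t)) * norm x"
proof -
  let ?U = "res 1" and ?e = "exp (\<i> * of_real (s * t))"
  note linU = bounded_clinearD[OF commuting_clinear[OF U_commuting]]
  note linQ = bounded_clinearD[OF commuting_clinear[OF Q_commuting]]
  note linR = bounded_clinearD[OF resolvable_graph(2)[OF r]]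
  have ne: "1 - \<i> * of_real s \<noteq> 0" by (simp add: complex_eq_iff)
  have cu: "(cmod u)\<^sup>2 = 1 / (1 + s\<^sup>2)" 
  proof -
    have "(cmod (1 - \<i> * of_real s))\<^sup>2 = 1 + s\<^sup>2" by (simp add: cmod_power2)
    then show ?thesis by (simp add: u_def norm_divide power_divide)
  qed
  then have u1: "cmod u \<le> 1"
  proof (intro power2_le_imp_le[of "cmod u" 1])
    have "1 / (1 + s\<^sup>2) \<le> 1 / 1" by (intro divide_left_mono) (auto simp: add_pos_nonneg)
    then show "(cmod u)\<^sup>2 \<le> 1\<^sup>2" by (simp add: cu)
  qed auto
  have UR: "?U (R s y) = u *\<^sub>C (R s y - ?U y)" for y
    using res_R[OF resolvable_1 r, of y] by (auto simp: u_def complex_eq_iff)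
  define v where "v = R s x"
  define D where "D = ?e *\<^sub>C x - T t x"
  \<comment> \<open>Both \<open>Z\<close> and its preimage \<open>D\<close> under \<open>R s\<close> are under control, hence so are \<open>A Z\<close> and \<open>U Z\<close>.\<close>
  define Z where "Z = ?e *\<^sub>C v - T t v"
  have ZD: "Z = R s D"
    using commuting_T[OF res_commuting[OF r] t] by (simp add: Z_def D_def v_def linR)
  have D: "norm D \<le> (1 + M) * norm x"
    using norm_triangle_ineq4[of "?e *\<^sub>C x" "T t x"] T_bound[OF t, of x]
    unfolding D_def norm_scaleC norm_exp_i_times by (simp add: algebra_simps)
  have Z: "norm Z \<le> M * t * norm x" unfolding Z_def v_def by (rule R_orbit_bound[OF r t])
  have UZ: "?U Z = u *\<^sub>C (Z - ?U D)" unfolding ZD by (rule UR)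
  have M: "M \<ge> 1" "M \<ge> 0" by (use M_ge_1 in auto)
  have M2: "M \<le> M ^ 3" "M\<^sup>2 \<le> M ^ 3"
    using power_increasing[of 1 3 M] power_increasing[of 2 3 M] M by auto
  have "u * (1 - u) = - (\<i> * of_real s) * u\<^sup>2"
    using ne by (simp add: u_def field_simps power2_eq_square)
  then have q: "cmod (u - u\<^sup>2) = \<bar>s\<bar> / (1 + s\<^sup>2)"
    by (simp add: power2_eq_square right_diff_distrib norm_mult cu[symmetric])
      (metis cu divide_inverse inverse_eq_divide mult.assoc power2_eq_square times_divide_eq_right mult_1_right)
  have Qv: "Q v - (u - u\<^sup>2) *\<^sub>C v = u *\<^sub>C (u *\<^sub>C ?U x + ?U (?U x) - ?U x)"
  proof -
    have 1: "?U v = u *\<^sub>C (v - ?U x)" unfolding v_def by (rule UR)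
    have 2: "?U (?U v) = u *\<^sub>C (u *\<^sub>C (v - ?U x) - ?U (?U x))"
      by (simp add: 1 linU)
    show ?thesis unfolding 2 unfolding 1
      by (simp add: scaleC.diff_right scaleC.add_right scaleC.diff_left scaleC_scaleC power2_eq_square)
  qed
  have "norm (u *\<^sub>C ?U x + ?U (?U x) - ?U x) \<le> norm (u *\<^sub>C ?U x) + norm (?U (?U x)) + norm (?U x)"
    by (meson norm_triangle_ineq norm_triangle_ineq4 add_right_mono order_trans)
  also have "\<dots> \<le> 1 * (M * norm x) + M * (M * norm x) + M * norm x"
    unfolding norm_scaleC
    by (intro add_mono mult_mono u1 U_bound order_trans[OF U_bound mult_left_mono[OF U_bound]]) (use M in auto)
  also have "\<dots> = (2 * M + M\<^sup>2) * norm x" by (simp add: algebra_simps power2_eq_square)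
  also have "\<dots> \<le> (3 * M ^ 3) * norm x" using M2 by (intro mult_right_mono) auto
  finally have rem: "norm (Q v - (u - u\<^sup>2) *\<^sub>C v) \<le> cmod u * (3 * M ^ 3 * norm x)"
    unfolding Qv norm_scaleC by (intro mult_left_mono) auto
  have "?e *\<^sub>C Q v = T t (Q v) + Q Z"
  proof -
    have "Q Z = ?e *\<^sub>C Q v - T t (Q v)"
      using commuting_T[OF Q_commuting t, of v] unfolding Z_def by (simp only: linQ(2,3))
    moreover have "a = b + (a - b)" for a b :: 'a by simp
    ultimately show ?thesis by metis
  qed
  then have Qvn: "norm (Q v) \<le> norm (T t (Q v)) + norm (Q Z)"
    by (metis norm_triangle_ineq norm_scaleC norm_exp_i_times mult_1)
  have "\<bar>s\<bar> / (1 + s\<^sup>2) * norm v = norm ((u - u\<^sup>2) *\<^sub>C v)" by (simp add: norm_scaleC q)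
  also have "\<dots> \<le> norm (Q v) + norm (Q v - (u - u\<^sup>2) *\<^sub>C v)"
    using norm_triangle_ineq4[of "Q v" "Q v - (u - u\<^sup>2) *\<^sub>C v"] by simp
  finally have main: "\<bar>s\<bar> / (1 + s\<^sup>2) * norm v \<le> norm (T t (Q v)) + norm (Q Z) + cmod u * (3 * M ^ 3 * norm x)"
    using Qvn rem by simp
  have "norm (Q Z) \<le> 4 * M ^ 3 * (1 + \<bar>s\<bar> * t) * norm x"
  proof -
    have "(1 - \<i> * of_real s) *\<^sub>C ?U Z = Z - ?U D"
      unfolding UZ scaleC_scaleC using ne by (simp add: u_def)
    then have "Z - ?U Z = ?U D - (\<i> * of_real s) *\<^sub>C ?U Z"
      by (simp add: scaleC.diff_left algebra_simps)
    then have "norm (Z - ?U Z) \<le> norm (?U D) + norm ((\<i> * of_real s) *\<^sub>C ?U Z)"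
      by (simp only: norm_triangle_ineq4)
    also have "\<dots> \<le> M * ((1 + M) * norm x) + \<bar>s\<bar> * (M * (M * t * norm x))"
      unfolding norm_scaleC norm_mult
      by (intro add_mono order_trans[OF U_bound mult_left_mono[OF D]] mult_mono order_trans[OF U_bound mult_left_mono[OF Z]])
        (use M in auto)
    finally have "M * norm (Z - ?U Z) \<le> M * (M * ((1 + M) * norm x) + \<bar>s\<bar> * (M * (M * t * norm x)))"
      using M by (intro mult_left_mono) auto
    also have "\<dots> = (M\<^sup>2 + M ^ 3) * norm x + M ^ 3 * (\<bar>s\<bar> * t) * norm x"
      by (simp add: algebra_simps power2_eq_square power3_eq_cube)
    also have "\<dots> \<le> (4 * M ^ 3) * norm x + 4 * M ^ 3 * (\<bar>s\<bar> * t) * norm x"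
      using M2 M t by (intro add_mono mult_right_mono) auto
    also have "\<dots> = 4 * M ^ 3 * (1 + \<bar>s\<bar> * t) * norm x" by (simp add: algebra_simps)
    finally show ?thesis using U_bound[of "Z - ?U Z"] unfolding Q_eq by simp
  qed
  note low = this
  have "cmod u * (3 * M ^ 3 * norm x) \<le> 1 * (3 * M ^ 3 * norm x)"
    using u1 M by (intro mult_right_mono) auto
  also have "\<dots> = 3 * M ^ 3 * 1 * norm x" by simp
  also have "\<dots> \<le> 3 * M ^ 3 * (1 + \<bar>s\<bar> * t) * norm x"
    using M t by (intro mult_right_mono mult_left_mono) auto
  finally show "\<bar>s\<bar> / (1 + s\<^sup>2) * norm (R s x) \<le> norm (T t (Q (R s x))) + 7 * M ^ 3 * (1 + \<bar>s\<bar> * t) * norm x"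
    using main low unfolding v_def by (simp add: algebra_simps)
  have "norm (Q Z) \<le> cmod u * (4 * M ^ 3 * (1 + t) * norm x)"
  proof -
    have "norm (Q Z) \<le> (1 + M) * norm (?U Z)" by (rule id_minus_U_bound)
    also have "norm (?U Z) = cmod u * norm (Z - ?U D)" unfolding UZ norm_scaleC ..
    also have "(1 + M) * (cmod u * norm (Z - ?U D))
        \<le> (1 + M) * (cmod u * (M * t * norm x + M * ((1 + M) * norm x)))"
    proof (intro mult_left_mono)
      show "norm (Z - ?U D) \<le> M * t * norm x + M * ((1 + M) * norm x)"
        by (intro order_trans[OF norm_triangle_ineq4] add_mono Z order_trans[OF U_bound mult_left_mono[OF D]])
          (use M in auto)
    qed (use M in auto)
    also have "(1 + M) * (cmod u * (M * t * norm x + M * ((1 + M) * norm x)))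
       = cmod u * (((M + M\<^sup>2) * t + (M + 2 * M\<^sup>2 + M ^ 3)) * norm x)"
      by (simp add: algebra_simps power2_eq_square power3_eq_cube)
    also have "\<dots> \<le> cmod u * (((4 * M ^ 3) * t + 4 * M ^ 3) * norm x)"
      using M2 M t by (intro mult_left_mono mult_right_mono add_mono) auto
    finally show ?thesis using M by (simp add: algebra_simps)
  qed
  moreover have "cmod u * (3 * M ^ 3 * norm x) \<le> cmod u * (3 * M ^ 3 * (1 + t) * norm x)"
    using M t by (intro mult_left_mono mult_right_mono) auto
  ultimately show "\<bar>s\<bar> / (1 + s\<^sup>2) * norm (R s x) \<le> norm (T t (Q (R s x))) + cmod u * (7 * M ^ 3 * (1 + t)) * norm x"
    using main unfolding v_def by (simp add: algebra_simps)
qed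

text \<open>At the time at which \<open>T t Q\<close> has half the size of the scalar by which \<open>Q\<close> acts on the range of \<open>R s\<close>, the error terms of
  the preceding lemma bound \<open>R s\<close>. That time is of order \<open>\<bar>s\<bar> powr - \<gamma>\<close> near 0 and \<open>\<bar>s\<bar> powr \<gamma>\<close> at infinity. Near 0
  the part of the error that does not grow with \<open>t\<close> contributes \<open>1 / \<bar>s\<bar>\<close>, whence the exponent \<open>max 1 \<gamma>\<close>.\<close>

theorem resolvent_growth_of_decay:
  assumes r: "\<And>s. s \<noteq> 0 \<Longrightarrow> resolvable (\<i> * of_real s)" and g: "\<gamma> > 0" and c0: "c > 0" "t0 > 0"
    and decay: "\<And>t x. t \<ge> t0 \<Longrightarrow> norm (T t (Q x)) \<le> c * t powr (- 1 / \<gamma>) * norm x"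
  shows "\<exists>L\<ge>0. \<forall>s x. (s \<noteq> 0 \<and> \<bar>s\<bar> \<le> 1 \<longrightarrow> norm (R s x) \<le> L * \<bar>s\<bar> powr (- max 1 \<gamma>) * norm x) \<and>
    (\<bar>s\<bar> \<ge> 1 \<longrightarrow> norm (R s x) \<le> L * \<bar>s\<bar> powr \<gamma> * norm x)"
proof -
  \<comment> \<open>Enlarging the constant keeps every chosen time above \<open>t0\<close>.\<close>
  define d where "d = max c (t0 powr (1 / \<gamma>))"
  have d: "d > 0" "c \<le> d" "t0 powr (1 / \<gamma>) \<le> d" using c0 by (auto simp: d_def)
  define L where "L = 4 * (7 * M ^ 3) * (1 + (4 * d) powr \<gamma>)"
  have M: "M \<ge> 1" by (rule M_ge_1)
  have key: "\<bar>s\<bar> / (1 + s\<^sup>2) / 2 * norm (R s x) \<le> E * norm x"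
    if s: "s \<noteq> 0" and E: "\<bar>s\<bar> / (1 + s\<^sup>2) * norm (R s x)
        \<le> norm (T ((2 * d * (1 + s\<^sup>2) / \<bar>s\<bar>) powr \<gamma>) (Q (R s x))) + E * norm x" for s x E
  proof -
    \<comment> \<open>The time \<open>?k powr \<gamma>\<close> is chosen so that \<open>T t Q\<close> is at most half of the scalar \<open>\<bar>s\<bar> / (1 + s\<^sup>2)\<close>; its contribution is then absorbed on the left.\<close>
    let ?k = "2 * d * (1 + s\<^sup>2) / \<bar>s\<bar>"
    have k: "?k > 0" using s d by (simp add: add_pos_nonneg)
    have "2 * \<bar>s\<bar> \<le> 1 + s\<^sup>2" using zero_le_power2[of "\<bar>s\<bar> - 1"] by (simp add: power2_eq_square algebra_simps)
    then have "d * \<bar>s\<bar> \<le> d * (2 * (1 + s\<^sup>2))" using d by (intro mult_left_mono) auto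
    then have "d \<le> ?k" using s by (simp add: pos_le_divide_eq mult_ac)
    then have "(t0 powr (1 / \<gamma>)) powr \<gamma> \<le> ?k powr \<gamma>"
      using d g by (intro powr_mono2) auto
    then have "t0 \<le> ?k powr \<gamma>" using g c0 by (simp add: powr_powr)
    then have "norm (T (?k powr \<gamma>) (Q (R s x))) \<le> c * (?k powr \<gamma>) powr (- 1 / \<gamma>) * norm (R s x)"
      by (rule decay)
    also have "(?k powr \<gamma>) powr (- 1 / \<gamma>) = 1 / ?k"
    proof -
      have "(k powr \<gamma>) powr (- 1 / \<gamma>) = 1 / k" if "k > 0" for k
        using g that by (simp add: powr_powr powr_minus_divide)
      then show ?thesis using k by blast
    qed
    also have "c * (1 / ?k) * norm (R s x) \<le> d * (1 / ?k) * norm (R s x)"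
      using d k by (intro mult_right_mono) auto
    also have "d * (1 / ?k) = \<bar>s\<bar> / (1 + s\<^sup>2) / 2"
      using d by simp
    also have "\<bar>s\<bar> / (1 + s\<^sup>2) / 2 * norm (R s x) = (\<bar>s\<bar> / (1 + s\<^sup>2) * norm (R s x)) / 2" by simp
    finally have "(\<bar>s\<bar> / (1 + s\<^sup>2) * norm (R s x)) / 2 \<le> E * norm x" using E by linarith
    then show ?thesis by simp
  qed
  have low: "norm (R s x) \<le> L * \<bar>s\<bar> powr (- max 1 \<gamma>) * norm x" if s: "s \<noteq> 0" "\<bar>s\<bar> \<le> 1" for s x
  proof -
    let ?t = "(2 * d * (1 + s\<^sup>2) / \<bar>s\<bar>) powr \<gamma>"
    have s1: "s\<^sup>2 \<le> 1" using s by (simp add: power2_le_iff_abs_le abs_square_le_1)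
    have "\<bar>s\<bar> / (1 + s\<^sup>2) / 2 * norm (R s x) \<le> (7 * M ^ 3 * (1 + \<bar>s\<bar> * ?t)) * norm x"
      by (intro key s R_bound_by_decay r) auto
    moreover have "\<bar>s\<bar> / 4 * norm (R s x) \<le> \<bar>s\<bar> / (1 + s\<^sup>2) / 2 * norm (R s x)"
    proof (intro mult_right_mono)
      have "\<bar>s\<bar> / 4 \<le> \<bar>s\<bar> / ((1 + s\<^sup>2) * 2)"
        by (intro divide_left_mono) (use s1 in \<open>auto simp: add_pos_nonneg\<close>)
      then show "\<bar>s\<bar> / 4 \<le> \<bar>s\<bar> / (1 + s\<^sup>2) / 2" by (simp only: divide_divide_eq_left)
    qed simp
    moreover have "?t \<le> (4 * d) powr \<gamma> * \<bar>s\<bar> powr - \<gamma>"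
    proof -
      have "?t \<le> (4 * d / \<bar>s\<bar>) powr \<gamma>"
        using s1 d g by (intro powr_mono2 divide_right_mono) auto
      also have "\<dots> = (4 * d) powr \<gamma> * \<bar>s\<bar> powr - \<gamma>"
        using d by (simp add: powr_divide powr_minus_divide)
      finally show ?thesis .
    qed
    ultimately have "\<bar>s\<bar> / 4 * norm (R s x) \<le> (7 * M ^ 3 * (1 + \<bar>s\<bar> * ((4 * d) powr \<gamma> * \<bar>s\<bar> powr - \<gamma>))) * norm x"
      using M by (elim order_trans) (auto intro!: mult_right_mono mult_left_mono add_left_mono)
    moreover have "1 + \<bar>s\<bar> * ((4 * d) powr \<gamma> * \<bar>s\<bar> powr - \<gamma>) \<le> \<bar>s\<bar> * ((1 + (4 * d) powr \<gamma>) * \<bar>s\<bar> powr (- max 1 \<gamma>))"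
    proof -
      have "\<bar>s\<bar> powr - 1 \<le> \<bar>s\<bar> powr (- max 1 \<gamma>)" "\<bar>s\<bar> powr - \<gamma> \<le> \<bar>s\<bar> powr (- max 1 \<gamma>)"
        by (rule powr_mono'; use s in simp)+
      then have "\<bar>s\<bar> * (\<bar>s\<bar> powr - 1 + (4 * d) powr \<gamma> * \<bar>s\<bar> powr - \<gamma>)
         \<le> \<bar>s\<bar> * (\<bar>s\<bar> powr (- max 1 \<gamma>) + (4 * d) powr \<gamma> * \<bar>s\<bar> powr (- max 1 \<gamma>))"
        by (intro mult_left_mono add_mono) auto
      then show ?thesis using s by (simp add: algebra_simps powr_minus_divide)
    qed
    then have "(7 * M ^ 3 * (1 + \<bar>s\<bar> * ((4 * d) powr \<gamma> * \<bar>s\<bar> powr - \<gamma>))) * norm x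
       \<le> (7 * M ^ 3 * (\<bar>s\<bar> * ((1 + (4 * d) powr \<gamma>) * \<bar>s\<bar> powr (- max 1 \<gamma>)))) * norm x"
      using M by (intro mult_right_mono mult_left_mono) auto
    ultimately have "\<bar>s\<bar> / 4 * norm (R s x)
       \<le> (7 * M ^ 3 * (\<bar>s\<bar> * ((1 + (4 * d) powr \<gamma>) * \<bar>s\<bar> powr (- max 1 \<gamma>)))) * norm x"
      by (rule order_trans)
    then have "\<bar>s\<bar> * norm (R s x) \<le> \<bar>s\<bar> * (L * \<bar>s\<bar> powr (- max 1 \<gamma>) * norm x)"
      by (simp add: L_def mult_ac del: distrib_left_numeral distrib_right_numeral)
    then show ?thesis by (rule mult_left_le_imp_le) (use s in simp)
  qed
  have high: "norm (R s x) \<le> L * \<bar>s\<bar> powr \<gamma> * norm x" if s: "\<bar>s\<bar> \<ge> 1" for s x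
  proof -
    let ?t = "(2 * d * (1 + s\<^sup>2) / \<bar>s\<bar>) powr \<gamma>" and ?u = "1 / (1 - \<i> * of_real s)"
    have s0: "s \<noteq> 0" using s by auto
    have s1: "1 \<le> s\<^sup>2" using s by (metis abs_ge_zero one_le_power power2_abs)
    have k1: "\<bar>s\<bar> / (1 + s\<^sup>2) / 2 * norm (R s x) \<le> (cmod ?u * (7 * M ^ 3 * (1 + ?t))) * norm x"
      by (intro key s0 R_bound_by_decay r) auto
    have k2: "(1 / (4 * \<bar>s\<bar>)) * norm (R s x) \<le> \<bar>s\<bar> / (1 + s\<^sup>2) / 2 * norm (R s x)"
      using s1 s0 by (intro mult_right_mono) (auto simp: field_simps power2_eq_square abs_mult_self_eq intro!: add_pos_nonneg)
    have kt: "?t \<le> (4 * d) powr \<gamma> * \<bar>s\<bar> powr \<gamma>"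
    proof -
      have "2 * d * (1 + s\<^sup>2) \<le> 2 * d * (2 * s\<^sup>2)" using s1 d by (intro mult_left_mono) auto
      then have "?t \<le> (4 * d * \<bar>s\<bar>) powr \<gamma>"
      proof (intro powr_mono2)
        have "4 * d * \<bar>s\<bar> * \<bar>s\<bar> = 4 * d * (s * s)" by (simp only: mult.assoc abs_mult_self_eq)
        then have "2 * d * (1 + s\<^sup>2) \<le> 4 * d * \<bar>s\<bar> * \<bar>s\<bar>"
          using \<open>2 * d * (1 + s\<^sup>2) \<le> 2 * d * (2 * s\<^sup>2)\<close> by (simp add: power2_eq_square)
        then show "2 * d * (1 + s\<^sup>2) / \<bar>s\<bar> \<le> 4 * d * \<bar>s\<bar>" using s0 by (simp add: pos_divide_le_eq)
      qed (use d g s0 in auto)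
      then show ?thesis using d by (simp add: powr_mult)
    qed
    have ku: "cmod ?u \<le> 1 / \<bar>s\<bar>"
    proof -
      have "\<bar>s\<bar> \<le> cmod (1 - \<i> * of_real s)" using abs_Im_le_cmod[of "1 - \<i> * of_real s"] by simp
      then show ?thesis using s0 by (simp add: norm_divide divide_left_mono)
    qed
    have k3: "(cmod ?u * (7 * M ^ 3 * (1 + ?t))) * norm x
        \<le> ((1 / \<bar>s\<bar>) * (7 * M ^ 3 * (1 + (4 * d) powr \<gamma> * \<bar>s\<bar> powr \<gamma>))) * norm x"
      using M by (intro mult_right_mono mult_mono[OF ku] mult_left_mono add_left_mono kt) auto
    have "(1 / (4 * \<bar>s\<bar>)) * norm (R s x) \<le> ((1 / \<bar>s\<bar>) * (7 * M ^ 3 * (1 + (4 * d) powr \<gamma> * \<bar>s\<bar> powr \<gamma>))) * norm x"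
      by (rule order_trans[OF k2 order_trans[OF k1 k3]])
    then have "norm (R s x) \<le> 4 * (7 * M ^ 3) * (1 + (4 * d) powr \<gamma> * \<bar>s\<bar> powr \<gamma>) * norm x"
      using s0 by (simp add: field_simps)
    also have "\<dots> \<le> 4 * (7 * M ^ 3) * (\<bar>s\<bar> powr \<gamma> + (4 * d) powr \<gamma> * \<bar>s\<bar> powr \<gamma>) * norm x"
      using M s g by (intro mult_right_mono mult_left_mono add_right_mono) (auto intro: ge_one_powr_ge_zero)
    also have "\<dots> = L * \<bar>s\<bar> powr \<gamma> * norm x" by (simp add: L_def algebra_simps)
    finally show ?thesis .
  qed
  have "L \<ge> 0" using M by (simp add: L_def)
  then show ?thesis using low high by blast
qed

section \<open>Local boundedness of the resolvent on the imaginary axis\<close>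

text \<open>The growth assumption only speaks of neighbourhoods of 0 and infinity; in between, the resolvent is locally bounded by the
  resolvent identity, and compactness does the rest.\<close>

lemma R_locally_bounded:
  assumes r: "\<And>s. s \<noteq> 0 \<Longrightarrow> resolvable (\<i> * of_real s)" and d: "0 < d"
  shows "\<exists>L\<ge>0. \<forall>s x. d \<le> \<bar>s\<bar> \<and> \<bar>s\<bar> \<le> b \<longrightarrow> norm (R s x) \<le> L * norm x"
proof -
  define S where "S = {s. d \<le> \<bar>s\<bar> \<and> \<bar>s\<bar> \<le> b}"
  have S0: "s \<noteq> 0" if "s \<in> S" for s using that d by (auto simp: S_def)
  have local: "\<exists>e>0. \<exists>L\<ge>0. \<forall>s\<in>S \<inter> ball s0 e. \<forall>x. norm (R s x) \<le> L * norm x" if s0: "s0 \<in> S" for s0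
  proof -
    obtain L where L: "L > 0" "\<And>x. norm (R s0 x) \<le> L * norm x"
      using bounded_clinear_bound[OF resolvable_graph(2)[OF r[OF S0[OF s0]]]] by blast
    have "norm (R s x) \<le> (2 * L) * norm x" if s: "s \<in> S" "dist s0 s < 1 / (2 * L)" for s x
    proof -
      have "R s x - R s0 x = (\<i> * of_real s0 - \<i> * of_real s) *\<^sub>C R s (R s0 x)"
        by (rule resolvent_identity) (use r S0 s s0 in auto)
      also have "R s (R s0 x) = R s0 (R s x)"
        by (rule res_commute) (use r S0 s s0 in auto)
      finally have "R s x = R s0 x + (\<i> * of_real (s0 - s)) *\<^sub>C R s0 (R s x)"
        by (simp add: algebra_simps)
      then have "norm (R s x) \<le> norm (R s0 x) + norm ((\<i> * of_real (s0 - s)) *\<^sub>C R s0 (R s x))"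
        by (metis norm_triangle_ineq)
      also have "\<dots> \<le> L * norm x + (1 / (2 * L)) * (L * norm (R s x))"
      proof -
        have "cmod (\<i> * of_real (s0 - s)) = \<bar>s0 - s\<bar>"
          by (simp only: norm_mult norm_ii norm_of_real mult_1_left)
        then show ?thesis unfolding norm_scaleC
          using s L by (intro add_mono mult_mono L) (auto simp: dist_real_def)
      qed
      also have "(1 / (2 * L)) * (L * norm (R s x)) = norm (R s x) / 2" using L by simp
      finally show ?thesis by simp
    qed
    then show ?thesis
      using L by (intro exI[of _ "1 / (2 * L)"] conjI exI[of _ "2 * L"]) auto
  qed
  then obtain e where e: "\<And>s. s \<in> S \<Longrightarrow> e s > 0"
    "\<And>s0. s0 \<in> S \<Longrightarrow> \<exists>L\<ge>0. \<forall>s\<in>S \<inter> ball s0 (e s0). \<forall>x. norm (R s x) \<le> L * norm x"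
    by metis
  then obtain L where L: "\<And>s0. s0 \<in> S \<Longrightarrow> L s0 \<ge> 0"
    "\<And>s0 s x. s0 \<in> S \<Longrightarrow> s \<in> S \<inter> ball s0 (e s0) \<Longrightarrow> norm (R s x) \<le> L s0 * norm x"
    by metis
  have "S = {-b..-d} \<union> {d..b}" using d by (auto simp: S_def abs_if split: if_splits)
  then have "compact S" by (simp add: compact_Un)
  moreover have "S \<subseteq> (\<Union>s\<in>S. ball s (e s))" using e(1) by auto
  ultimately obtain F where F: "F \<subseteq> S" "finite F" "S \<subseteq> (\<Union>s\<in>F. ball s (e s))"
    by (elim compactE_image[of S S "\<lambda>s. ball s (e s)"]) auto
  have "norm (R s x) \<le> (\<Sum>s0\<in>F. L s0) * norm x" if "s \<in> S" for s x
  proof -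
    obtain s0 where s0: "s0 \<in> F" "s \<in> ball s0 (e s0)" using F(3) \<open>s \<in> S\<close> by auto
    then have "norm (R s x) \<le> L s0 * norm x" using L(2) F(1) \<open>s \<in> S\<close> by auto
    also have "\<dots> \<le> (\<Sum>s0\<in>F. L s0) * norm x"
      using s0 F L(1) by (intro mult_right_mono member_le_sum) auto
    finally show ?thesis .
  qed
  moreover have "0 \<le> (\<Sum>s0\<in>F. L s0)" using F(1) L(1) by (intro sum_nonneg) auto
  ultimately show ?thesis by (auto simp: S_def)
qed

section \<open>From resolvent growth to decay\<close>

text \<open>The operator \<open>A (p + A)\<^sup>-\<^sup>1\<close>, which damps the frequencies below \<open>p\<close>, whereas the Euler
  operator \<open>p (p + A)\<^sup>-\<^sup>1\<close> damps those above \<open>p\<close>.\<close>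

definition lowcut :: "real \<Rightarrow> 'a \<Rightarrow> 'a" where
  "lowcut p v = v - euler p v"

lemma lowcut_commuting: "p > 0 \<Longrightarrow> commuting (lowcut p)"
  unfolding lowcut_def[abs_def] by (intro commuting_sub commuting_id euler_commuting)

lemma lowcut_bound:
  assumes "p > 0"
  shows "norm (lowcut p v) \<le> (1 + M) * norm v"
  using norm_triangle_ineq4[of v "euler p v"] euler_bound[OF assms, of v]
  by (simp add: lowcut_def algebra_simps)

lemma lowcut_pow_bound: "p > 0 \<Longrightarrow> norm ((lowcut p ^^ j) v) \<le> (1 + M) ^ j * norm v"
  using M_ge_1 by (intro norm_funpow_le_power lowcut_bound) auto

lemma lowcut_pow_bound_le: "p > 0 \<Longrightarrow> j < m \<Longrightarrow> norm ((lowcut p ^^ j) v) \<le> (1 + M) ^ m * norm v"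
  using M_ge_1 by (intro order_trans[OF lowcut_pow_bound] mult_right_mono power_increasing) auto

lemma lowcut_U: "p > 0 \<Longrightarrow> lowcut p (U x) = res (of_real p) (x - U x)"
  using euler_minus_id[OF _ AU_in_A, of p x] by (metis lowcut_def minus_diff_eq minus_minus)

lemma commuting_funpow_res:
  "commuting f \<Longrightarrow> resolvable z \<Longrightarrow> (f ^^ j) (res z v) = res z ((f ^^ j) v)"
  by (rule commuting_res[OF commuting_funpow])

text \<open>At the value \<open>- i s\<close> of \<open>A\<close> the Euler operator has the value \<open>q\<close> and the low cutoff the value \<open>1 - q\<close>; each of
  them is small at the frequencies that its operator is meant to suppress.\<close>

lemma euler_R:
  fixes p s :: real
  assumes r: "resolvable (\<i> * of_real s)" and p: "p > 0"
  defines "q \<equiv> of_real p / (of_real p - \<i> * of_real s)"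
  shows "euler p (R s y) - q *\<^sub>C R s y = - (q *\<^sub>C res (of_real p) y)"
    "lowcut p (R s y) - (1 - q) *\<^sub>C R s y = q *\<^sub>C res (of_real p) y"
    "cmod q \<le> p / max p \<bar>s\<bar>" "cmod (1 - q) \<le> \<bar>s\<bar> / max p \<bar>s\<bar>"
proof -
  let ?d = "complex_of_real p - \<i> * of_real s"
  have ne: "?d \<noteq> 0" using p by (simp add: complex_eq_iff)
  have d: "0 < max p \<bar>s\<bar>" "max p \<bar>s\<bar> \<le> cmod ?d"
    using abs_Re_le_cmod[of ?d] abs_Im_le_cmod[of ?d] p by auto
  then have cd: "cmod ?d > 0" by linarith
  have "res (of_real p) (R s y) = (1 / ?d) *\<^sub>C (R s y - res (of_real p) y)"
    by (rule res_R[OF resolvable_real[OF p] r]) (use ne in auto)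
  then have "euler p (R s y) = of_real p *\<^sub>C (1 / ?d) *\<^sub>C (R s y - res (of_real p) y)"
    unfolding euler_def by (simp only: scaleC_of_real)
  then have 1: "euler p (R s y) = q *\<^sub>C R s y - q *\<^sub>C res (of_real p) y"
    by (simp add: scaleC_scaleC scaleC.diff_right q_def)
  then show "euler p (R s y) - q *\<^sub>C R s y = - (q *\<^sub>C res (of_real p) y)" by simp
  have "1 *\<^sub>C R s y = R s y" using scaleC_of_real[of 1 "R s y"] by simp
  with 1 show "lowcut p (R s y) - (1 - q) *\<^sub>C R s y = q *\<^sub>C res (of_real p) y"
    by (simp add: lowcut_def scaleC.diff_left)
  show "cmod q \<le> p / max p \<bar>s\<bar>"
    using d p cd by (simp add: q_def norm_divide divide_left_mono)
  have "1 - q = - (\<i> * of_real s) / ?d" using ne by (simp add: q_def field_simps)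
  then have "cmod (1 - q) = \<bar>s\<bar> / cmod ?d" by (simp add: norm_divide norm_mult)
  also have "\<dots> \<le> \<bar>s\<bar> / max p \<bar>s\<bar>" using d cd by (intro divide_left_mono mult_pos_pos) auto
  finally show "cmod (1 - q) \<le> \<bar>s\<bar> / max p \<bar>s\<bar>" .
qed

lemma euler_R_pow_bound:
  fixes p s :: real
  assumes r: "resolvable (\<i> * of_real s)" and p: "p > 0"
  shows "norm ((euler p ^^ m) (R s y))
      \<le> (p / max p \<bar>s\<bar>) ^ m * norm (R s y) + real m * M * norm (res (of_real p) y)"
    and "norm ((lowcut p ^^ m) (R s y))
      \<le> (\<bar>s\<bar> / max p \<bar>s\<bar>) ^ m * norm (R s y) + real m * (1 + M) ^ m * norm (res (of_real p) y)"
proof -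
  define q where "q = of_real p / (of_real p - \<i> * of_real s)"
  note E = euler_R[OF r p, folded q_def]
  have M: "M \<ge> 1" by (rule M_ge_1)
  have mx: "max p \<bar>s\<bar> > 0" using p by linarith
  then have le1: "p / max p \<bar>s\<bar> \<le> 1" "\<bar>s\<bar> / max p \<bar>s\<bar> \<le> 1" by simp_all
  have q1: "cmod q \<le> 1" and q2: "cmod (1 - q) \<le> 1" using E(3,4) le1 by linarith+
  have d: "norm (q *\<^sub>C res (of_real p) y) \<le> norm (res (of_real p) y)"
    using q1 by (simp add: norm_scaleC mult_left_le_one_le)
  have "norm ((euler p ^^ m) (R s y))
      \<le> cmod q ^ m * norm (R s y) + real m * M * norm (euler p (R s y) - q *\<^sub>C R s y)"
    by (rule norm_funpow_le[OF commuting_clinear[OF euler_commuting[OF p]] euler_pow_bound[OF p] q1])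
  also have "\<dots> \<le> (p / max p \<bar>s\<bar>) ^ m * norm (R s y) + real m * M * norm (res (of_real p) y)"
    unfolding E(1) norm_minus_cancel using M
    by (intro add_mono mult_right_mono mult_left_mono power_mono E(3) d) auto
  finally show "norm ((euler p ^^ m) (R s y))
      \<le> (p / max p \<bar>s\<bar>) ^ m * norm (R s y) + real m * M * norm (res (of_real p) y)" .
  have "norm ((lowcut p ^^ m) (R s y))
      \<le> cmod (1 - q) ^ m * norm (R s y) + real m * (1 + M) ^ m * norm (lowcut p (R s y) - (1 - q) *\<^sub>C R s y)"
    by (rule norm_funpow_le[OF commuting_clinear[OF lowcut_commuting[OF p]] lowcut_pow_bound_le[OF p] q2])
  also have "\<dots> \<le> (\<bar>s\<bar> / max p \<bar>s\<bar>) ^ m * norm (R s y) + real m * (1 + M) ^ m * norm (res (of_real p) y)"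
    unfolding E(2) using M
    by (intro add_mono mult_right_mono mult_left_mono power_mono E(4) d) auto
  finally show "norm ((lowcut p ^^ m) (R s y))
      \<le> (\<bar>s\<bar> / max p \<bar>s\<bar>) ^ m * norm (R s y) + real m * (1 + M) ^ m * norm (res (of_real p) y)" .
qed

text \<open>One factor \<open>A (1 + A)\<^sup>-\<^sup>1\<close> gains one power of \<open>s\<close>, because \<open>A R s = 1 - i s R s\<close>. The remaining singularity at
  \<open>s = 0\<close> is removed by the cutoff, whose factors on the range of \<open>R s\<close> are at most \<open>\<bar>s\<bar> / e\<close>.\<close>

lemma R_lowcut_bound:
  assumes e: "0 < e" "e \<le> 1" and r: "resolvable (\<i> * of_real s)" and s: "s \<noteq> 0" "\<bar>s\<bar> \<le> 1"
    and m: "1 \<le> \<gamma>" "\<gamma> - 1 \<le> real m" and C: "C \<ge> 0" "norm (R s x) \<le> C * \<bar>s\<bar> powr - \<gamma> * norm x"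
  shows "norm ((lowcut e ^^ m) (R s (x - U x)))
    \<le> (M * (1 + C) + real m * (1 + M) ^ m * ((1 + M) * M)) * e powr (1 - \<gamma>) * norm x"
proof -
  define v where "v = R s (x - U x)"
  define c where "c = real m * (1 + M) ^ m * ((1 + M) * M)"
  have M: "M \<ge> 1" by (rule M_ge_1)
  have "v = U (x - (\<i> * of_real s) *\<^sub>C R s x)"
  proof -
    have "v = R s x - U (R s x)"
      using bounded_clinearD[OF resolvable_graph(2)[OF r]]
      by (simp add: v_def res_commute[OF resolvable_1 r])
    moreover have "R s x = U (1 *\<^sub>C R s x + (x - (\<i> * of_real s) *\<^sub>C R s x))"
      by (rule res_left[OF resolvable_1 res_in_A[OF r], symmetric])
    then have "R s x = U (R s x) + U (x - (\<i> * of_real s) *\<^sub>C R s x)"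
      by (simp add: bounded_clinearD(1)[OF resolvable_graph(2)[OF resolvable_1]])
    ultimately show ?thesis by (metis add_diff_cancel_left')
  qed
  then have "norm v \<le> M * norm (x - (\<i> * of_real s) *\<^sub>C R s x)" using U_bound by simp
  also have "\<dots> \<le> M * (norm x + \<bar>s\<bar> * (C * \<bar>s\<bar> powr - \<gamma> * norm x))"
    using M C s by (intro mult_left_mono order_trans[OF norm_triangle_ineq4] add_left_mono)
      (auto simp: norm_scaleC norm_mult)
  also have "\<dots> = M * (1 + C * \<bar>s\<bar> powr (1 - \<gamma>)) * norm x"
    using s by (simp add: powr_diff powr_minus_divide algebra_simps)
  also have "\<dots> \<le> M * (\<bar>s\<bar> powr (1 - \<gamma>) + C * \<bar>s\<bar> powr (1 - \<gamma>)) * norm x"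
    using M s m powr_mono'[of "1 - \<gamma>" 0 "\<bar>s\<bar>"]
    by (intro mult_right_mono mult_left_mono add_right_mono) auto
  finally have v: "norm v \<le> M * (1 + C) * \<bar>s\<bar> powr (1 - \<gamma>) * norm x" by (simp add: algebra_simps)
  have d: "norm (res (of_real e) (x - U x)) \<le> (1 + M) * (M * norm x)"
    unfolding lowcut_U[OF e(1), symmetric] using M
    by (intro order_trans[OF lowcut_bound[OF e(1)]] mult_left_mono U_bound) auto
  have "norm ((lowcut e ^^ m) v)
      \<le> (\<bar>s\<bar> / max e \<bar>s\<bar>) ^ m * norm v + real m * (1 + M) ^ m * norm (res (of_real e) (x - U x))"
    unfolding v_def by (rule euler_R_pow_bound(2)[OF r e(1)])
  also have "\<dots> \<le> (\<bar>s\<bar> / e) powr (\<gamma> - 1) * (M * (1 + C) * \<bar>s\<bar> powr (1 - \<gamma>) * norm x)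
      + real m * (1 + M) ^ m * ((1 + M) * (M * norm x))"
  proof (intro add_mono mult_mono power_le_powr_cutoff mult_left_mono v d)
    show "\<bar>s\<bar> / max e \<bar>s\<bar> \<le> \<bar>s\<bar> / e" using e by (intro divide_left_mono) auto
  qed (use M e s m in auto)
  also have "(\<bar>s\<bar> / e) powr (\<gamma> - 1) * (M * (1 + C) * \<bar>s\<bar> powr (1 - \<gamma>) * norm x)
      = M * (1 + C) * e powr (1 - \<gamma>) * norm x"
    using e s by (simp add: powr_divide powr_diff field_simps)
  also have "real m * (1 + M) ^ m * ((1 + M) * (M * norm x)) = c * 1 * norm x" by (simp add: c_def mult_ac)
  also have "\<dots> \<le> c * e powr (1 - \<gamma>) * norm x"
    using M e m powr_mono'[of "1 - \<gamma>" 0 e] by (intro mult_right_mono mult_left_mono) (auto simp: c_def)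
  finally show ?thesis unfolding v_def c_def by (simp add: algebra_simps)
qed

text \<open>The mirror image at infinity: one factor \<open>(1 + A)\<^sup>-\<^sup>1\<close> gains a factor \<open>1 / \<bar>s\<bar>\<close>.\<close>

lemma R_euler_bound:
  assumes e: "0 < e" "e \<le> 1" and r: "resolvable (\<i> * of_real s)" and s: "\<bar>s\<bar> \<ge> 1"
    and m: "1 \<le> \<gamma>" "\<gamma> - 1 \<le> real m" and C: "C \<ge> 0" "norm (R s x) \<le> C * \<bar>s\<bar> powr \<gamma> * norm x"
  shows "norm ((euler (1 / e) ^^ m) (R s (U x)))
    \<le> (C + M + real m * M * (M * M)) * e powr (1 - \<gamma>) * norm x"
proof -
  define v where "v = R s (U x)"
  define c where "c = real m * M * (M * M)"
  have M: "M \<ge> 1" by (rule M_ge_1)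
  have p: "1 / e > 0" using e by simp
  have "v = (1 / (1 - \<i> * of_real s)) *\<^sub>C (R s x - U x)"
    unfolding v_def res_commute[OF r resolvable_1]
    by (rule res_R[OF resolvable_1 r]) (auto simp: complex_eq_iff)
  then have "norm v = 1 / cmod (1 - \<i> * of_real s) * norm (R s x - U x)"
    by (simp add: norm_scaleC norm_divide)
  also have "\<dots> \<le> 1 / \<bar>s\<bar> * (C * \<bar>s\<bar> powr \<gamma> * norm x + M * norm x)"
  proof (intro mult_mono)
    have "\<bar>s\<bar> \<le> cmod (1 - \<i> * of_real s)" using abs_Im_le_cmod[of "1 - \<i> * of_real s"] by simp
    then show "1 / cmod (1 - \<i> * of_real s) \<le> 1 / \<bar>s\<bar>" using s by (intro divide_left_mono) (auto simp: complex_eq_iff)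
    show "norm (R s x - U x) \<le> C * \<bar>s\<bar> powr \<gamma> * norm x + M * norm x"
      by (intro order_trans[OF norm_triangle_ineq4] add_mono C U_bound)
  qed auto
  also have "\<dots> \<le> 1 / \<bar>s\<bar> * (C * \<bar>s\<bar> powr \<gamma> * norm x + M * \<bar>s\<bar> powr \<gamma> * norm x)"
  proof (intro mult_left_mono add_left_mono mult_right_mono)
    have "1 \<le> \<bar>s\<bar> powr \<gamma>" using s m by (intro ge_one_powr_ge_zero) auto
    then show "M \<le> M * \<bar>s\<bar> powr \<gamma>" using M by simp
  qed auto
  finally have v: "norm v \<le> (C + M) * \<bar>s\<bar> powr (\<gamma> - 1) * norm x"
    using s by (simp add: powr_diff algebra_simps add_divide_distrib)
  have "norm (res (of_real (1 / e)) (U x)) = e * norm (euler (1 / e) (U x))"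
    using e by (simp add: euler_def)
  also have "\<dots> \<le> 1 * (M * (M * norm x))"
    using e M by (intro mult_mono order_trans[OF euler_bound[OF p]] U_bound) auto
  finally have d: "norm (res (of_real (1 / e)) (U x)) \<le> M * (M * norm x)" by simp
  have "norm ((euler (1 / e) ^^ m) v)
      \<le> ((1 / e) / max (1 / e) \<bar>s\<bar>) ^ m * norm v + real m * M * norm (res (of_real (1 / e)) (U x))"
    unfolding v_def by (rule euler_R_pow_bound(1)[OF r p])
  also have "\<dots> \<le> (1 / (e * \<bar>s\<bar>)) powr (\<gamma> - 1) * ((C + M) * \<bar>s\<bar> powr (\<gamma> - 1) * norm x)
      + real m * M * (M * (M * norm x))"
  proof (intro add_mono mult_mono power_le_powr_cutoff mult_left_mono v d)
    have "(1 / e) / max (1 / e) \<bar>s\<bar> \<le> (1 / e) / \<bar>s\<bar>" using e s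
      by (intro divide_left_mono mult_pos_pos) (auto simp: less_max_iff_disj)
    then show "(1 / e) / max (1 / e) \<bar>s\<bar> \<le> 1 / (e * \<bar>s\<bar>)" by simp
    have "q / max q \<bar>s\<bar> \<le> 1 \<and> 0 \<le> q / max q \<bar>s\<bar>" if "q > 0" for q
    proof -
      have "max q \<bar>s\<bar> > 0" using that by linarith
      then show ?thesis using that by simp
    qed
    from this[OF p] show "(1 / e) / max (1 / e) \<bar>s\<bar> \<le> 1" "0 \<le> (1 / e) / max (1 / e) \<bar>s\<bar>" by blast+
    show "0 < 1 / (e * \<bar>s\<bar>)" using e s by (intro divide_pos_pos mult_pos_pos) auto
  qed (use M e s m C in auto)
  also have "(1 / (e * \<bar>s\<bar>)) powr (\<gamma> - 1) * ((C + M) * \<bar>s\<bar> powr (\<gamma> - 1) * norm x)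
      = (C + M) * e powr (1 - \<gamma>) * norm x"
    using e s by (simp add: powr_divide powr_mult powr_diff field_simps)
  also have "real m * M * (M * (M * norm x)) = c * 1 * norm x" by (simp add: c_def mult_ac)
  also have "\<dots> \<le> c * e powr (1 - \<gamma>) * norm x"
    using M e m powr_mono'[of "1 - \<gamma>" 0 e] by (intro mult_right_mono mult_left_mono) (auto simp: c_def)
  finally show ?thesis unfolding v_def c_def by (simp add: algebra_simps)
qed

text \<open>The low cutoff moves vectors in the range of \<open>A\<close> by \<open>O(e)\<close>, the high one moves vectors in the domain of \<open>A\<close> by \<open>O(e)\<close>;
  the range of \<open>Q\<close> consists of vectors of both kinds.\<close>

lemma Q_cutoff_error:
  assumes e: "0 < e"
  shows "norm (Q (x - (lowcut e ^^ m) ((euler (1 / e) ^^ m) x)))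
    \<le> (real m * M * (1 + M)\<^sup>2 + real m * (1 + M) ^ (m + 1) * M\<^sup>2) * M * e * norm x"
proof -
  let ?a = "lowcut e" and ?b = "euler (1 / e)"
  have M: "M \<ge> 1" by (rule M_ge_1)
  have p: "1 / e > 0" using e by simp
  note lin = bounded_clinearD[OF commuting_clinear[OF Q_commuting]]
  have low: "norm (Q y - (?a ^^ m) (Q y)) \<le> real m * (1 + M) ^ m * (e * ((1 + M) * (M * (M * norm y))))" for y
  proof -
    have "Q y - ?a (Q y) = e *\<^sub>R ?a (U (U y))"
      using lowcut_U[OF e, of "U y"] by (simp add: lowcut_def[of e "Q y"] euler_def)
    also have "norm \<dots> \<le> e * ((1 + M) * (M * (M * norm y)))"
      using M e by (simp, intro order_trans[OF lowcut_bound[OF e]] mult_left_mono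
          order_trans[OF U_bound] U_bound) auto
    finally have d: "norm (Q y - ?a (Q y)) \<le> e * ((1 + M) * (M * (M * norm y)))" .
    have "norm (Q y - (?a ^^ m) (Q y)) \<le> real m * (1 + M) ^ m * norm (Q y - ?a (Q y))"
      by (rule norm_minus_funpow_le[OF commuting_clinear[OF lowcut_commuting[OF e]] lowcut_pow_bound_le[OF e]])
    also have "\<dots> \<le> real m * (1 + M) ^ m * (e * ((1 + M) * (M * (M * norm y))))"
      using M by (intro mult_left_mono d) auto
    finally show ?thesis .
  qed
  have high: "norm (Q x - (?b ^^ m) (Q x)) \<le> real m * M * (e * (M * ((1 + M) * ((1 + M) * norm x))))"
  proof -
    let ?y = "x - U x"
    have "?b (Q x) - Q x = - res (of_real (1 / e)) (?y - U ?y)"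
      unfolding Q_eq by (rule euler_minus_id[OF p AU_in_A])
    then have "norm (Q x - ?b (Q x)) = e * norm (?b (?y - U ?y))"
      using e by (simp add: norm_minus_commute[of "Q x"] euler_def)
    also have "\<dots> \<le> e * (M * ((1 + M) * ((1 + M) * norm x)))"
      using M e by (intro mult_left_mono order_trans[OF euler_bound[OF p]]
          order_trans[OF id_minus_U_bound] id_minus_U_bound) auto
    finally show ?thesis
      using M by (intro order_trans[OF norm_minus_funpow_le[OF commuting_clinear[OF
            euler_commuting[OF p]] euler_pow_bound[OF p]]] mult_left_mono) auto
  qed
  have com: "Q ((f ^^ m) y) = (f ^^ m) (Q y)" if "commuting f" for f y
    by (simp only: commuting_funpow_res[OF that resolvable_1]
        bounded_clinearD(2)[OF commuting_clinear[OF commuting_funpow[OF that]]])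
  have "Q (x - (?a ^^ m) ((?b ^^ m) x))
    = (Q x - (?b ^^ m) (Q x)) + (Q ((?b ^^ m) x) - (?a ^^ m) (Q ((?b ^^ m) x)))"
    using com[OF lowcut_commuting[OF e], of "(?b ^^ m) x"] com[OF euler_commuting[OF p], of x]
    by (simp add: lin)
  also have "norm \<dots> \<le> real m * M * (e * (M * ((1 + M) * ((1 + M) * norm x))))
      + real m * (1 + M) ^ m * (e * ((1 + M) * (M * (M * (M * norm x)))))"
    using M e by (intro order_trans[OF norm_triangle_ineq] add_mono high order_trans[OF low]
        mult_left_mono euler_pow_bound p) auto
  also have "\<dots> = (real m * M * (1 + M)\<^sup>2 + real m * (1 + M) ^ (m + 1) * M\<^sup>2) * M * e * norm x"
    by (simp add: power2_eq_square algebra_simps)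
  finally show ?thesis .
qed

text \<open>The truncated operator \<open>B e\<close> satisfies \<open>R s (B e) = O(e powr (1 - \<gamma>))\<close> uniformly in \<open>s\<close>, hence \<open>T t (B e)\<close> is
  \<open>O(e powr (1 - \<gamma>) / t)\<close>. The number \<open>m\<close> of cutoff factors only has to reach the order \<open>\<gamma> - 1\<close> of the remaining singularity.\<close>

theorem decay_of_resolvent_growth:
  assumes r: "\<And>s. s \<noteq> 0 \<Longrightarrow> resolvable (\<i> * of_real s)" and g: "\<gamma> \<ge> 1" and C: "C \<ge> 0"
    and low: "\<And>s x. s \<noteq> 0 \<Longrightarrow> \<bar>s\<bar> \<le> 1 \<Longrightarrow> norm (R s x) \<le> C * \<bar>s\<bar> powr - \<gamma> * norm x"
    and high: "\<And>s x. \<bar>s\<bar> \<ge> 1 \<Longrightarrow> norm (R s x) \<le> C * \<bar>s\<bar> powr \<gamma> * norm x"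
  shows "\<exists>L\<ge>0. \<forall>t\<ge>1. \<forall>x. norm (T t (Q x)) \<le> L * t powr (- 1 / \<gamma>) * norm x"
proof -
  obtain m :: nat where m: "\<gamma> - 1 \<le> real m" using real_arch_simple by blast
  define B where "B e x = Q ((lowcut e ^^ m) ((euler (1 / e) ^^ m) x))" for e x
  define cl where "cl = M * (1 + C) + real m * (1 + M) ^ m * ((1 + M) * M)"
  define ch where "ch = C + M + real m * M * (M * M)"
  define c1 where "c1 = M * (M * cl) + (1 + M) * ((1 + M) ^ m * ch)"
  have M: "M \<ge> 1" by (rule M_ge_1)
  have cc: "cl \<ge> 0" "ch \<ge> 0" using M C by (auto simp: cl_def ch_def)
  then have c1: "c1 \<ge> 0" using M by (simp add: c1_def)
  have Bc: "commuting (B e)" if "e > 0" for e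
    unfolding B_def
    by (rule commuting_compose[OF Q_commuting commuting_compose[OF
          commuting_funpow[OF lowcut_commuting[OF that]] commuting_funpow[OF euler_commuting]]]) (use that in simp)
  have RB: "norm (R s (B e x)) \<le> c1 * e powr (1 - \<gamma>) * norm x" if e: "0 < e" "e \<le> 1" and s: "s \<noteq> 0" for e s x
  proof -
    have p: "1 / e > 0" using e by simp
    note com_low = lowcut_commuting[OF e(1)] and com_high = euler_commuting[OF p]
    note comm = commuting_funpow_res[OF com_low] commuting_funpow_res[OF com_high]
    note lin = bounded_clinearD(2)[OF commuting_clinear[OF commuting_funpow[OF com_low]]]
      bounded_clinearD(2)[OF commuting_clinear[OF commuting_funpow[OF com_high]]]
      bounded_clinearD(2)[OF resolvable_graph(2)[OF r[OF s]]]
    have ab: "(lowcut e ^^ m) ((euler (1 / e) ^^ m) y) = (euler (1 / e) ^^ m) ((lowcut e ^^ m) y)" for y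
    proof -
      have "euler (1 / e) ((lowcut e ^^ m) z) = (lowcut e ^^ m) (euler (1 / e) z)" for z
        using comm(1)[OF resolvable_real[OF p]]
          bounded_clinearD(4)[OF commuting_clinear[OF commuting_funpow[OF com_low]]]
        by (simp add: euler_def)
      then have "(euler (1 / e) ^^ k) ((lowcut e ^^ m) z) = (lowcut e ^^ m) ((euler (1 / e) ^^ k) z)" for k z
        by (induction k) simp_all
      then show ?thesis by simp
    qed
    show ?thesis
    proof (cases "\<bar>s\<bar> \<le> 1")
      case True
      have "R s (B e x) = U ((euler (1 / e) ^^ m) ((lowcut e ^^ m) (R s (x - U x))))"
        by (simp add: B_def Q_eq comm resolvable_1 r s lin ab res_commute)
      also have "norm \<dots> \<le> M * (M * (cl * e powr (1 - \<gamma>) * norm x))"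
        unfolding cl_def using M e s r m C low True g
        by (intro order_trans[OF U_bound] mult_left_mono order_trans[OF euler_pow_bound[OF p]] R_lowcut_bound) auto
      also have "\<dots> = (M * (M * cl)) * (e powr (1 - \<gamma>) * norm x)" by simp
      also have "\<dots> \<le> c1 * (e powr (1 - \<gamma>) * norm x)"
        unfolding c1_def using M cc by (intro mult_right_mono) auto
      finally show ?thesis by simp
    next
      case False
      have "R s (B e x) = (\<lambda>z. z - U z) ((lowcut e ^^ m) ((euler (1 / e) ^^ m) (R s (U x))))"
        by (simp add: B_def comm resolvable_1 r s lin res_commute[OF r[OF s] resolvable_1])
      also have "norm \<dots> \<le> (1 + M) * ((1 + M) ^ m * (ch * e powr (1 - \<gamma>) * norm x))"
        unfolding ch_def using M e s r m C high False g
        by (intro order_trans[OF id_minus_U_bound] mult_left_mono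
            order_trans[OF lowcut_pow_bound[OF e(1)]] R_euler_bound) auto
      also have "\<dots> = ((1 + M) * ((1 + M) ^ m * ch)) * (e powr (1 - \<gamma>) * norm x)" by simp
      also have "\<dots> \<le> c1 * (e powr (1 - \<gamma>) * norm x)"
        unfolding c1_def using M cc by (intro mult_right_mono) auto
      finally show ?thesis by simp
    qed
  qed
  define c0 where "c0 = (real m * M * (1 + M)\<^sup>2 + real m * (1 + M) ^ (m + 1) * M\<^sup>2) * M"
  define L where "L = M * c0 + 4 * M\<^sup>2 * (1 + M) * ((1 + M) * c1)"
  have "norm (T t (Q x)) \<le> L * t powr (- 1 / \<gamma>) * norm x" if t: "t \<ge> 1" for t x
  proof -
    \<comment> \<open>The truncation error \<open>O(e)\<close> and the bound \<open>O(e powr (1 - \<gamma>) / t)\<close> for the truncated part balance here.\<close>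
    define e where "e = t powr (- 1 / \<gamma>)"
    have "t powr (- 1 / \<gamma>) \<le> t powr 0" using t g by (intro powr_mono) auto
    then have e: "0 < e" "e \<le> 1" using t by (auto simp: e_def)
    have et: "e powr (1 - \<gamma>) / t = e"
    proof -
      have "e powr (- \<gamma>) = t" using t g by (simp add: e_def powr_powr)
      moreover have "e powr (1 - \<gamma>) = e * e powr (- \<gamma>)" using e by (simp add: powr_diff powr_minus_divide)
      ultimately show ?thesis using t by simp
    qed
    have "norm (T t (B e x)) \<le> 4 * M\<^sup>2 * (1 + M) * ((1 + M) * (c1 * e powr (1 - \<gamma>))) / t * norm x"
    proof (rule decay_of_resolvent_bound[OF Bc[OF e(1)]])
      show "norm (res z (B e x)) \<le> (1 + M) * (c1 * e powr (1 - \<gamma>)) * norm x" if "Re z > 0" for z x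
        using res_imaginary_bound[of "c1 * e powr (1 - \<gamma>) * norm x" "B e x" z] RB[OF e] c1 r that
        by (simp add: mult.assoc)
    qed (use t M c1 in auto)
    also have "\<dots> = 4 * M\<^sup>2 * (1 + M) * ((1 + M) * c1) * (e powr (1 - \<gamma>) / t) * norm x" by simp
    finally have 1: "norm (T t (B e x)) \<le> 4 * M\<^sup>2 * (1 + M) * ((1 + M) * c1) * e * norm x" unfolding et .
    let ?D = "Q (x - (lowcut e ^^ m) ((euler (1 / e) ^^ m) x))"
    have "Q x = ?D + B e x"
      unfolding B_def by (simp only: bounded_clinearD(2)[OF commuting_clinear[OF Q_commuting]] diff_add_cancel)
    then have "T t (Q x) = T t ?D + T t (B e x)"
      by (rule ssubst) (use t in \<open>simp only: bounded_clinearD(1)[OF T_clinear]\<close>)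
    then have "norm (T t (Q x)) \<le> norm (T t ?D) + norm (T t (B e x))"
      by (simp only: norm_triangle_ineq)
    also have "\<dots> \<le> M * (c0 * e * norm x) + 4 * M\<^sup>2 * (1 + M) * ((1 + M) * c1) * e * norm x"
      unfolding c0_def
      using t M by (intro add_mono 1 order_trans[OF T_bound mult_left_mono[OF Q_cutoff_error[OF e(1)]]]) auto
    also have "\<dots> = L * e * norm x" by (simp add: L_def algebra_simps)
    finally show ?thesis by (simp add: e_def)
  qed
  moreover have "L \<ge> 0" using M c1 by (simp add: L_def c0_def)
  ultimately show ?thesis by blast
qed

end

section \<open>Binomial series\<close>

lemma gbinomial_shift_step:
  fixes a :: real
  shows "(a - 1) gchoose (Suc m) = ((a - 1) gchoose m) * ((a - 1 - real m) / real (Suc m))"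
proof -
  have "real (Suc m) * ((a - 1) gchoose (Suc m)) = (a - 1 - real m) * ((a - 1) gchoose m)"
    using gbinomial_mult_1[of "a - 1" m] by (simp add: algebra_simps)
  then show ?thesis by (simp add: field_simps del: of_nat_Suc)
qed

text \<open>By Pascal's rule the terms telescope from the index \<open>a\<close> on: they are the differences of the absolute values of the binomial
  coefficients of \<open>a - 1\<close>, which decrease from there on.\<close>

lemma summable_abs_gbinomial:
  fixes a :: real
  assumes "a \<ge> 0"
  shows "summable (\<lambda>k. \<bar>a gchoose k\<bar>)"
proof -
  define P where "P m = \<bar>(a - 1) gchoose m\<bar>" for m
  define m0 where "m0 = nat \<lceil>a\<rceil>"
  have eq: "\<bar>a gchoose (Suc m)\<bar> = P m - P (Suc m)" if "m0 \<le> m" for m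
  proof -
    have m: "a \<le> real m" using that by (simp add: m0_def)
    have "a gchoose (Suc m) = ((a - 1) gchoose m) + ((a - 1) gchoose (Suc m))"
      using gbinomial_Suc_Suc[of "a - 1" m] by simp
    also have "\<dots> = ((a - 1) gchoose m) * (1 + (a - 1 - real m) / real (Suc m))"
      by (simp only: gbinomial_shift_step ring_distribs mult_1_right)
    also have "1 + (a - 1 - real m) / real (Suc m) = a / real (Suc m)" by (simp add: field_simps)
    finally have 1: "\<bar>a gchoose (Suc m)\<bar> = P m * (a / real (Suc m))"
      using assms by (simp add: P_def abs_mult)
    have "P (Suc m) = P m * ((real m + 1 - a) / real (Suc m))"
      unfolding P_def gbinomial_shift_step abs_mult using m by simp
    also have "(real m + 1 - a) / real (Suc m) = 1 - a / real (Suc m)"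
      by (simp add: field_simps)
    finally show ?thesis unfolding 1 by (simp add: algebra_simps)
  qed
  have "summable (\<lambda>k. \<bar>a gchoose (k + Suc m0)\<bar>)"
  proof (rule bounded_imp_summable)
    fix n
    have "(\<Sum>k\<le>n. \<bar>a gchoose (k + Suc m0)\<bar>) = (\<Sum>k<Suc n. P (k + m0) - P (Suc k + m0))"
      unfolding lessThan_Suc_atMost using eq by (intro sum.cong) auto
    also have "\<dots> = P m0 - P (Suc n + m0)" by (subst sum_lessThan_telescope') simp
    also have "\<dots> \<le> P m0" by (simp add: P_def)
    finally show "(\<Sum>k\<le>n. \<bar>a gchoose (k + Suc m0)\<bar>) \<le> P m0" .
  qed simp
  then show ?thesis by (subst (asm) summable_iff_shift)
qed

lemma summable_abs_gbinomial_mult: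
  fixes a :: real
  assumes "a \<ge> 1"
  shows "summable (\<lambda>k. real k * \<bar>a gchoose k\<bar>)"
proof -
  have "real (Suc k) * \<bar>a gchoose (Suc k)\<bar> = a * \<bar>(a - 1) gchoose k\<bar>" for k
    using arg_cong[OF gbinomial_absorption[of k a], of abs] assms by (simp add: abs_mult)
  then have "summable (\<lambda>k. real (Suc k) * \<bar>a gchoose (Suc k)\<bar>)"
    using summable_mult[OF summable_abs_gbinomial[of "a - 1"], of a] assms by simp
  then show ?thesis by (subst (asm) summable_Suc_iff)
qed

text \<open>Vandermonde's identity: the Cauchy product of the series of \<open>(1 + x) powr - a\<close> and \<open>(1 + x) powr a\<close>.\<close>

lemma binomial_series_inverse:
  fixes a x :: real
  shows "(\<Sum>k\<le>n. ((- a) gchoose k) * x ^ k * ((a gchoose (n - k)) * x ^ (n - k))) = of_bool (n = 0)"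
proof -
  have "(\<Sum>k\<le>n. ((- a) gchoose k) * x ^ k * ((a gchoose (n - k)) * x ^ (n - k)))
    = (\<Sum>k\<le>n. ((- a) gchoose k) * (a gchoose (n - k))) * x ^ n"
    unfolding sum_distrib_right
  proof (rule sum.cong[OF refl])
    fix k assume "k \<in> {..n}"
    then have "x ^ n = x ^ k * x ^ (n - k)" by (simp flip: power_add)
    then show "((- a) gchoose k) * x ^ k * ((a gchoose (n - k)) * x ^ (n - k))
      = ((- a) gchoose k) * (a gchoose (n - k)) * x ^ n" by simp
  qed
  also have "(\<Sum>k\<le>n. ((- a) gchoose k) * (a gchoose (n - k))) = (- a + a) gchoose n"
    using gbinomial_Vandermonde[of "- a" a n] by (simp add: atMost_atLeast0)
  finally show ?thesis by (cases n) auto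
qed

lemma neg_binomial_coeff:
  fixes a x :: real
  shows "((- a) gchoose k) * (- x) ^ k = pochhammer a k / fact k * x ^ k"
  by (simp add: gbinomial_pochhammer power_mult_distrib[symmetric] mult_ac)

text \<open>The termwise identity behind \<open>exp (- (1 - x) t) = exp (- t) exp (x t)\<close> on the level of Gamma densities.\<close>

lemma kern_shift:
  assumes "a > 0"
  shows "pochhammer a k / fact k * x ^ k * kern 1 (a + real k) t = kern 1 a t * ((x * t) ^ k / fact k)"
proof (cases "t > 0")
  case True
  have "pochhammer a k = Gamma (a + real k) / Gamma a"
    by (rule pochhammer_Gamma) (use assms in \<open>auto elim!: nonpos_Ints_cases\<close>)
  moreover have "t powr (a + real k - 1) = t powr (a - 1) * t ^ k"
    using True by (simp add: powr_add[symmetric] powr_realpow[symmetric] algebra_simps)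
  moreover have "Gamma a \<noteq> 0" "Gamma (a + real k) \<noteq> 0"
    using assms by (auto intro!: less_imp_neq[OF Gamma_real_pos, symmetric])
  ultimately show ?thesis using True by (simp add: kern_def power_mult_distrib)
qed (simp add: kern_def)

context bounded_semigroup
begin

section \<open>Absolutely convergent power series in the resolvent\<close>

lemma U_pow_bound: "norm ((U ^^ k) x) \<le> M * norm x"
  using res_pow_bound[of 1 k x] by simp

text \<open>Since the powers of \<open>U\<close> are bounded, absolutely summable coefficients act as an algebra of bounded operators; the product
  is the Cauchy product.\<close>

definition W :: "(nat \<Rightarrow> real) \<Rightarrow> 'a \<Rightarrow> 'a" where
  "W c x = (\<Sum>k. c k *\<^sub>R (U ^^ k) x)"

lemma W_term_bound: "norm (c k *\<^sub>R (U ^^ k) x) \<le> \<bar>c k\<bar> * (M * norm x)"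
  using U_pow_bound by (simp add: mult_left_mono)

lemma W_sums:
  assumes "summable (\<lambda>k. \<bar>c k\<bar>)"
  shows "(\<lambda>k. c k *\<^sub>R (U ^^ k) x) sums W c x"
proof -
  have "summable (\<lambda>k. \<bar>c k\<bar> * (M * norm x))" by (rule summable_mult2[OF assms])
  then have "summable (\<lambda>k. c k *\<^sub>R (U ^^ k) x)"
    by (rule summable_comparison_test'[where N=0]) (use W_term_bound in auto)
  then show ?thesis unfolding W_def by (rule summable_sums)
qed

lemma W_unique: "(\<lambda>k. c k *\<^sub>R (U ^^ k) x) sums y \<Longrightarrow> W c x = y"
  unfolding W_def by (rule sums_unique[symmetric])

lemma W_bound:
  assumes "summable (\<lambda>k. \<bar>c k\<bar>)"
  shows "norm (W c x) \<le> M * (\<Sum>k. \<bar>c k\<bar>) * norm x"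
proof -
  have "norm (W c x) \<le> (\<Sum>k. \<bar>c k\<bar> * (M * norm x))"
    unfolding W_def by (rule norm_suminf_le) (rule W_term_bound summable_mult2 assms)+
  then show ?thesis using suminf_mult2[OF assms, of "M * norm x"] by (simp add: mult_ac)
qed

lemma W_clinear:
  assumes "summable (\<lambda>k. \<bar>c k\<bar>)"
  shows "bounded_clinear (W c)"
proof (rule bounded_clinearI)
  note lin = bounded_clinearD[OF commuting_clinear[OF commuting_funpow[OF U_commuting]]]
  fix x y :: 'a and r :: complex
  show "W c (x + y) = W c x + W c y"
    using sums_add[OF W_sums[OF assms, of x] W_sums[OF assms, of y]]
    by (intro W_unique) (simp add: lin scaleR_add_right)
  show "W c (r *\<^sub>C x) = r *\<^sub>C W c x"
    using bounded_linear.sums[OF scaleC.bounded_linear_right W_sums[OF assms, of x], of r]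
    by (intro W_unique) (simp add: lin scaleC.scaleR_right)
  show "norm (W c x) \<le> norm x * (M * (\<Sum>k. \<bar>c k\<bar>))"
    using W_bound[OF assms, of x] by (simp add: mult_ac)
qed

lemma commuting_W:
  assumes c: "summable (\<lambda>k. \<bar>c k\<bar>)" and S: "commuting S"
  shows "S (W c x) = W c (S x)"
proof -
  have "S ((U ^^ k) x) = (U ^^ k) (S x)" for k
    by (induction k) (simp_all add: commuting_res[OF S resolvable_1])
  then show ?thesis
    using bounded_linear.sums[OF bounded_clinear_linear[OF commuting_clinear[OF S]] W_sums[OF c, of x]]
    by (intro W_unique[symmetric]) (simp add: bounded_clinearD[OF commuting_clinear[OF S]])
qed

lemma W_commuting: "summable (\<lambda>k. \<bar>c k\<bar>) \<Longrightarrow> commuting (W c)"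
  unfolding commuting_def using W_clinear commuting_W[OF _ T_commuting] by simp

text \<open>The partial sums over triangles differ from those over squares by at most the corresponding sums of absolute values, for which
  the Cauchy product of real series is known.\<close>

lemma W_product_sums:
  assumes c: "summable (\<lambda>k. \<bar>c k\<bar>)" and d: "summable (\<lambda>k. \<bar>d k\<bar>)"
  shows "(\<lambda>n. (\<Sum>k\<le>n. d k * c (n - k)) *\<^sub>R (U ^^ n) x) sums W d (W c x)"
proof -
  define P where "P N = (\<Sum>k<N. d k *\<^sub>R (U ^^ k) (W c x))" for N
  define PP where "PP N = (\<Sum>p\<in>{..<N} \<times> {..<N}. (d (fst p) * c (snd p)) *\<^sub>R (U ^^ (fst p + snd p)) x)" for N
  define TT where "TT N = (\<Sum>n<N. (\<Sum>k\<le>n. d k * c (n - k)) *\<^sub>R (U ^^ n) x)" for N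
  define Ca where "Ca N = (\<Sum>p\<in>{..<N} \<times> {..<N}. \<bar>d (fst p)\<bar> * \<bar>c (snd p)\<bar>)" for N
  define Cb where "Cb N = (\<Sum>n<N. \<Sum>k\<le>n. \<bar>d k\<bar> * \<bar>c (n - k)\<bar>)" for N
  have tri: "(\<Sum>n<N. \<Sum>k\<le>n. g k (n - k)) = (\<Sum>p\<in>{p. fst p + snd p < N}. g (fst p) (snd p))"
    for g :: "nat \<Rightarrow> nat \<Rightarrow> 'b::comm_monoid_add" and N
    using sum.triangle_reindex[of g N] by (simp add: case_prod_beta')
  have sub: "{p. fst p + snd p < N} \<subseteq> {..<N} \<times> {..<N}" for N :: nat by auto
  have "(\<lambda>n. \<Sum>k\<le>n. \<bar>d k\<bar> * \<bar>c (n - k)\<bar>) sums ((\<Sum>k. \<bar>d k\<bar>) * (\<Sum>k. \<bar>c k\<bar>))"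
    by (rule Cauchy_product_sums) (use c d in auto)
  then have Cb: "Cb \<longlonglongrightarrow> (\<Sum>k. \<bar>d k\<bar>) * (\<Sum>k. \<bar>c k\<bar>)" unfolding sums_def Cb_def .
  have "(\<lambda>N. (\<Sum>k<N. \<bar>d k\<bar>) * (\<Sum>k<N. \<bar>c k\<bar>)) \<longlonglongrightarrow> (\<Sum>k. \<bar>d k\<bar>) * (\<Sum>k. \<bar>c k\<bar>)"
    by (intro tendsto_mult summable_LIMSEQ c d)
  then have Ca: "Ca \<longlonglongrightarrow> (\<Sum>k. \<bar>d k\<bar>) * (\<Sum>k. \<bar>c k\<bar>)"
    by (simp add: Ca_def[abs_def] sum_product sum.cartesian_product case_prod_beta')
  have diff: "norm (PP N - TT N) \<le> (Ca N - Cb N) * (M * norm x)" for N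
  proof -
    let ?f = "\<lambda>p. (d (fst p) * c (snd p)) *\<^sub>R (U ^^ (fst p + snd p)) x"
    have "TT N = (\<Sum>n<N. \<Sum>k\<le>n. (d k * c (n - k)) *\<^sub>R (U ^^ (k + (n - k))) x)"
      unfolding TT_def scaleR_sum_left by (intro sum.cong) auto
    also have "\<dots> = (\<Sum>p\<in>{p. fst p + snd p < N}. ?f p)"
      by (rule tri[of "\<lambda>k j. (d k * c j) *\<^sub>R (U ^^ (k + j)) x"])
    finally have "PP N - TT N = (\<Sum>p\<in>{..<N} \<times> {..<N} - {p. fst p + snd p < N}. ?f p)"
      unfolding PP_def by (simp add: sum_diff[OF _ sub])
    also have "norm \<dots> \<le> (\<Sum>p\<in>{..<N} \<times> {..<N} - {p. fst p + snd p < N}. (\<bar>d (fst p)\<bar> * \<bar>c (snd p)\<bar>) * (M * norm x))"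
      by (intro order_trans[OF norm_sum sum_mono])
        (auto simp: abs_mult intro!: mult_left_mono U_pow_bound)
    also have "\<dots> = (Ca N - Cb N) * (M * norm x)"
      unfolding Ca_def Cb_def tri[of "\<lambda>k j. \<bar>d k\<bar> * \<bar>c j\<bar>"]
      by (simp add: sum_diff[OF _ sub] flip: sum_distrib_right)
    finally show ?thesis .
  qed
  have "(\<lambda>N. (Ca N - Cb N) * (M * norm x)) \<longlonglongrightarrow>
      ((\<Sum>k. \<bar>d k\<bar>) * (\<Sum>k. \<bar>c k\<bar>) - (\<Sum>k. \<bar>d k\<bar>) * (\<Sum>k. \<bar>c k\<bar>)) * (M * norm x)"
    by (intro tendsto_intros Ca Cb)
  then have z1: "(\<lambda>N. (Ca N - Cb N) * (M * norm x)) \<longlonglongrightarrow> 0" by simp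
  have 1: "(\<lambda>N. PP N - TT N) \<longlonglongrightarrow> 0"
    by (rule Lim_null_comparison[OF always_eventually[OF allI[OF diff]] z1])
  define Wc where "Wc N = (\<Sum>k<N. c k *\<^sub>R (U ^^ k) x)" for N
  have PPeq: "PP N = (\<Sum>k<N. d k *\<^sub>R (U ^^ k) (Wc N))" for N
  proof -
    note lin = bounded_clinearD[OF commuting_clinear[OF commuting_funpow[OF U_commuting]]]
      linear_sum[OF bounded_linear.linear[OF bounded_clinear_linear[OF commuting_clinear[OF commuting_funpow[OF U_commuting]]]]]
    have "d k *\<^sub>R (U ^^ k) (Wc N) = (\<Sum>j<N. (d k * c j) *\<^sub>R (U ^^ (k + j)) x)" for k
      by (simp add: Wc_def lin scaleR_sum_right funpow_add)
    then show ?thesis by (simp add: PP_def sum.cartesian_product case_prod_beta')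
  qed
  have Wc: "Wc \<longlonglongrightarrow> W c x" using W_sums[OF c, of x] unfolding sums_def Wc_def .
  have "norm (P N - PP N) \<le> (\<Sum>k. \<bar>d k\<bar>) * (M * norm (W c x - Wc N))" for N
  proof -
    have "P N - PP N = (\<Sum>k<N. d k *\<^sub>R (U ^^ k) (W c x - Wc N))"
      unfolding P_def PPeq by (simp add: sum_subtractf scaleR_diff_right
          bounded_clinearD(2)[OF commuting_clinear[OF commuting_funpow[OF U_commuting]]])
    also have "norm \<dots> \<le> (\<Sum>k<N. \<bar>d k\<bar> * (M * norm (W c x - Wc N)))"
      by (intro order_trans[OF norm_sum sum_mono] W_term_bound)
    also have "\<dots> \<le> (\<Sum>k. \<bar>d k\<bar>) * (M * norm (W c x - Wc N))"
      unfolding sum_distrib_right[symmetric] using M_ge_1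
      by (intro mult_right_mono sum_le_suminf d) auto
    finally show ?thesis .
  qed
  moreover have "(\<lambda>N. (\<Sum>k. \<bar>d k\<bar>) * (M * norm (W c x - Wc N))) \<longlonglongrightarrow> (\<Sum>k. \<bar>d k\<bar>) * (M * norm (W c x - W c x))"
    by (intro tendsto_intros Wc)
  then have z2: "(\<lambda>N. (\<Sum>k. \<bar>d k\<bar>) * (M * norm (W c x - Wc N))) \<longlonglongrightarrow> 0" by simp
  ultimately have 2: "(\<lambda>N. P N - PP N) \<longlonglongrightarrow> 0"
    by (intro Lim_null_comparison[OF always_eventually[OF allI] z2])
  have 3: "P \<longlonglongrightarrow> W d (W c x)" using W_sums[OF d, of "W c x"] unfolding sums_def P_def .
  have "(\<lambda>N. P N - (P N - PP N) - (PP N - TT N)) \<longlonglongrightarrow> W d (W c x) - 0 - 0"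
    by (intro tendsto_diff 1 2 3)
  then show ?thesis unfolding sums_def TT_def by simp
qed

section \<open>Binomial series of the resolvent\<close>

text \<open>The operator \<open>(1 - q U)\<^sup>a\<close>. For \<open>q = 1\<close> it is \<open>(A (1 + A)\<^sup>-\<^sup>1)\<^sup>a\<close>, since \<open>1 - U = A (1 + A)\<^sup>-\<^sup>1\<close>.\<close>

definition binom_op :: "real \<Rightarrow> real \<Rightarrow> 'a \<Rightarrow> 'a" where
  "binom_op a q = W (\<lambda>k. (a gchoose k) * (- q) ^ k)"

lemma binom_coeff_summable:
  assumes "0 \<le> (q::real)" "q < 1 \<or> (q = 1 \<and> a \<ge> 0)"
  shows "summable (\<lambda>k. \<bar>(a gchoose k) * (- q) ^ k\<bar>)"
  using assms(2)
proof
  assume q: "q < 1"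
  define r :: real where "r = (1 + q) / 2"
  have r: "q < r" "r < 1" "0 < r" using q assms by (auto simp: r_def)
  have "summable (\<lambda>k. (a gchoose k) * r ^ k)"
    using gen_binomial_real[of r a] r by (simp add: sums_iff)
  then show ?thesis
    using powser_insidea[of "\<lambda>k. a gchoose k" r "- q"] r assms by simp
next
  assume "q = 1 \<and> a \<ge> 0"
  then show ?thesis using summable_abs_gbinomial[of a] by (simp add: abs_mult power_abs)
qed

lemma binom_op_commuting:
  "0 \<le> q \<Longrightarrow> q < 1 \<or> (q = 1 \<and> a \<ge> 0) \<Longrightarrow> commuting (binom_op a q)"
  unfolding binom_op_def by (rule W_commuting[OF binom_coeff_summable])

lemma binom_op_inverse:
  assumes "0 \<le> q" "q < 1"
  shows "binom_op (- a) q (binom_op a q x) = x"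
proof -
  have "(\<lambda>n. of_bool (n = 0) *\<^sub>R (U ^^ n) x) sums binom_op (- a) q (binom_op a q x)"
    using W_product_sums[OF binom_coeff_summable binom_coeff_summable, of q a q "- a" x] assms
    by (simp add: binom_op_def binomial_series_inverse)
  moreover have "(\<lambda>n. of_bool (n = 0) *\<^sub>R (U ^^ n) x) sums (\<Sum>n\<in>{0}. of_bool (n = 0) *\<^sub>R (U ^^ n) x)"
    by (rule sums_finite) auto
  ultimately show ?thesis using sums_unique2 by fastforce
qed

lemma K_add_nat:
  assumes "p > 0" "a > 0"
  shows "K p a ((res (of_real p) ^^ n) x) = K p (a + real n) x"
proof (cases n)
  case (Suc m)
  then show ?thesis
    using res_pow_real[OF assms(1), of m x] K_add[of p a "real (Suc m)" x] assms
    by (simp del: of_nat_Suc funpow.simps)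
qed simp

text \<open>The negative powers of \<open>e + A\<close> and \<open>1 + A\<close> differ by a binomial series in \<open>U\<close>, because
  \<open>e + A = (1 + A) (1 - (1 - e) U)\<close>. The Gamma densities of both sides agree termwise, and
  positivity of the coefficients controls the remainder.\<close>

lemma K_eq_K_binom_op:
  assumes e: "0 < e" "e \<le> 1" and a: "a > 0"
  shows "K e a x = K 1 a (binom_op (- a) (1 - e) x)"
proof -
  define q where "q = 1 - e"
  have q: "0 \<le> q" "q < 1" using e by (auto simp: q_def)
  define d where "d k = ((- a) gchoose k) * (- q) ^ k" for k
  have d: "d k = pochhammer a k / fact k * q ^ k" for k unfolding d_def by (rule neg_binomial_coeff)
  have d0: "0 \<le> d k" for k unfolding d using a q by (auto intro!: divide_nonneg_nonneg mult_nonneg_nonneg pochhammer_nonneg)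
  have ds: "summable (\<lambda>k. \<bar>d k\<bar>)" unfolding d_def by (rule binom_coeff_summable) (use q in auto)
  have sums: "d sums e powr - a"
    using gen_binomial_real[of "- q" "- a"] q by (simp add: d_def[abs_def] q_def)
  have "(\<lambda>k. K 1 a (d k *\<^sub>R (U ^^ k) x)) sums K 1 a (W d x)"
    by (rule bounded_linear.sums[OF bounded_clinear_linear[OF K_clinear] W_sums[OF ds]]) (use a in auto)
  then have S: "(\<lambda>k. d k *\<^sub>R K 1 (a + real k) x) sums K 1 a (W d x)"
    using K_add_nat[of 1 a] a by (simp add: bounded_clinearD(4)[OF K_clinear])
  have "norm (K e a x - (\<Sum>k<N. d k *\<^sub>R K 1 (a + real k) x)) \<le> (e powr - a - (\<Sum>k<N. d k)) * (M * norm x)" for N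
  proof -
    let ?f = "\<lambda>t. kern e a t - (\<Sum>k<N. d k * kern 1 (a + real k) t)"
    have f0: "0 \<le> ?f t" for t
    proof (cases "t > 0")
      case True
      have "(\<Sum>k<N. d k * kern 1 (a + real k) t) = kern 1 a t * (\<Sum>k<N. (q * t) ^ k / fact k)"
        unfolding d kern_shift[OF a] by (simp add: sum_distrib_left)
      also have "\<dots> \<le> kern 1 a t * exp (q * t)"
      proof (rule mult_left_mono[OF _ kern_nonneg[OF a]])
        have "(\<lambda>k. (q * t) ^ k / fact k) sums exp (q * t)"
          using exp_converges[of "q * t"] by (simp add: divide_inverse mult.commute)
        then show "(\<Sum>k<N. (q * t) ^ k / fact k) \<le> exp (q * t)"
          using q True by (subst sums_unique) (auto intro!: sum_le_suminf simp: sums_iff)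
      qed
      also have "\<dots> = kern e a t"
        using True by (simp add: kern_def q_def algebra_simps flip: exp_add)
      finally show ?thesis by simp
    qed (simp add: kern_def)
    have "((\<lambda>t. \<Sum>k<N. d k * kern 1 (a + real k) t) has_integral (\<Sum>k<N. d k * 1 powr - (a + real k))) {0<..}"
      by (intro has_integral_sum has_integral_mult_right has_integral_kern) (use a in auto)
    then have i: "(?f has_integral e powr - a - (\<Sum>k<N. d k)) {0<..}"
      using has_integral_diff[OF has_integral_kern[OF e(1) a]] by simp
    have c: "continuous_on {0<..} ?f"
      by (intro continuous_intros kern_continuous)
    have "((\<lambda>t. \<Sum>k<N. d k *\<^sub>R (kern 1 (a + real k) t *\<^sub>R T t x)) has_integral (\<Sum>k<N. d k *\<^sub>R K 1 (a + real k) x)) {0<..}"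
      by (intro has_integral_sum has_integral_cmul K_has_integral) (use a in auto)
    then have "((\<lambda>t. kern e a t *\<^sub>R T t x - (\<Sum>k<N. d k *\<^sub>R (kern 1 (a + real k) t *\<^sub>R T t x))) has_integral
        K e a x - (\<Sum>k<N. d k *\<^sub>R K 1 (a + real k) x)) {0<..}"
      by (intro has_integral_diff K_has_integral e a)
    then have "K e a x - (\<Sum>k<N. d k *\<^sub>R K 1 (a + real k) x) = integral {0<..} (\<lambda>t. ?f t *\<^sub>R T t x)"
      by (simp add: scaleR_diff_left scaleR_sum_left integral_unique)
    then show ?thesis
      using kernel_integral(2)[OF c, of "e powr - a - (\<Sum>k<N. d k)" x] i f0 by simp
  qed
  moreover have "(\<lambda>N. (e powr - a - (\<Sum>k<N. d k)) * (M * norm x)) \<longlonglongrightarrow> (e powr - a - e powr - a) * (M * norm x)"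
    using sums unfolding sums_def by (intro tendsto_intros)
  then have z: "(\<lambda>N. (e powr - a - (\<Sum>k<N. d k)) * (M * norm x)) \<longlonglongrightarrow> 0" by simp
  ultimately have "(\<lambda>N. K e a x - (\<Sum>k<N. d k *\<^sub>R K 1 (a + real k) x)) \<longlonglongrightarrow> 0"
    by (intro Lim_null_comparison[OF always_eventually[OF allI] z])
  then have "(\<lambda>N. K e a x - (K e a x - (\<Sum>k<N. d k *\<^sub>R K 1 (a + real k) x))) \<longlonglongrightarrow> K e a x - 0"
    by (intro tendsto_diff tendsto_const)
  then have "(\<lambda>k. d k *\<^sub>R K 1 (a + real k) x) sums K e a x" unfolding sums_def by simp
  then have "K 1 a (W d x) = K e a x" using S sums_unique2 by blast
  then show ?thesis by (simp add: binom_op_def d_def[abs_def] q_def)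
qed

end

lemma funpow_cancel:
  assumes "\<And>z. f (g z) = h z" "\<And>z. f (h z) = h (f z)"
  shows "(f ^^ n) ((g ^^ n) z) = (h ^^ n) z"
proof (induction n)
  case (Suc n)
  have "(f ^^ n) (h w) = h ((f ^^ n) w)" for w
    by (induction n) (simp_all add: assms(2))
  moreover have "(f ^^ Suc n) ((g ^^ Suc n) z) = (f ^^ n) (h ((g ^^ n) z))"
    by (simp add: funpow_swap1[of f] assms(1))
  ultimately show ?case using Suc by simp
qed simp

lemma funpow_compose_commute:
  assumes "\<And>z. f (g z) = g (f z)"
  shows "((\<lambda>z. f (g z)) ^^ n) z = (f ^^ n) ((g ^^ n) z)"
proof (induction n)
  case (Suc n)
  have "g ((f ^^ n) w) = (f ^^ n) (g w)" for w
    by (induction n) (simp_all add: assms[symmetric])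
  then show ?case using Suc by simp
qed simp

lemma strong_tendsto:
  fixes F :: "'i \<Rightarrow> 'b::real_normed_vector \<Rightarrow> 'b"
  assumes lim: "\<And>z. ((\<lambda>i. F i z) \<longlongrightarrow> F0 z) net" and lin: "\<forall>\<^sub>F i in net. \<forall>x y. F i (x - y) = F i x - F i y"
    and bound: "\<forall>\<^sub>F i in net. \<forall>z. norm (F i z) \<le> L * norm z" and g: "(g \<longlongrightarrow> l) net"
  shows "((\<lambda>i. F i (g i)) \<longlongrightarrow> F0 l) net"
proof -
  have "((\<lambda>i. L * norm (g i - l)) \<longlongrightarrow> L * norm (l - l)) net"
    by (intro tendsto_intros g)
  then have z: "((\<lambda>i. L * norm (g i - l)) \<longlongrightarrow> 0) net" by simp
  have "((\<lambda>i. F i (g i) - F i l) \<longlongrightarrow> 0) net"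
  proof (rule Lim_null_comparison[OF _ z])
    show "\<forall>\<^sub>F i in net. norm (F i (g i) - F i l) \<le> L * norm (g i - l)"
      using lin bound by eventually_elim metis
  qed
  from tendsto_add[OF this lim[of l]] show ?thesis by simp
qed

lemma strong_tendsto_funpow:
  fixes F :: "'i \<Rightarrow> 'b::real_normed_vector \<Rightarrow> 'b"
  assumes lim: "\<And>z. ((\<lambda>i. F i z) \<longlongrightarrow> F0 z) net" and lin: "\<forall>\<^sub>F i in net. \<forall>x y. F i (x - y) = F i x - F i y"
    and bound: "\<forall>\<^sub>F i in net. \<forall>z. norm (F i z) \<le> L * norm z"
  shows "((\<lambda>i. (F i ^^ n) x) \<longlongrightarrow> (F0 ^^ n) x) net"
proof (induction n)
  case (Suc n)
  then show ?case using strong_tendsto[OF lim lin bound] by simp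
qed simp

context bounded_semigroup
begin

section \<open>The Balakrishnan integral of the generator\<close>

text \<open>The operator \<open>(p + A) (r + p + A)\<^sup>-\<^sup>1\<close>, whose powers form the Balakrishnan integrand of \<open>p + A\<close>. The power \<open>A\<^sup>a\<close> itself,
  the case \<open>p = 0\<close>, is reached as a limit.\<close>

definition V :: "real \<Rightarrow> real \<Rightarrow> 'a \<Rightarrow> 'a" where
  "V p r y = y - r *\<^sub>R res (of_real (p + r)) y"

text \<open>The Beta value by which the Balakrishnan formula is normalized.\<close>

definition bal_const :: "real \<Rightarrow> nat \<Rightarrow> real" where
  "bal_const a n = Gamma a * Gamma (real n - a) / Gamma (real n)"

lemma bal_const_pos: "0 < a \<Longrightarrow> a < real n \<Longrightarrow> 0 < bal_const a n"
  by (simp add: bal_const_def Gamma_real_pos)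

lemma V_commuting: "p \<ge> 0 \<Longrightarrow> r > 0 \<Longrightarrow> commuting (V p r)"
  unfolding V_def
  by (rule commuting_sub[OF commuting_id commuting_scaleR[OF res_commuting[OF resolvable_real]]]) simp

lemma V_bound:
  assumes "p \<ge> 0" "r > 0"
  shows "norm (V p r y) \<le> (1 + M) * norm y"
proof -
  have "norm (r *\<^sub>R res (of_real (p + r)) y) \<le> norm ((p + r) *\<^sub>R res (of_real (p + r)) y)"
    using assms by (simp add: mult_right_mono)
  also have "\<dots> \<le> M * norm y" by (rule euler_bound[unfolded euler_def]) (use assms in simp)
  finally show ?thesis
    using norm_triangle_ineq4[of y "r *\<^sub>R res (of_real (p + r)) y"] by (simp add: V_def algebra_simps)
qed

lemma V_U:
  assumes "p \<ge> 0" "r > 0"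
  shows "V p r (U z) = res (of_real (p + r)) (z - (1 - p) *\<^sub>R U z)"
proof -
  have l: "resolvable (of_real (p + r))" using assms by (intro resolvable_real) simp
  have "U z = res (of_real (p + r)) (of_real (p + r) *\<^sub>C U z + (z - U z))"
    by (rule res_left[OF l AU_in_A, symmetric])
  also have "of_real (p + r) *\<^sub>C U z + (z - U z) = r *\<^sub>R U z + (z - (1 - p) *\<^sub>R U z)"
    unfolding scaleC_of_real by (simp add: algebra_simps)
  finally have "U z = r *\<^sub>R res (of_real (p + r)) (U z) + res (of_real (p + r)) (z - (1 - p) *\<^sub>R U z)"
    by (simp only: bounded_clinearD(1,4)[OF resolvable_graph(2)[OF l]])
  then show ?thesis unfolding V_def by (metis add_diff_cancel_left')
qed

lemma V_res:
  assumes "p > 0" "r > 0"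
  shows "V p r (res (of_real p) z) = res (of_real (p + r)) z"
proof -
  have l: "resolvable (of_real (p + r))" "resolvable (of_real p)"
    by (rule resolvable_real; use assms in simp)+
  have "res (of_real p) z - res (of_real (p + r)) z
      = (of_real (p + r) - of_real p) *\<^sub>C res (of_real p) (res (of_real (p + r)) z)"
    by (rule resolvent_identity[OF l(2,1)])
  also have "of_real (p + r) - of_real p = (of_real r :: complex)" by simp
  finally have "res (of_real p) z - res (of_real (p + r)) z = r *\<^sub>R res (of_real (p + r)) (res (of_real p) z)"
    by (simp only: scaleC_of_real res_commute[OF l])
  then show ?thesis unfolding V_def by (metis diff_diff_eq2 add_diff_cancel_left' diff_add_cancel)
qed

text \<open>For \<open>p > 0\<close> the argument \<open>(p + A)\<^sup>-\<^sup>a (p + A)\<^sup>-\<^sup>n z\<close> makes the integrand equal to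
  \<open>r powr (a - 1) (p + r + A)\<^sup>-\<^sup>n (p + A)\<^sup>-\<^sup>a z\<close>, whose integral is known.\<close>

lemma balakrishnan_integral_pos:
  assumes p: "p > 0" and a: "0 < a" "a < real n"
  shows "((\<lambda>r. r powr (a - 1) *\<^sub>R (V p r ^^ n) (K p a ((res (of_real p) ^^ n) z)))
    has_integral bal_const a n *\<^sub>R (res (of_real p) ^^ n) z) {0<..}"
proof -
  obtain m where n: "n = Suc m" using a by (cases n) auto
  have K: "K p a ((res (of_real p) ^^ n) z) = (res (of_real p) ^^ n) (K p a z)"
    using commuting_K[OF commuting_funpow[OF res_commuting[OF resolvable_real[OF p]]] p a(1)] by simp
  have VK: "(V p r ^^ n) ((res (of_real p) ^^ n) (K p a z)) = K (p + r) (real n) (K p a z)" if "r > 0" for r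
  proof -
    have "(V p r ^^ n) ((res (of_real p) ^^ n) (K p a z)) = (res (of_real (p + r)) ^^ n) (K p a z)"
    proof (rule funpow_cancel)
      show "V p r (res (of_real p) y) = res (of_real (p + r)) y" for y by (rule V_res[OF p that])
      show "V p r (res (of_real (p + r)) y) = res (of_real (p + r)) (V p r y)" for y
        using p that by (intro commuting_res V_commuting resolvable_real) auto
    qed
    then show ?thesis
      using res_pow_real[of "p + r" m "K p a z"] p that by (simp del: funpow.simps add: n)
  qed
  have KK: "K p (real n - a) (K p a z) = (res (of_real p) ^^ n) z"
    using K_add[of p "real n - a" a z] p a res_pow_real[of p m z] by (simp add: n del: funpow.simps of_nat_Suc)
  have "((\<lambda>r. r powr (a - 1) *\<^sub>R K (p + r) (real n) (K p a z)) has_integral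
      bal_const a n *\<^sub>R (res (of_real p) ^^ n) z) {0<..}"
    using has_integral_powr_K[OF p a, of "K p a z"] unfolding KK bal_const_def .
  then show ?thesis
    by (rule has_integral_eq[rotated]) (simp only: K VK greaterThan_iff)
qed

lemma res_one_minus_U: 
  assumes "e > 0"
  shows "res (of_real e) (v - (1 - e) *\<^sub>R U v) = U v"
proof -
  have "res (of_real e) (of_real e *\<^sub>C U v + (v - U v)) = U v"
    by (rule res_left[OF resolvable_real[OF assms] AU_in_A])
  also have "of_real e *\<^sub>C U v + (v - U v) = v - (1 - e) *\<^sub>R U v"
    unfolding scaleC_of_real by (simp add: algebra_simps)
  finally show ?thesis .
qed

text \<open>The preceding formula for \<open>e + A\<close>, rewritten with the argument \<open>(1 + A)\<^sup>-\<^sup>a (1 + A)\<^sup>-\<^sup>n z\<close> that does not depend on \<open>e\<close>; the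
  price is the factor \<open>((e + A) (1 + A)\<^sup>-\<^sup>1)\<^sup>a\<close>, a binomial series.\<close>

lemma balakrishnan_integral_shifted:
  assumes e: "0 < e" "e \<le> 1" and a: "0 < a" "a < real n"
  shows "((\<lambda>r. r powr (a - 1) *\<^sub>R (V e r ^^ n) (K 1 a ((U ^^ n) z)))
    has_integral bal_const a n *\<^sub>R binom_op a (1 - e) ((U ^^ n) z)) {0<..}"
proof -
  define X where "X v = v - (1 - e) *\<^sub>R U v" for v
  define B where "B = binom_op a (1 - e)"
  have B: "commuting B" unfolding B_def by (rule binom_op_commuting) (use e in auto)
  have "B ((U ^^ n) z) = (U ^^ n) (B z)"
    unfolding B_def binom_op_def
    by (rule commuting_W[OF binom_coeff_summable commuting_funpow[OF U_commuting], symmetric])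
      (use e in auto)
  also have "\<dots> = (res (of_real e) ^^ n) ((X ^^ n) (B z))"
  proof (rule funpow_cancel[symmetric])
    show "res (of_real e) (X y) = U y" for y unfolding X_def by (rule res_one_minus_U[OF e(1)])
    show "res (of_real e) (U y) = U (res (of_real e) y)" for y
      by (rule res_commute[OF resolvable_real[OF e(1)] resolvable_1])
  qed
  finally have 1: "B ((U ^^ n) z) = (res (of_real e) ^^ n) ((X ^^ n) (B z))" .
  have "K 1 a ((U ^^ n) z) = K e a (B ((U ^^ n) z))"
    unfolding K_eq_K_binom_op[OF e a(1)] B_def using binom_op_inverse[of "1 - e" a] e by simp
  then show ?thesis
    using balakrishnan_integral_pos[OF e(1) a, of "(X ^^ n) (B z)", folded 1] by (simp only: B_def)
qed

text \<open>Bernoulli's inequality bounds \<open>1 - (1 - e) ^ k\<close> by \<open>k e\<close>; this is where \<open>a \<ge> 1\<close> is needed, for the summability of \<open>k (a choose k)\<close>.\<close>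

lemma binom_op_diff_bound:
  assumes a: "a \<ge> 1" and e: "0 \<le> e" "e \<le> 1"
  shows "norm (binom_op a (1 - e) w - binom_op a 1 w) \<le> e * (M * (\<Sum>k. real k * \<bar>a gchoose k\<bar>) * norm w)"
proof -
  let ?c = "\<lambda>q k. (a gchoose k) * (- q) ^ k"
  have s: "(\<lambda>k. ?c (1 - e) k *\<^sub>R (U ^^ k) w - ?c 1 k *\<^sub>R (U ^^ k) w) sums (binom_op a (1 - e) w - binom_op a 1 w)"
    unfolding binom_op_def by (intro sums_diff W_sums binom_coeff_summable) (use a e in auto)
  have le: "norm (?c (1 - e) k *\<^sub>R (U ^^ k) w - ?c 1 k *\<^sub>R (U ^^ k) w)
      \<le> (real k * \<bar>a gchoose k\<bar>) * (e * (M * norm w))" for k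
  proof -
    have b: "1 - (1 - e) ^ k \<le> real k * e" "(1 - e) ^ k \<le> 1"
      using Bernoulli_inequality[of "- e" k] e by (auto simp: power_le_one)
    have "?c (1 - e) k - ?c 1 k = (a gchoose k) * (- 1) ^ k * ((1 - e) ^ k - 1)"
      using power_mult_distrib[of "-1" "1 - e" k] by (simp add: algebra_simps)
    then have "\<bar>?c (1 - e) k - ?c 1 k\<bar> = \<bar>a gchoose k\<bar> * (1 - (1 - e) ^ k)"
      using b(2) by (simp add: abs_mult)
    also have "\<dots> \<le> \<bar>a gchoose k\<bar> * (real k * e)" by (intro mult_left_mono b) auto
    finally have "\<bar>?c (1 - e) k - ?c 1 k\<bar> \<le> \<bar>a gchoose k\<bar> * (real k * e)" .
    then have "\<bar>?c (1 - e) k - ?c 1 k\<bar> * norm ((U ^^ k) w) \<le> (\<bar>a gchoose k\<bar> * (real k * e)) * (M * norm w)"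
      using e by (intro mult_mono U_pow_bound) auto
    then show ?thesis by (simp add: mult_ac flip: scaleR_diff_left)
  qed
  have "norm (binom_op a (1 - e) w - binom_op a 1 w) \<le> (\<Sum>k. (real k * \<bar>a gchoose k\<bar>) * (e * (M * norm w)))"
    unfolding sums_unique[OF s]
    by (rule norm_suminf_le) (rule le summable_mult2 summable_abs_gbinomial_mult a)+
  also have "\<dots> = e * (M * (\<Sum>k. real k * \<bar>a gchoose k\<bar>) * norm w)"
    using suminf_mult2[OF summable_abs_gbinomial_mult[OF a], of "e * (M * norm w)"] by (simp add: mult_ac)
  finally show ?thesis .
qed

lemma res_real_tendsto:
  assumes "q > 0"
  shows "((\<lambda>q. res (of_real q) z) \<longlongrightarrow> res (of_real q) z) (at q)"
proof -
  have "continuous_on {0<..} (\<lambda>r. K (q / 2 + r) 1 z)" by (rule K_continuous) (use assms in auto)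
  then have "isCont (\<lambda>r. K (q / 2 + r) 1 z) (q - q / 2)"
    by (subst (asm) continuous_on_eq_continuous_at) (use assms in auto)
  then have "isCont (\<lambda>s. K (q / 2 + (s - q / 2)) 1 z) q"
    by (rule isCont_o2[where f = "\<lambda>s. s - q / 2", rotated]) simp
  then have "((\<lambda>s. K s 1 z) \<longlongrightarrow> K q 1 z) (at q)" by (simp add: isCont_def)
  then have "((\<lambda>s. K s 1 z) \<longlongrightarrow> res (of_real q) z) (at q)" using assms by (simp add: res_real)
  moreover have "\<forall>\<^sub>F s in at q. K s 1 z = res (of_real s) z"
    using assms by (auto simp: res_real intro!: eventually_mono[OF order_tendstoD(1)[OF tendsto_ident_at, of 0]])
  ultimately show ?thesis by (rule Lim_transform_eventually)
qed

text \<open>The decay in \<open>r\<close> is uniform in \<open>e\<close>: the \<open>n\<close> factors \<open>U\<close> turn each \<open>V e r\<close> into a resolvent at \<open>e + r\<close>.\<close>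

lemma V_pow_U_bound:
  assumes e: "0 \<le> e" "e \<le> 1" and r: "r > 0"
  shows "norm ((V e r ^^ n) ((U ^^ n) y)) \<le> M / r ^ n * ((1 + M) ^ n * norm y)"
proof -
  define X where "X v = v - (1 - e) *\<^sub>R U v" for v
  have l: "resolvable (of_real (e + r))" using e r by (intro resolvable_real) simp
  have Xc: "commuting X"
    unfolding X_def by (rule commuting_sub[OF commuting_id commuting_scaleR[OF U_commuting]])
  have comm: "res (of_real (e + r)) (X v) = X (res (of_real (e + r)) v)" for v
    using commuting_res[OF Xc l] by simp
  have "(V e r ^^ n) ((U ^^ n) y) = ((\<lambda>z. res (of_real (e + r)) (X z)) ^^ n) y"
  proof (rule funpow_cancel)
    show "V e r (U z) = res (of_real (e + r)) (X z)" for z unfolding X_def by (rule V_U[OF e(1) r])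
    show "V e r (res (of_real (e + r)) (X z)) = res (of_real (e + r)) (X (V e r z))" for z
      using commuting_res[OF V_commuting[OF e(1) r] l] commuting_res[OF V_commuting[OF e(1) r] resolvable_1]
        bounded_clinearD(2,4)[OF commuting_clinear[OF V_commuting[OF e(1) r]]]
      by (simp add: X_def)
  qed
  also have "\<dots> = (res (of_real (e + r)) ^^ n) ((X ^^ n) y)"
    by (rule funpow_compose_commute) (rule comm)
  finally have eq: "(V e r ^^ n) ((U ^^ n) y) = (res (of_real (e + r)) ^^ n) ((X ^^ n) y)" .
  have X: "norm (X v) \<le> (1 + M) * norm v" for v
  proof -
    have "norm ((1 - e) *\<^sub>R U v) \<le> 1 * (M * norm v)"
      unfolding norm_scaleR by (intro mult_mono U_bound) (use e in auto)
    then show ?thesis using norm_triangle_ineq4[of v "(1 - e) *\<^sub>R U v"] by (simp add: X_def algebra_simps)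
  qed
  have "norm ((X ^^ n) y) \<le> (1 + M) ^ n * norm y"
    by (rule norm_funpow_le_power[OF X]) (use M_ge_1 in simp)
  moreover have "norm ((res (of_real (e + r)) ^^ n) v) \<le> M / r ^ n * norm v" for v
  proof -
    have "norm ((res (of_real (e + r)) ^^ n) v) \<le> M / (e + r) ^ n * norm v"
      by (rule res_pow_bound) (use e r in simp)
    also have "\<dots> \<le> M / r ^ n * norm v"
      using e r M_ge_1 by (intro mult_right_mono divide_left_mono power_mono) auto
    finally show ?thesis .
  qed
  ultimately show ?thesis unfolding eq
    using M_ge_1 r by (meson mult_left_mono order_trans divide_nonneg_nonneg zero_le_power less_imp_le zero_le_one)
qed

text \<open>Dominated convergence as \<open>e\<close> tends to 0 in the shifted formula. It is applied to the scalar integrands obtained by testing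
  against vectors; integrability of the limit is known beforehand.\<close>

theorem balakrishnan_integral_0:
  assumes a: "1 \<le> a" "a < real n"
  shows "((\<lambda>r. r powr (a - 1) *\<^sub>R (V 0 r ^^ n) (K 1 a ((U ^^ n) z)))
    has_integral bal_const a n *\<^sub>R binom_op a 1 ((U ^^ n) z)) {0<..}"
proof -
  define w where "w = (U ^^ n) z"
  define x where "x = K 1 a w"
  have x: "x = (U ^^ n) (K 1 a z)"
    using commuting_K[OF commuting_funpow[OF U_commuting], of 1 a] a by (simp add: x_def w_def)
  define f where "f e r = r powr (a - 1) *\<^sub>R (V e r ^^ n) x" for e r
  let ?C = "(1 + M) ^ n * norm x" and ?D = "M * ((1 + M) ^ n * norm (K 1 a z))"
  define h where "h r = (if r \<le> 1 then ?C * r powr (a - 1) else ?D * r powr (a - 1 - real n))" for r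
  have h: "h integrable_on {0<..}"
    unfolding h_def by (rule has_integral_integrable[OF has_integral_powr_split]) (use a in auto)
  have le: "norm (f e r) \<le> h r" if "0 \<le> e" "e \<le> 1" "r > 0" for e r
  proof (cases "r \<le> 1")
    case True
    have "norm ((V e r ^^ n) x) \<le> (1 + M) ^ n * norm x"
      by (rule norm_funpow_le_power[OF V_bound]) (use that M_ge_1 in auto)
    then show ?thesis using True by (simp add: f_def h_def mult_left_mono mult.commute)
  next
    case False
    have "norm (f e r) \<le> r powr (a - 1) * (M / r ^ n * ((1 + M) ^ n * norm (K 1 a z)))"
      unfolding f_def x norm_scaleR
      using mult_left_mono[OF V_pow_U_bound[OF that, of n "K 1 a z"], of "r powr (a - 1)"] by simp
    also have "\<dots> = ?D * (r powr (a - 1) / r powr real n)" using that by (simp add: powr_realpow)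
    also have "r powr (a - 1) / r powr real n = r powr (a - 1 - real n)" by (simp flip: powr_diff)
    finally show ?thesis using False by (simp add: h_def)
  qed
  have Vlin: "V e r (x - y) = V e r x - V e r y" if "0 \<le> e" "r > 0" for e r x y
    using bounded_clinearD(2)[OF commuting_clinear[OF V_commuting]] that by simp
  have cont: "continuous_on {0<..} (f 0)"
    unfolding continuous_on_def
  proof
    fix r :: real assume r: "r \<in> {0<..}"
    have ev: "\<forall>\<^sub>F s in at r within {0<..}. s > 0" by (auto simp: eventually_at_topological)
    have "((\<lambda>s. (V 0 s ^^ n) x) \<longlongrightarrow> (V 0 r ^^ n) x) (at r within {0<..})"
    proof (rule strong_tendsto_funpow)
      show "((\<lambda>s. V 0 s y) \<longlongrightarrow> V 0 r y) (at r within {0<..})" for y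
        unfolding V_def add_0_left
        by (intro tendsto_intros tendsto_mono[OF at_le res_real_tendsto]) (use r in auto)
      show "\<forall>\<^sub>F s in at r within {0<..}. \<forall>x y. V 0 s (x - y) = V 0 s x - V 0 s y"
        using ev by eventually_elim (simp add: Vlin)
      show "\<forall>\<^sub>F s in at r within {0<..}. \<forall>y. norm (V 0 s y) \<le> (1 + M) * norm y"
        using ev by eventually_elim (simp add: V_bound)
    qed
    then show "(f 0 \<longlongrightarrow> f 0 r) (at r within {0<..})"
      unfolding f_def using r by (intro tendsto_intros) auto
  qed
  have int: "f 0 integrable_on {0<..}"
    by (rule integrable_on_halfline_dominated[OF cont h]) (use le in auto)
  define e where "e k = 1 / real (Suc k)" for k
  have e: "0 < e k" "e k \<le> 1" for k by (auto simp: e_def)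
  have e0: "e \<longlonglongrightarrow> 0" unfolding e_def by (rule LIMSEQ_Suc[OF lim_1_over_n])
  have fe: "(f (e k) has_integral bal_const a n *\<^sub>R binom_op a (1 - e k) w) {0<..}" for k
    unfolding f_def x_def w_def by (rule balakrishnan_integral_shifted) (use e a in auto)
  have flim: "(\<lambda>k. f (e k) r) \<longlonglongrightarrow> f 0 r" if r: "r > 0" for r
  proof -
    have "(\<lambda>k. (V (e k) r ^^ n) x) \<longlonglongrightarrow> (V 0 r ^^ n) x"
    proof (rule strong_tendsto_funpow)
      have "filterlim (\<lambda>k. e k + r) (at r) sequentially"
        unfolding filterlim_at using tendsto_add[OF e0 tendsto_const[of r]] e by (auto simp: less_imp_neq[symmetric])
      then show "(\<lambda>k. V (e k) r y) \<longlonglongrightarrow> V 0 r y" for y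
        unfolding V_def add_0_left by (intro tendsto_intros filterlim_compose[OF res_real_tendsto[OF r]])
      show "\<forall>\<^sub>F k in sequentially. \<forall>x y. V (e k) r (x - y) = V (e k) r x - V (e k) r y"
        by (rule always_eventually) (use Vlin e r in \<open>auto simp: less_imp_le\<close>)
      show "\<forall>\<^sub>F k in sequentially. \<forall>y. norm (V (e k) r y) \<le> (1 + M) * norm y"
        by (rule always_eventually) (use V_bound e r in \<open>auto simp: less_imp_le\<close>)
    qed
    then show ?thesis unfolding f_def by (intro tendsto_intros)
  qed
  have "(\<lambda>k. binom_op a (1 - e k) w - binom_op a 1 w) \<longlonglongrightarrow> 0"
  proof (rule Lim_null_comparison[OF always_eventually[OF allI]])
    show "norm (binom_op a (1 - e k) w - binom_op a 1 w) \<le> e k * (M * (\<Sum>k. real k * \<bar>a gchoose k\<bar>) * norm w)" for k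
      using binom_op_diff_bound[OF a(1)] e by (simp add: less_imp_le)
    show "(\<lambda>k. e k * (M * (\<Sum>k. real k * \<bar>a gchoose k\<bar>) * norm w)) \<longlonglongrightarrow> 0"
      by (rule tendsto_mult_left_zero[OF e0])
  qed
  then have blim: "(\<lambda>k. binom_op a (1 - e k) w) \<longlonglongrightarrow> binom_op a 1 w" by (rule LIM_zero_cancel)
  have "integral {0<..} (f 0) = bal_const a n *\<^sub>R binom_op a 1 w"
  proof (rule eq_if_inner_eq)
    fix y
    have fi: "((\<lambda>r. inner (f (e k) r) y) has_integral inner (bal_const a n *\<^sub>R binom_op a (1 - e k) w) y) {0<..}" for k
      using has_integral_linear[OF fe bounded_linear_inner_left] by (simp add: o_def)
    have "(\<lambda>k. integral {0<..} (\<lambda>r. inner (f (e k) r) y)) \<longlonglongrightarrow> integral {0<..} (\<lambda>r. inner (f 0 r) y)"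
    proof (rule dominated_convergence(2))
      show "(\<lambda>r. inner (f (e k) r) y) integrable_on {0<..}" for k using fi by blast
      show "(\<lambda>r. h r * norm y) integrable_on {0<..}" by (rule integrable_on_mult_left[OF h])
      show "norm (inner (f (e k) r) y) \<le> h r * norm y" if "r \<in> {0<..}" for k r
        using le[of "e k" r] e that
        by (auto intro!: order_trans[OF Cauchy_Schwarz_ineq2 mult_right_mono] simp: less_imp_le)
      show "(\<lambda>k. inner (f (e k) r) y) \<longlonglongrightarrow> inner (f 0 r) y" if "r \<in> {0<..}" for r
        using flim that by (intro tendsto_intros) auto
    qed
    then have "(\<lambda>k. inner (bal_const a n *\<^sub>R binom_op a (1 - e k) w) y) \<longlonglongrightarrow> inner (integral {0<..} (f 0)) y"
      using integral_linear[OF int bounded_linear_inner_left[of y]] by (simp only: integral_unique[OF fi] o_def)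
    moreover have "(\<lambda>k. inner (bal_const a n *\<^sub>R binom_op a (1 - e k) w) y) \<longlonglongrightarrow> inner (bal_const a n *\<^sub>R binom_op a 1 w) y"
      by (intro tendsto_intros blim)
    ultimately show "inner (integral {0<..} (f 0)) y = inner (bal_const a n *\<^sub>R binom_op a 1 w) y"
      by (rule LIMSEQ_unique)
  qed
  then show ?thesis
    using integrable_integral[OF int] by (simp add: f_def[abs_def] x_def w_def)
qed

section \<open>Fractional powers\<close>

lemma op_apply_V:
  assumes "p \<ge> 0" "r > 0"
  shows "op_apply (op_shift (of_real p) A \<odot> (op_shift (of_real r) (op_shift (of_real p) A))\<inverse>) = V p r"
proof -
  have l: "resolvable (of_real (p + r))" using assms by (intro resolvable_real) simp
  have "op_shift (of_real r) (op_shift (of_real p) A) = op_shift (of_real (p + r)) A"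
    by (simp add: op_shift_shift add.commute)
  then have eq: "(op_shift (of_real r) (op_shift (of_real p) A))\<inverse> = graph_of (res (of_real (p + r)))"
    using resolvable_graph(1)[OF l] by simp
  have "(res (of_real (p + r)) y, z) \<in> op_shift (of_real p) A \<longleftrightarrow> z = V p r y" for y z
  proof -
    let ?x = "res (of_real (p + r)) y"
    have in_A: "(?x, y - of_real (p + r) *\<^sub>C ?x) \<in> A" by (rule res_in_A[OF l])
    have "(?x, z) \<in> op_shift (of_real p) A \<longleftrightarrow> z - of_real p *\<^sub>C ?x = y - of_real (p + r) *\<^sub>C ?x"
      unfolding op_shift_iff using in_A A_single_valued by metis
    also have "\<dots> \<longleftrightarrow> z = V p r y"
      unfolding scaleC_of_real V_def by (auto simp: algebra_simps)
    finally show ?thesis .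
  qed
  then have "op_shift (of_real p) A \<odot> graph_of (res (of_real (p + r))) = graph_of (V p r)"
    by (auto simp: op_prod_def graph_of_def)
  then show ?thesis unfolding eq by simp
qed

abbreviation bal_order :: "real \<Rightarrow> nat" where "bal_order a \<equiv> nat \<lfloor>a\<rfloor> + 1"

lemma bal_order_gt: "a > 0 \<Longrightarrow> a < real (bal_order a)"
  by linarith

lemma in_balakrishnan_iff:
  assumes "p \<ge> 0" "a > 0"
  defines "n \<equiv> bal_order a"
  shows "(x, z) \<in> balakrishnan (op_shift (of_real p) A) a \<longleftrightarrow>
    x \<in> Domain (op_shift (of_real p) A ^^ n) \<and>
    ((\<lambda>r. r powr (a - 1) *\<^sub>R (V p r ^^ n) x) has_integral bal_const a n *\<^sub>R z) {0<..}"
proof -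
  have c: "Gamma (real n) / (Gamma a * Gamma (real n - a)) = inverse (bal_const a n)"
    by (simp add: bal_const_def divide_inverse)
  have c0: "bal_const a n \<noteq> 0"
    using bal_const_pos[of a n] bal_order_gt[of a] assms by simp
  have i: "((\<lambda>r. r powr (a - 1) *\<^sub>R
      (op_apply (op_shift (of_real p) A \<odot> (op_shift (of_real r) (op_shift (of_real p) A))\<inverse>) ^^ n) x) has_integral y) {0<..}
    \<longleftrightarrow> ((\<lambda>r. r powr (a - 1) *\<^sub>R (V p r ^^ n) x) has_integral y) {0<..}" for x y
    by (rule has_integral_cong) (simp add: op_apply_V assms)
  have "balakrishnan (op_shift (of_real p) A) a = {(x, inverse (bal_const a n) *\<^sub>R y) |x y.
      x \<in> Domain (op_shift (of_real p) A ^^ n) \<and>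
      ((\<lambda>r. r powr (a - 1) *\<^sub>R (V p r ^^ n) x) has_integral y) {0<..}}"
    unfolding balakrishnan_def Let_def n_def[symmetric] i c ..
  moreover have "z = inverse (bal_const a n) *\<^sub>R y \<longleftrightarrow> y = bal_const a n *\<^sub>R z" for y z :: 'a
    using c0 by auto
  ultimately show ?thesis by auto
qed

lemma U_pow_in_domain: "(U ^^ n) y \<in> Domain (op_shift (of_real p) A ^^ n)"
proof -
  have "\<exists>z. ((U ^^ n) y, z) \<in> op_shift (of_real p) A ^^ n" for y
  proof (induction n arbitrary: y)
    case (Suc n)
    let ?y = "p *\<^sub>R U y + (y - U y)"
    have "((U ^^ n) (U y), (U ^^ n) (y - U y)) \<in> A"
      by (rule commuting_A[OF commuting_funpow[OF U_commuting] AU_in_A])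
    then have "((U ^^ Suc n) y, (U ^^ n) ?y) \<in> op_shift (of_real p) A"
      unfolding op_shift_iff scaleC_of_real
      by (simp add: funpow_swap1 bounded_clinearD(1,4)[OF commuting_clinear[OF commuting_funpow[OF U_commuting]]])
    moreover obtain z where "((U ^^ n) ?y, z) \<in> op_shift (of_real p) A ^^ n" using Suc by blast
    ultimately show ?case by (intro exI) (rule relpow_Suc_I2)
  qed auto
  then show ?thesis by blast
qed

lemma closure_range_U_pow: "closure (range (U ^^ n)) = UNIV"
proof (induction n)
  case (Suc n)
  have cont: "continuous_on S (U ^^ n)" for S
    by (intro linear_continuous_on bounded_clinear_linear commuting_clinear commuting_funpow U_commuting)
  have "Domain A \<subseteq> range U"
  proof
    fix x assume "x \<in> Domain A"
    then obtain y where "(x, y) \<in> A" by blast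
    then have "x = U (1 *\<^sub>C x + y)" using res_left[OF resolvable_1] by simp
    then show "x \<in> range U" by blast
  qed
  moreover have "closure (Domain A) = UNIV"
    using domain_dense by (metis UNIV_eq_I closure_sequential)
  ultimately have "closure (range U) = UNIV"
    using closure_mono by blast
  moreover have "(U ^^ n) ` closure (range U) \<subseteq> closure ((U ^^ n) ` range U)"
    by (rule image_closure_subset[OF cont closed_closure closure_subset])
  ultimately have "(U ^^ n) ` UNIV \<subseteq> closure ((U ^^ n) ` range U)" by simp
  also have "(U ^^ n) ` range U = range (U ^^ Suc n)"
    by (auto simp: funpow_swap1 image_image)
  finally have "closure (range (U ^^ n)) \<subseteq> closure (range (U ^^ Suc n))"
    by (simp add: closure_minimal)
  then show ?case by (simp only: Suc top.extremum_unique)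
qed simp

lemma dense_sequence:
  obtains y where "\<And>j::nat. y j \<in> range (U ^^ n)" "y \<longlonglongrightarrow> z"
  using closure_range_U_pow[of n] unfolding set_eq_iff closure_sequential by blast

text \<open>A further factor \<open>K 1 b\<close> makes \<open>K 1 a\<close> a power of \<open>U\<close>, and \<open>U\<close> is injective because \<open>A\<close> is single-valued.\<close>

lemma K_injective:
  assumes "a > 0" "K 1 a x = K 1 a y"
  shows "x = y"
proof -
  obtain m where m: "a < real (Suc m)" using reals_Archimedean2[of a] by (metis less_trans lessI of_nat_less_iff)
  have U_inj: "x = y" if "U x = U y" for x y
  proof -
    have "(U x, x - U x) \<in> A" "(U x, y - U x) \<in> A" using AU_in_A[of x] AU_in_A[of y] that by auto
    then have "x - U x = y - U x" by (rule A_single_valued)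
    then show ?thesis by simp
  qed
  have pow_inj: "(U ^^ n) x = (U ^^ n) y \<Longrightarrow> x = y" for n
    by (induction n) (auto dest: U_inj)
  have "(U ^^ Suc m) v = K 1 (real (Suc m) - a) (K 1 a v)" for v
    using res_pow_real[of 1 m v] K_add[of 1 "real (Suc m) - a" a v] assms(1) m
    by (simp del: of_nat_Suc funpow.simps)
  then show ?thesis using assms(2) pow_inj[of "Suc m"] by metis
qed

lemma V_pow_commute:
  assumes "commuting S" "p \<ge> 0" "r > 0"
  shows "S ((V p r ^^ n) x) = (V p r ^^ n) (S x)"
proof -
  have "S (V p r y) = V p r (S y)" for y
    using commuting_res[OF assms(1) resolvable_real[of "p + r"]] assms
    by (simp add: V_def bounded_clinearD[OF commuting_clinear])
  then show ?thesis by (induction n) simp_all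
qed

text \<open>Regularizing by a commuting operator moves an arbitrary element of the graph to one where the integral is known.\<close>

lemma balakrishnan_integral_commuting:
  assumes S: "commuting S" and p: "p \<ge> 0"
    and i: "((\<lambda>r. r powr (a - 1) *\<^sub>R (V p r ^^ n) x) has_integral c *\<^sub>R z) {0<..}"
  shows "((\<lambda>r. r powr (a - 1) *\<^sub>R (V p r ^^ n) (S x)) has_integral c *\<^sub>R S z) {0<..}"
proof -
  note lin = bounded_clinearD[OF commuting_clinear[OF S]]
  have "((\<lambda>r. S (r powr (a - 1) *\<^sub>R (V p r ^^ n) x)) has_integral S (c *\<^sub>R z)) {0<..}"
    using has_integral_linear[OF i bounded_clinear_linear[OF commuting_clinear[OF S]]] by (simp add: o_def)
  then have "((\<lambda>r. r powr (a - 1) *\<^sub>R (V p r ^^ n) (S x)) has_integral S (c *\<^sub>R z)) {0<..}"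
    by (rule has_integral_eq[rotated]) (simp add: lin V_pow_commute[OF S p])
  then show ?thesis by (simp add: lin)
qed

text \<open>One inclusion regularizes a given pair in the graph by \<open>K 1 d\<close> and \<open>U ^^ n\<close>, evaluates the integral and cancels the
  injective factors. The other one takes limits of pairs over the dense range of \<open>U ^^ n\<close>.\<close>

theorem frac_power_negative:
  assumes d: "d > 0"
  shows "frac_power (op_shift 1 A) (- d) = graph_of (K 1 d)"
proof -
  define n where "n = bal_order d"
  have n: "d < real n" unfolding n_def by (rule bal_order_gt[OF d])
  have c: "bal_const d n > 0" using bal_const_pos d n by simp
  note iff = in_balakrishnan_iff[of 1 d, unfolded of_real_1, folded n_def, OF zero_le_one d]
  have Kc: "commuting (K 1 d)" using d by (intro K_commuting) auto
  have closed: "closed {q. fst q = K 1 d (snd q)}"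
    by (intro closed_Collect_eq continuous_intros
        bounded_linear.continuous_on[OF bounded_clinear_linear[OF commuting_clinear[OF Kc]]])
  have "x = K 1 d z" if "(x, z) \<in> balakrishnan (op_shift 1 A) d" for x z
  proof -
    have i: "((\<lambda>r. r powr (d - 1) *\<^sub>R (V 1 r ^^ n) x) has_integral bal_const d n *\<^sub>R z) {0<..}"
      using that iff by simp
    have S: "commuting (\<lambda>v. K 1 d ((U ^^ n) v))"
      by (rule commuting_compose[OF Kc commuting_funpow[OF U_commuting]])
    have "((\<lambda>r. r powr (d - 1) *\<^sub>R (V 1 r ^^ n) (K 1 d ((U ^^ n) x))) has_integral
        bal_const d n *\<^sub>R K 1 d ((U ^^ n) z)) {0<..}"
      by (rule balakrishnan_integral_commuting[OF S zero_le_one i])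
    moreover have "((\<lambda>r. r powr (d - 1) *\<^sub>R (V 1 r ^^ n) (K 1 d ((U ^^ n) x))) has_integral
        bal_const d n *\<^sub>R (U ^^ n) x) {0<..}"
      using balakrishnan_integral_pos[of 1 d n x] d n by simp
    ultimately have "bal_const d n *\<^sub>R (U ^^ n) x = bal_const d n *\<^sub>R K 1 d ((U ^^ n) z)"
      by (rule has_integral_unique[rotated])
    then have "(U ^^ n) x = K 1 d ((U ^^ n) z)" using c by simp
    then have "(U ^^ n) x = (U ^^ n) (K 1 d z)"
      using commuting_K[OF commuting_funpow[OF U_commuting], of 1 d n z] d by simp
    then have "K 1 d ((U ^^ n) x) = K 1 d ((U ^^ n) (K 1 d z))" by simp
    then have "K 1 (d + real n) x = K 1 (d + real n) (K 1 d z)"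
      using K_add_nat[of 1 d n] d by simp
    then show ?thesis by (rule K_injective[rotated]) (use d in auto)
  qed
  then have "balakrishnan (op_shift 1 A) d \<subseteq> {q. fst q = K 1 d (snd q)}" by auto
  then have 1: "closure (balakrishnan (op_shift 1 A) d) \<subseteq> {q. fst q = K 1 d (snd q)}"
    by (rule closure_minimal[OF _ closed])
  have 2: "(K 1 d z, z) \<in> closure (balakrishnan (op_shift 1 A) d)" for z
  proof -
    obtain y where y: "\<And>j::nat. y j \<in> range (U ^^ n)" "y \<longlonglongrightarrow> z" using dense_sequence by blast
    have "(K 1 d (y j), y j) \<in> balakrishnan (op_shift 1 A) d" for j
    proof -
      obtain v where v: "y j = (U ^^ n) v" using y(1) by blast
      have "K 1 d (y j) = (U ^^ n) (K 1 d v)"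
        using commuting_K[OF commuting_funpow[OF U_commuting], of 1 d n v] d v by simp
      then show ?thesis
        using iff U_pow_in_domain[of n "K 1 d v" 1] balakrishnan_integral_pos[of 1 d n v] d n v by simp
    qed
    moreover have "(\<lambda>j. (K 1 d (y j), y j)) \<longlonglongrightarrow> (K 1 d z, z)"
      by (intro tendsto_Pair y bounded_clinear_tendsto[OF commuting_clinear[OF Kc]])
    ultimately show ?thesis unfolding closure_sequential
      by (intro exI[of _ "\<lambda>j. (K 1 d (y j), y j)"] conjI allI)
  qed
  have "closure (balakrishnan (op_shift 1 A) d) = (graph_of (K 1 d))\<inverse>"
    using 1 2 by (auto simp: graph_of_def)
  then show ?thesis using d by (simp add: frac_power_def)
qed

text \<open>The closure contains all pairs \<open>((1 + A)\<^sup>-\<^sup>a z, (1 - U)\<^sup>a z)\<close> and is single-valued, so it maps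
  \<open>(1 + A)\<^sup>-\<^sup>a (1 + A)\<^sup>-\<^sup>b y\<close> to \<open>(1 - U)\<^sup>a (1 + A)\<^sup>-\<^sup>b y\<close> and the product has full domain.\<close>

theorem frac_power_product:
  assumes a: "a \<ge> 1" and b: "b > 0"
  shows "frac_power A a \<odot> frac_power (op_shift 1 A) (- (a + b)) = graph_of (\<lambda>y. binom_op a 1 (K 1 b y))"
proof -
  define n where "n = bal_order a"
  have a0: "a > 0" using a by simp
  have n: "a < real n" unfolding n_def by (rule bal_order_gt[OF a0])
  have c: "bal_const a n > 0" using bal_const_pos a0 n by simp
  have "op_shift 0 A = A" by (auto simp: op_shift_iff scaleC.zero_left)
  then have iff: "(x, z) \<in> balakrishnan A a \<longleftrightarrow>
    x \<in> Domain (A ^^ n) \<and> ((\<lambda>r. r powr (a - 1) *\<^sub>R (V 0 r ^^ n) x) has_integral bal_const a n *\<^sub>R z) {0<..}" for x z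
    using in_balakrishnan_iff[of 0 a x z] a0 by (simp add: n_def)
  have dom: "(U ^^ n) y \<in> Domain (A ^^ n)" for y
    using U_pow_in_domain[of n y 0] \<open>op_shift 0 A = A\<close> by simp
  have Kc: "commuting (K 1 a)" using a0 by (intro K_commuting) auto
  have Dc: "commuting (binom_op a 1)" using a by (intro binom_op_commuting) auto
  have Uc: "commuting (U ^^ n)" by (rule commuting_funpow[OF U_commuting])
  note contin = bounded_linear.continuous_on[OF bounded_clinear_linear[OF commuting_clinear]]
  have closed: "closed {q. K 1 a ((U ^^ n) (snd q)) = binom_op a 1 ((U ^^ n) (fst q))}"
    by (intro closed_Collect_eq contin[OF Kc] contin[OF Uc] contin[OF Dc] continuous_intros)
  have "K 1 a ((U ^^ n) z) = binom_op a 1 ((U ^^ n) x)" if "(x, z) \<in> balakrishnan A a" for x z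
  proof -
    have i: "((\<lambda>r. r powr (a - 1) *\<^sub>R (V 0 r ^^ n) x) has_integral bal_const a n *\<^sub>R z) {0<..}"
      using that iff by simp
    have "((\<lambda>r. r powr (a - 1) *\<^sub>R (V 0 r ^^ n) (K 1 a ((U ^^ n) x))) has_integral
        bal_const a n *\<^sub>R K 1 a ((U ^^ n) z)) {0<..}"
      by (rule balakrishnan_integral_commuting[OF commuting_compose[OF Kc Uc] order_refl i])
    then have "bal_const a n *\<^sub>R K 1 a ((U ^^ n) z) = bal_const a n *\<^sub>R binom_op a 1 ((U ^^ n) x)"
      using balakrishnan_integral_0[OF a n, of x] by (rule has_integral_unique)
    then show ?thesis using c by simp
  qed
  then have "closure (balakrishnan A a) \<subseteq> {q. K 1 a ((U ^^ n) (snd q)) = binom_op a 1 ((U ^^ n) (fst q))}"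
    by (intro closure_minimal[OF _ closed]) auto
  then have 1: "K 1 a ((U ^^ n) z) = binom_op a 1 ((U ^^ n) x)" if "(x, z) \<in> closure (balakrishnan A a)" for x z
    using that by auto
  have unique: "z = z'" if "(x, z) \<in> closure (balakrishnan A a)" "(x, z') \<in> closure (balakrishnan A a)" for x z z'
  proof -
    have "K 1 a ((U ^^ n) z) = K 1 a ((U ^^ n) z')" using 1[OF that(1)] 1[OF that(2)] by simp
    then have "K 1 (a + real n) z = K 1 (a + real n) z'" using K_add_nat[of 1 a n] a0 by simp
    then show ?thesis by (rule K_injective[rotated]) (use a0 in auto)
  qed
  have 2: "(K 1 a z, binom_op a 1 z) \<in> closure (balakrishnan A a)" for z
  proof -
    obtain y where y: "\<And>j::nat. y j \<in> range (U ^^ n)" "y \<longlonglongrightarrow> z" using dense_sequence by blast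
    have "(K 1 a (y j), binom_op a 1 (y j)) \<in> balakrishnan A a" for j
    proof -
      obtain v where v: "y j = (U ^^ n) v" using y(1) by blast
      have "K 1 a (y j) = (U ^^ n) (K 1 a v)"
        using commuting_K[OF Uc, of 1 a v] a0 v by simp
      then show ?thesis using iff dom[of "K 1 a v"] balakrishnan_integral_0[OF a n, of v] v by simp
    qed
    moreover have "(\<lambda>j. (K 1 a (y j), binom_op a 1 (y j))) \<longlonglongrightarrow> (K 1 a z, binom_op a 1 z)"
      by (intro tendsto_Pair y bounded_clinear_tendsto[OF commuting_clinear[OF Kc]]
          bounded_clinear_tendsto[OF commuting_clinear[OF Dc]])
    ultimately show ?thesis unfolding closure_sequential
      by (intro exI[of _ "\<lambda>j. (K 1 a (y j), binom_op a 1 (y j))"] conjI allI)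
  qed
  have "(K 1 (a + b) y, z) \<in> closure (balakrishnan A a) \<longleftrightarrow> z = binom_op a 1 (K 1 b y)" for y z
    using 2[of "K 1 b y"] K_add[of 1 a b y] a0 b unique by auto
  moreover have "frac_power (op_shift 1 A) (- (a + b)) = graph_of (K 1 (a + b))"
    by (rule frac_power_negative) (use a0 b in simp)
  moreover have "frac_power A a = closure (balakrishnan A a)" using a0 by (simp add: frac_power_def)
  ultimately show ?thesis by (auto simp: op_prod_def graph_of_def)
qed

section \<open>Resolvent estimates for fractional powers\<close>

text \<open>Low frequencies. With \<open>u = 1 / (1 - i s)\<close>, the operators \<open>U ^^ k\<close> and \<open>u ^ k\<close> differ on the range of \<open>R s\<close> by an error of
  order \<open>k\<close>, and \<open>k (a choose k)\<close> is summable. So \<open>(1 - U)\<^sup>a\<close> acts there as the scalar \<open>(1 - u)\<^sup>a\<close> up to a bounded error, and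
  this scalar is at most \<open>\<bar>s\<bar> powr a\<close>.\<close>

lemma R_binom_op_bound:
  assumes r: "resolvable (\<i> * of_real s)" and s: "s \<noteq> 0" and a: "a \<ge> 1"
    and C: "C \<ge> 0" "norm (R s y) \<le> C * \<bar>s\<bar> powr - a * norm y"
  shows "norm (R s (binom_op a 1 y)) \<le> (C + M * M * (\<Sum>k. real k * \<bar>a gchoose k\<bar>)) * norm y"
proof -
  define u where "u = 1 / (1 - \<i> * of_real s)"
  define v where "v = R s y"
  define c where "c k = (a gchoose k) * (- 1) ^ k" for k
  have ne: "1 - \<i> * of_real s \<noteq> 0" by (simp add: complex_eq_iff)
  have "(cmod (1 - \<i> * of_real s))\<^sup>2 = 1 + s\<^sup>2" by (simp add: cmod_power2)
  then have "1\<^sup>2 < (cmod (1 - \<i> * of_real s))\<^sup>2" using s by simp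
  then have gt: "1 < cmod (1 - \<i> * of_real s)" by (rule power_less_imp_less_base) simp
  then have u: "cmod u < 1" by (simp add: u_def norm_divide)
  have "1 - u = - (\<i> * of_real s) * u" using ne by (simp add: u_def field_simps)
  then have "cmod (1 - u) = \<bar>s\<bar> * cmod u" by (simp add: norm_mult)
  also have "\<dots> \<le> \<bar>s\<bar> * 1" using u by (intro mult_left_mono) auto
  finally have u1: "cmod (1 - u) \<le> \<bar>s\<bar>" by simp
  have "(\<lambda>k. (of_real a gchoose k) * (- u) ^ k) sums (1 + - u) powr of_real a"
    by (rule gen_binomial_complex) (use u in simp)
  moreover have "(of_real a gchoose k) * (- u) ^ k = of_real (c k) * u ^ k" for k
    using power_mult_distrib[of "-1" u k] by (simp add: c_def gbinomial_prod_rev mult_ac)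
  ultimately have cs: "(\<lambda>k. of_real (c k) * u ^ k) sums (1 - u) powr of_real a" by simp
  have "cmod ((1 - u) powr of_real a) = cmod (1 - u) powr a" by (simp add: norm_powr_real_powr')
  also have "\<dots> \<le> \<bar>s\<bar> powr a" using a u1 by (intro powr_mono2) auto
  finally have cb: "cmod ((1 - u) powr of_real a) \<le> \<bar>s\<bar> powr a" .
  have "U v = u *\<^sub>C (v - U y)"
    unfolding v_def u_def by (rule res_R[OF resolvable_1 r]) (auto simp: complex_eq_iff)
  then have "norm (U v - u *\<^sub>C v) = cmod u * norm (U y)" by (simp add: scaleC.diff_right norm_scaleC)
  also have "\<dots> \<le> 1 * (M * norm y)" using u by (intro mult_mono U_bound) auto
  finally have Uv: "norm (U v - u *\<^sub>C v) \<le> M * norm y" by simp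
  have diff: "norm (c k *\<^sub>R (U ^^ k) v - (of_real (c k) * u ^ k) *\<^sub>C v)
      \<le> (real k * \<bar>a gchoose k\<bar>) * (M * (M * norm y))" for k
  proof -
    have "norm (c k *\<^sub>R (U ^^ k) v - (of_real (c k) * u ^ k) *\<^sub>C v) = \<bar>c k\<bar> * norm ((U ^^ k) v - u ^ k *\<^sub>C v)"
      unfolding scaleC_scaleC[symmetric] scaleC_of_real by (simp flip: scaleR_diff_right)
    also have "\<dots> \<le> \<bar>c k\<bar> * (real k * M * norm (U v - u *\<^sub>C v))"
      using u by (intro mult_left_mono norm_funpow_minus_power_le commuting_clinear U_commuting U_pow_bound) auto
    also have "\<dots> \<le> \<bar>c k\<bar> * (real k * M * (M * norm y))"
      using M_ge_1 by (intro mult_left_mono Uv) auto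
    also have "\<bar>c k\<bar> = \<bar>a gchoose k\<bar>" by (simp add: c_def abs_mult)
    finally show ?thesis by (simp add: mult_ac)
  qed
  have "(\<lambda>k. c k *\<^sub>R (U ^^ k) v) sums binom_op a 1 v"
    using W_sums[OF binom_coeff_summable[of 1 a], of v] a by (simp add: binom_op_def c_def)
  then have "(\<lambda>k. c k *\<^sub>R (U ^^ k) v - (of_real (c k) * u ^ k) *\<^sub>C v) sums
      (binom_op a 1 v - ((1 - u) powr of_real a) *\<^sub>C v)"
    by (rule sums_diff[OF _ bounded_linear.sums[OF scaleC.bounded_linear_left cs]])
  then have "norm (binom_op a 1 v - ((1 - u) powr of_real a) *\<^sub>C v) \<le>
      (\<Sum>k. (real k * \<bar>a gchoose k\<bar>) * (M * (M * norm y)))"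
    by (subst sums_unique, assumption) (rule norm_suminf_le diff summable_mult2 summable_abs_gbinomial_mult a)+
  also have "\<dots> = M * M * (\<Sum>k. real k * \<bar>a gchoose k\<bar>) * norm y"
    using suminf_mult2[OF summable_abs_gbinomial_mult[OF a], of "M * (M * norm y)"] by (simp add: mult_ac)
  finally have d: "norm (binom_op a 1 v - ((1 - u) powr of_real a) *\<^sub>C v)
      \<le> M * M * (\<Sum>k. real k * \<bar>a gchoose k\<bar>) * norm y" .
  have "norm (((1 - u) powr of_real a) *\<^sub>C v) \<le> \<bar>s\<bar> powr a * (C * \<bar>s\<bar> powr - a * norm y)"
    unfolding norm_scaleC v_def by (intro mult_mono cb C) auto
  also have "\<dots> = C * norm y" using s by (simp add: powr_minus_divide)
  finally have e: "norm (((1 - u) powr of_real a) *\<^sub>C v) \<le> C * norm y" .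
  have "R s (binom_op a 1 y) = binom_op a 1 v"
    unfolding v_def using commuting_res[OF binom_op_commuting r, of 1 a y] a by simp
  then have "norm (R s (binom_op a 1 y)) \<le> norm (((1 - u) powr of_real a) *\<^sub>C v)
      + norm (binom_op a 1 v - ((1 - u) powr of_real a) *\<^sub>C v)"
    using norm_triangle_sub by simp
  also have "\<dots> \<le> C * norm y + M * M * (\<Sum>k. real k * \<bar>a gchoose k\<bar>) * norm y"
    by (intro add_mono d e)
  finally show ?thesis by (simp add: algebra_simps)
qed

text \<open>This is the estimate for the Euler operator without its normalizing factor; for \<open>p > \<bar>s\<bar>\<close> the scalar decays in \<open>p\<close>, else in \<open>s\<close>.\<close>

lemma R_res_pow_bound:
  assumes r: "resolvable (\<i> * of_real s)" and p: "p > 0"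
  shows "norm (R s ((res (of_real p) ^^ m) y))
    \<le> (1 / max p \<bar>s\<bar>) ^ m * norm (R s y) + real m * M * M * (1 / p ^ Suc m) * norm y"
proof -
  have "p ^ m * norm (R s ((res (of_real p) ^^ m) y)) = norm ((euler p ^^ m) (R s y))"
    using commuting_res[OF commuting_funpow[OF res_commuting[OF resolvable_real[OF p]]] r, of m y] p
    by (simp add: euler_pow[OF p])
  also have "\<dots> \<le> (p / max p \<bar>s\<bar>) ^ m * norm (R s y) + real m * M * norm (res (of_real p) y)"
    by (rule euler_R_pow_bound(1)[OF r p])
  also have "\<dots> \<le> (p / max p \<bar>s\<bar>) ^ m * norm (R s y) + real m * M * (M / p * norm y)"
    using resolvable_Re_pos(2)[of "of_real p" y] p M_ge_1 by (intro add_left_mono mult_left_mono) auto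
  also have "(p / max p \<bar>s\<bar>) ^ m = p ^ m * (1 / max p \<bar>s\<bar>) ^ m" by (simp add: power_divide)
  also have "M / p = p ^ m * (M * (1 / p ^ Suc m))" using p by simp
  finally have "p ^ m * norm (R s ((res (of_real p) ^^ m) y))
      \<le> p ^ m * ((1 / max p \<bar>s\<bar>) ^ m * norm (R s y) + real m * M * M * (1 / p ^ Suc m) * norm y)"
    by (simp only: distrib_left mult_ac)
  then show ?thesis by (rule mult_left_le_imp_le) (use p in simp)
qed

text \<open>High frequencies. In the integral representation of \<open>(1 + A)\<^sup>-\<^sup>b\<close> by powers \<open>(1 + r + A)\<^sup>-\<^sup>m\<close> each resolvent acts
  as a scalar up to a remainder; the integral of the scalars is of order \<open>\<bar>s\<bar> powr - b\<close>, and that of the remainders is bounded.\<close>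

lemma R_K_bound:
  assumes b: "b > 0"
  shows "\<exists>L\<ge>0. \<forall>C\<ge>0. \<forall>s y. resolvable (\<i> * of_real s) \<and> \<bar>s\<bar> \<ge> 1 \<and> norm (R s y) \<le> C * \<bar>s\<bar> powr b * norm y \<longrightarrow>
    norm (R s (K 1 b y)) \<le> L * (C + 1) * norm y"
proof -
  define m where "m = bal_order b"
  define a where "a = real m - b"
  have m: "b < real m" unfolding m_def by (rule bal_order_gt[OF b])
  have a: "0 < a" "a < real m" "real m - a = b" using b m by (auto simp: a_def)
  obtain j where j: "m = Suc j" by (simp add: m_def)
  define I where "I = 1 / a + 1 / b"
  have I: "I \<ge> 0" using a b by (simp add: I_def)
  have c: "bal_const a m > 0" by (rule bal_const_pos[OF a(1,2)])
  define L where "L = (I + real m * M * M * I) / bal_const a m"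
  have M: "M \<ge> 1" by (rule M_ge_1)
  have L: "L \<ge> 0" using I c M by (simp add: L_def)
  have "norm (R s (K 1 b y)) \<le> L * (C + 1) * norm y"
    if C: "C \<ge> 0" and r: "resolvable (\<i> * of_real s)" and s: "\<bar>s\<bar> \<ge> 1"
      and Rs: "norm (R s y) \<le> C * \<bar>s\<bar> powr b * norm y" for C s y
  proof -
    have s0: "s \<noteq> 0" using s by auto
    \<comment> \<open>The dominating functions of the scalar part and of the remainder.\<close>
    let ?g = "\<lambda>r. if r \<le> \<bar>s\<bar> then \<bar>s\<bar> powr - real m * r powr (a - 1) else 1 * r powr (a - 1 - real m)"
    let ?h = "\<lambda>r. if r \<le> 1 then 1 * r powr (a - 1) else 1 * r powr (a - 1 - real m)"
    let ?G = "\<lambda>r. ?g r * (C * \<bar>s\<bar> powr b * norm y) + ?h r * (real m * M * M * norm y)"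
    have gI: "(?g has_integral \<bar>s\<bar> powr - real m * (\<bar>s\<bar> powr a / a) + 1 * (\<bar>s\<bar> powr (a - real m) / (real m - a))) {0<..}"
      by (rule has_integral_powr_split) (use a s0 in auto)
    have "\<bar>s\<bar> powr - real m * (\<bar>s\<bar> powr a / a) + 1 * (\<bar>s\<bar> powr (a - real m) / (real m - a)) = \<bar>s\<bar> powr - b * I"
      using s0 a by (simp add: I_def a_def powr_diff powr_minus_divide field_simps)
    then have g: "(?g has_integral \<bar>s\<bar> powr - b * I) {0<..}" using gI by metis
    have h: "(?h has_integral I) {0<..}"
      using has_integral_powr_split[of a "real m" 1 1 1] a by (simp add: I_def)
    have G: "(?G has_integral (\<bar>s\<bar> powr - b * I) * (C * \<bar>s\<bar> powr b * norm y) + I * (real m * M * M * norm y)) {0<..}"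
      by (intro has_integral_add has_integral_mult_left g h)
    have "((\<lambda>r. r powr (a - 1) *\<^sub>R K (1 + r) (real m) y) has_integral bal_const a m *\<^sub>R K 1 b y) {0<..}"
      using has_integral_powr_K[of 1 a "real m" y] a by (simp add: bal_const_def)
    from has_integral_linear[OF this bounded_clinear_linear[OF resolvable_graph(2)[OF r]]]
    have i: "((\<lambda>q. q powr (a - 1) *\<^sub>R R s (K (1 + q) (real m) y)) has_integral bal_const a m *\<^sub>R R s (K 1 b y)) {0<..}"
      by (simp add: o_def bounded_clinearD(4)[OF resolvable_graph(2)[OF r]])
    have le: "norm (q powr (a - 1) *\<^sub>R R s (K (1 + q) (real m) y)) \<le> ?G q" if q: "q > 0" for q
    proof -
      have "norm (R s (K (1 + q) (real m) y))
        \<le> (1 / max (1 + q) \<bar>s\<bar>) ^ m * norm (R s y) + real m * M * M * (1 / (1 + q) ^ Suc m) * norm y"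
        using R_res_pow_bound[OF r, of "1 + q" m y] q s0 res_pow_real[of "1 + q" j y]
        by (simp add: j del: funpow.simps of_nat_Suc)
      also have "\<dots> \<le> (1 / max (1 + q) \<bar>s\<bar>) ^ m * (C * \<bar>s\<bar> powr b * norm y) + real m * M * M * (1 / (1 + q) ^ Suc m) * norm y"
        by (intro add_right_mono mult_left_mono Rs) simp
      finally have le: "norm (R s (K (1 + q) (real m) y)) \<le> (1 / max (1 + q) \<bar>s\<bar>) ^ m * (C * \<bar>s\<bar> powr b * norm y)
          + real m * M * M * (1 / (1 + q) ^ Suc m) * norm y" .
      have 1: "norm (q powr (a - 1) *\<^sub>R R s (K (1 + q) (real m) y))
        \<le> (q powr (a - 1) * (1 / max (1 + q) \<bar>s\<bar>) ^ m) * (C * \<bar>s\<bar> powr b * norm y)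
          + (q powr (a - 1) * (1 / (1 + q) ^ Suc m)) * (real m * M * M * norm y)"
      proof -
        have "norm (q powr (a - 1) *\<^sub>R R s (K (1 + q) (real m) y)) = q powr (a - 1) * norm (R s (K (1 + q) (real m) y))"
          by simp
        also have "\<dots> \<le> q powr (a - 1) * ((1 / max (1 + q) \<bar>s\<bar>) ^ m * (C * \<bar>s\<bar> powr b * norm y)
          + real m * M * M * (1 / (1 + q) ^ Suc m) * norm y)"
          by (rule mult_left_mono[OF le]) simp
        finally show ?thesis by (simp only: distrib_left mult_ac)
      qed
      have pw: "q powr (a - 1) * (1 / q) ^ m = q powr (a - 1 - real m)"
        using q by (simp add: powr_diff powr_realpow power_divide)
      have "q powr (a - 1) * (1 / max (1 + q) \<bar>s\<bar>) ^ m \<le> ?g q"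
      proof (cases "q \<le> \<bar>s\<bar>")
        case True
        have "(1 / max (1 + q) \<bar>s\<bar>) ^ m \<le> (1 / \<bar>s\<bar>) ^ m"
          using q s0 by (intro power_mono divide_left_mono) auto
        also have "\<dots> = \<bar>s\<bar> powr - real m" using s0 by (simp add: powr_minus_divide powr_realpow power_divide)
        finally show ?thesis using True by (simp add: mult_left_mono mult.commute[of _ "q powr (a - 1)"])
      next
        case False
        have "(1 / max (1 + q) \<bar>s\<bar>) ^ m \<le> (1 / q) ^ m"
          using q by (intro power_mono divide_left_mono) auto
        then have "q powr (a - 1) * (1 / max (1 + q) \<bar>s\<bar>) ^ m \<le> q powr (a - 1) * (1 / q) ^ m"
          by (intro mult_left_mono) auto
        then show ?thesis using False pw by simp
      qed
      moreover have "q powr (a - 1) * (1 / (1 + q) ^ Suc m) \<le> ?h q"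
      proof (cases "q \<le> 1")
        case True
        have "1 / (1 + q) ^ Suc m \<le> 1" using q one_le_power[of "1 + q" "Suc m"] by (simp add: divide_le_eq_1)
        then have "q powr (a - 1) * (1 / (1 + q) ^ Suc m) \<le> q powr (a - 1) * 1"
          by (intro mult_left_mono) auto
        then show ?thesis using True by simp
      next
        case False
        have "q ^ m \<le> (1 + q) ^ m" using q by (intro power_mono) auto
        also have "\<dots> \<le> (1 + q) ^ Suc m" using q by (intro power_increasing) auto
        finally have "1 / (1 + q) ^ Suc m \<le> (1 / q) ^ m"
          using q by (simp add: power_divide frac_le)
        then have "q powr (a - 1) * (1 / (1 + q) ^ Suc m) \<le> q powr (a - 1) * (1 / q) ^ m"
          by (intro mult_left_mono) auto
        then show ?thesis using False pw by simp
      qed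
      ultimately have "(q powr (a - 1) * (1 / max (1 + q) \<bar>s\<bar>) ^ m) * (C * \<bar>s\<bar> powr b * norm y)
          + (q powr (a - 1) * (1 / (1 + q) ^ Suc m)) * (real m * M * M * norm y) \<le> ?G q"
        using C M by (intro add_mono mult_right_mono) auto
      then show ?thesis using 1 by linarith
    qed
    have "norm (bal_const a m *\<^sub>R R s (K 1 b y))
        \<le> (\<bar>s\<bar> powr - b * I) * (C * \<bar>s\<bar> powr b * norm y) + I * (real m * M * M * norm y)"
      using Henstock_Kurzweil_Integration.integral_norm_bound_integral
        [OF has_integral_integrable[OF i] has_integral_integrable[OF G]] le
      unfolding integral_unique[OF i] integral_unique[OF G] by auto
    also have "\<dots> = (I * C + real m * M * M * I) * norm y"
      using s0 by (simp add: powr_minus_divide algebra_simps)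
    also have "\<dots> \<le> ((I + real m * M * M * I) * (C + 1)) * norm y"
      using I M C by (intro mult_right_mono) (auto simp: algebra_simps)
    finally show ?thesis using c by (simp add: L_def field_simps)
  qed
  then show ?thesis using L by blast
qed

text \<open>At each frequency one of the two factors compensates the growth of the resolvent, and the other one is merely bounded.\<close>

theorem fractional_decay:
  assumes a: "a \<ge> 1" and b: "b > 0" and r: "\<And>s. s \<noteq> 0 \<Longrightarrow> resolvable (\<i> * of_real s)" and C: "C \<ge> 0"
    and low: "\<And>s x. s \<noteq> 0 \<Longrightarrow> \<bar>s\<bar> \<le> 1 \<Longrightarrow> norm (R s x) \<le> C * \<bar>s\<bar> powr - a * norm x"
    and high: "\<And>s x. \<bar>s\<bar> \<ge> 1 \<Longrightarrow> norm (R s x) \<le> C * \<bar>s\<bar> powr b * norm x"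
  shows "\<exists>L\<ge>0. \<forall>t>0. \<forall>x. norm (T t (binom_op a 1 (K 1 b x))) \<le> L / t * norm x"
proof -
  define S where "S = (\<Sum>k. real k * \<bar>a gchoose k\<bar>)"
  define S' where "S' = (\<Sum>k. \<bar>(a gchoose k) * (- 1) ^ k\<bar>)"
  obtain L where L: "L \<ge> 0" "\<And>s y. resolvable (\<i> * of_real s) \<Longrightarrow> \<bar>s\<bar> \<ge> 1 \<Longrightarrow>
      norm (R s y) \<le> C * \<bar>s\<bar> powr b * norm y \<Longrightarrow> norm (R s (K 1 b y)) \<le> L * (C + 1) * norm y"
    using R_K_bound[OF b] C by metis
  have M: "M \<ge> 1" by (rule M_ge_1)
  have S: "S \<ge> 0" unfolding S_def by (rule suminf_nonneg[OF summable_abs_gbinomial_mult[OF a]]) simp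
  have bs: "summable (\<lambda>k. \<bar>(a gchoose k) * (- 1) ^ k\<bar>)" by (rule binom_coeff_summable) (use a in auto)
  have S': "S' \<ge> 0" unfolding S'_def by (rule suminf_nonneg[OF bs]) simp
  have Bc: "commuting (binom_op a 1)" by (rule binom_op_commuting) (use a in auto)
  have Kc: "commuting (K 1 b)" by (rule K_commuting) (use b in auto)
  define c where "c = (C + M * M * S) * M + M * S' * (L * (C + 1))"
  have c: "c \<ge> 0" using C M S S' L(1) by (simp add: c_def)
  have R: "norm (R s (binom_op a 1 (K 1 b x))) \<le> c * norm x" if s: "s \<noteq> 0" for s x
  proof (cases "\<bar>s\<bar> \<le> 1")
    case True
    have "norm (R s (binom_op a 1 (K 1 b x))) \<le> (C + M * M * S) * norm (K 1 b x)"
      unfolding S_def by (rule R_binom_op_bound[OF r[OF s] s a C low[OF s True]])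
    also have "\<dots> \<le> (C + M * M * S) * (M * norm x)"
      using K_bound[of 1 b x] b C M S by (intro mult_left_mono) auto
    also have "\<dots> \<le> c * norm x"
      using C M S' L(1) by (simp add: c_def algebra_simps)
    finally show ?thesis .
  next
    case False
    have "R s (binom_op a 1 (K 1 b x)) = binom_op a 1 (R s (K 1 b x))"
      using commuting_res[OF Bc r[OF s]] by simp
    also have "norm \<dots> \<le> M * S' * norm (R s (K 1 b x))"
      unfolding binom_op_def S'_def by (rule W_bound[OF bs])
    also have "\<dots> \<le> M * S' * (L * (C + 1) * norm x)"
      using M S' False by (intro mult_left_mono L r s high) auto
    also have "\<dots> \<le> c * norm x"
      using C M S by (simp add: c_def algebra_simps)
    finally show ?thesis .
  qed
  have "norm (T t (binom_op a 1 (K 1 b x))) \<le> 4 * M\<^sup>2 * (1 + M) * ((1 + M) * c) / t * norm x" if "t > 0" for t x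
  proof (rule decay_of_resolvent_bound[OF commuting_compose[OF Bc Kc] _ _ that])
    show "norm (res z (binom_op a 1 (K 1 b x))) \<le> (1 + M) * c * norm x" if "Re z > 0" for z x
      using res_imaginary_bound[of "c * norm x" "binom_op a 1 (K 1 b x)" z] R r c that by (simp add: mult.assoc)
  qed (use M c in simp)
  then show ?thesis
    using M c by (intro exI[of _ "4 * M\<^sup>2 * (1 + M) * ((1 + M) * c)"]) auto
qed

section \<open>Translation to operator norms\<close>

text \<open>The resolvent set of \<open>A\<close> consists of the \<open>z\<close> with \<open>z - A\<close> invertible, whence the sign.\<close>

lemma resolvable_if_not_spectrum:
  assumes "- z \<notin> spectrum A"
  shows "resolvable z"
proof -
  have "bounded_operator ((op_shift (- z) (op_neg A))\<inverse>)" using assms by (simp add: spectrum_def)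
  then obtain f where f: "bounded_clinear f" "(op_shift (- z) (op_neg A))\<inverse> = graph_of f"
    unfolding bounded_operator_def by blast
  have "(x, y) \<in> op_shift z A \<longleftrightarrow> (x, - y) \<in> op_shift (- z) (op_neg A)" for x y
  proof -
    have neg: "(x, v) \<in> op_neg A \<longleftrightarrow> (x, - v) \<in> A" for v
      by (auto simp: op_neg_def) (metis minus_minus)
    show ?thesis by (simp add: op_shift_iff neg scaleC.minus_left)
  qed
  then have "(y, x) \<in> (op_shift z A)\<inverse> \<longleftrightarrow> x = f (- y)" for x y
    using f(2) by (auto simp: graph_of_def set_eq_iff)
  then have "(op_shift z A)\<inverse> = graph_of (\<lambda>y. f (- y))" by (auto simp: graph_of_def)
  moreover have "bounded_clinear (\<lambda>y. f (- y))"
    using bounded_clinear_compose[OF f(1) bounded_clinear_scaleR[OF bounded_clinear_id, of "- 1"]] by simp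
  ultimately show ?thesis unfolding resolvable_def bounded_operator_def by blast
qed

lemma op_norm_R: "resolvable (\<i> * of_real s) \<Longrightarrow> op_norm ((op_shift (\<i> * of_real s) A)\<inverse>) = onorm (R s)"
  by (simp add: resolvable_graph)

lemma R_le_onorm: "resolvable (\<i> * of_real s) \<Longrightarrow> norm (R s x) \<le> onorm (R s) * norm x"
  by (rule onorm[OF bounded_clinear_linear[OF resolvable_graph(2)]])

lemma resolvent_growth_bound:
  assumes r: "\<And>s. s \<noteq> 0 \<Longrightarrow> resolvable (\<i> * of_real s)" and ab: "a \<ge> 0" "b \<ge> 0"
    and g: "resolvent_growth A a b"
  obtains C where "C \<ge> 0" "\<And>s x. s \<noteq> 0 \<Longrightarrow> \<bar>s\<bar> \<le> 1 \<Longrightarrow> norm (R s x) \<le> C * \<bar>s\<bar> powr - a * norm x"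
    "\<And>s x. \<bar>s\<bar> \<ge> 1 \<Longrightarrow> norm (R s x) \<le> C * \<bar>s\<bar> powr b * norm x"
proof -
  let ?N = "\<lambda>s. op_norm ((op_shift (\<i> * complex_of_real s) A)\<inverse>)"
  obtain c1 where c1: "c1 > 0" "\<forall>\<^sub>F s in at 0. norm (?N s) \<le> c1 * norm (\<bar>s\<bar> powr - a)"
    using landau_o.bigE[OF conjunct1[OF g[unfolded resolvent_growth_def]]] by blast
  obtain c2 where c2: "c2 > 0" "\<forall>\<^sub>F s in at_infinity. norm (?N s) \<le> c2 * norm (\<bar>s\<bar> powr b)"
    using landau_o.bigE[OF conjunct2[OF g[unfolded resolvent_growth_def]]] by blast
  obtain d where d: "d > 0" "\<And>s. s \<noteq> 0 \<Longrightarrow> \<bar>s\<bar> < d \<Longrightarrow> ?N s \<le> c1 * \<bar>s\<bar> powr - a"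
    using c1(2) unfolding eventually_at by (auto simp: dist_real_def) (metis abs_le_D1)
  obtain B where B: "\<And>s. \<bar>s\<bar> \<ge> B \<Longrightarrow> ?N s \<le> c2 * \<bar>s\<bar> powr b"
    using c2(2) unfolding eventually_at_infinity by (auto) (metis abs_le_D1)
  obtain L where L: "L \<ge> 0" "\<And>s x. d \<le> \<bar>s\<bar> \<Longrightarrow> \<bar>s\<bar> \<le> B \<Longrightarrow> norm (R s x) \<le> L * norm x"
    using R_locally_bounded[OF r d(1), of B] by blast
  define C where "C = c1 + c2 + L"
  have C: "C \<ge> 0" "c1 \<le> C" "c2 \<le> C" "L \<le> C"
    using c1(1) c2(1) L(1) by (auto simp: C_def)
  have le: "norm (R s x) \<le> C * w * norm x"
    if s: "s \<noteq> 0" and w: "\<bar>s\<bar> < d \<Longrightarrow> \<bar>s\<bar> powr - a \<le> w" "\<bar>s\<bar> \<ge> B \<Longrightarrow> \<bar>s\<bar> powr b \<le> w" "1 \<le> w" for s x w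
  proof -
    have n: "norm (R s x) \<le> ?N s * norm x" using R_le_onorm[OF r[OF s]] op_norm_R[OF r[OF s]] by simp
    consider "\<bar>s\<bar> < d" | "\<bar>s\<bar> \<ge> B" | "d \<le> \<bar>s\<bar>" "\<bar>s\<bar> \<le> B" by linarith
    then show ?thesis
    proof cases
      case 1
      have "?N s \<le> c1 * \<bar>s\<bar> powr - a" by (rule d(2)[OF s 1])
      also have "\<dots> \<le> C * w" using C c1(1) w(1)[OF 1] by (intro mult_mono) auto
      finally show ?thesis using n by (meson mult_right_mono norm_ge_zero order_trans)
    next
      case 2
      have "?N s \<le> c2 * \<bar>s\<bar> powr b" by (rule B[OF 2])
      also have "\<dots> \<le> C * w" using C c2(1) w(2)[OF 2] by (intro mult_mono) auto
      finally show ?thesis using n by (meson mult_right_mono norm_ge_zero order_trans)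
    next
      case 3
      have "norm (R s x) \<le> L * norm x" by (rule L(2)[OF 3])
      also have "L \<le> C * w" using mult_mono[OF C(4) w(3)] C(1) by simp
      finally show ?thesis by (simp add: mult_right_mono)
    qed
  qed
  show ?thesis
  proof (rule that[OF C(1)])
    fix s :: real and x assume s: "s \<noteq> 0" "\<bar>s\<bar> \<le> 1"
    have "1 \<le> \<bar>s\<bar> powr - a" using powr_mono'[of "- a" 0 "\<bar>s\<bar>"] s ab by simp
    moreover have "\<bar>s\<bar> powr b \<le> 1" using s ab by (simp add: powr_le1)
    ultimately show "norm (R s x) \<le> C * \<bar>s\<bar> powr - a * norm x" by (intro le s) auto
  next
    fix s :: real and x assume s: "\<bar>s\<bar> \<ge> 1"
    have "1 \<le> \<bar>s\<bar> powr b" using s ab by (intro ge_one_powr_ge_zero)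
    moreover have "\<bar>s\<bar> powr - a \<le> 1" using powr_mono[of "- a" 0 "\<bar>s\<bar>"] s ab by (auto split: if_splits)
    ultimately show "norm (R s x) \<le> C * \<bar>s\<bar> powr b * norm x" using s by (intro le) auto
  qed
qed

lemma T_Q_graph: "graph_of (T t) \<odot> A \<odot> ((op_shift 1 A)\<inverse> ^^ 2) = graph_of (\<lambda>x. T t (Q x))"
proof -
  have "(op_shift 1 A)\<inverse> = graph_of U" using resolvable_graph(1)[OF resolvable_1] .
  then have "(op_shift 1 A)\<inverse> ^^ 2 = graph_of (\<lambda>x. U (U x))"
    by (auto simp: numeral_2_eq_2 graph_of_def relcomp_unfold)
  moreover have "A \<odot> graph_of (\<lambda>x. U (U x)) = graph_of (\<lambda>x. Q x)"
  proof -
    have "(U (U x), z) \<in> A \<longleftrightarrow> z = Q x" for x z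
      using AU_in_A[of "U x"] A_single_valued by blast
    then show ?thesis by (auto simp: op_prod_def graph_of_def)
  qed
  ultimately show ?thesis by simp
qed

end

theorem theorem1p6:
  fixes T :: "real \<Rightarrow> 'a::complex_hilbert_space \<Rightarrow> 'a"
    and A :: "'a operator"
  assumes "bounded_C0_semigroup T"
    and "generator T = op_neg A"
    and "spectrum A \<inter> {z. Re z = 0} = {0}"
  shows "(\<forall>\<alpha> \<beta>. \<alpha> \<ge> 1 \<and> \<beta> > 0 \<and> resolvent_growth A \<alpha> \<beta> \<longrightarrow>
            bounded_operator (frac_power A \<alpha> \<odot> frac_power (op_shift 1 A) (- (\<alpha> + \<beta>))) \<and>
            (\<lambda>t. op_norm (graph_of (T t) \<odot> frac_power A \<alpha> \<odot>
                    frac_power (op_shift 1 A) (- (\<alpha> + \<beta>))))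
              \<in> O[at_top](\<lambda>t. 1 / t) \<and>
            (\<lambda>t. op_norm (graph_of (T t) \<odot> A \<odot> ((op_shift 1 A)\<inverse> ^^ 2)))
              \<in> O[at_top](\<lambda>t. t powr (- 1 / max \<alpha> \<beta>))) \<and>
         (\<forall>\<gamma>>0.
            (\<lambda>t. op_norm (graph_of (T t) \<odot> A \<odot> ((op_shift 1 A)\<inverse> ^^ 2)))
              \<in> O[at_top](\<lambda>t. t powr (- 1 / \<gamma>)) \<longrightarrow>
            resolvent_growth A (max 1 \<gamma>) \<gamma>)"
proof -
  obtain M0 where C0: "C0_semigroup T" and M0: "\<And>t. t \<ge> 0 \<Longrightarrow> onorm (T t) \<le> M0"
    using assms(1) unfolding bounded_C0_semigroup_def by blast
  have lin: "bounded_clinear (T t)" if "t \<ge> 0" for t using C0 that by (simp add: C0_semigroup_def)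
  interpret bounded_semigroup T A "max 1 M0"
  proof
    show "norm (T t x) \<le> max 1 M0 * norm x" if "t \<ge> 0" for t x
    proof -
      have "norm (T t x) \<le> onorm (T t) * norm x"
        by (rule onorm[OF bounded_clinear_linear[OF lin[OF that]]])
      also have "\<dots> \<le> max 1 M0 * norm x" using M0[OF that] by (intro mult_right_mono) auto
      finally show ?thesis .
    qed
  qed (use C0 assms(2) in \<open>auto simp: C0_semigroup_def fun_eq_iff\<close>)
  have r: "resolvable (\<i> * of_real s)" if "s \<noteq> 0" for s :: real
  proof (rule resolvable_if_not_spectrum)
    show "- (\<i> * of_real s) \<notin> spectrum A"
    proof
      assume "- (\<i> * of_real s) \<in> spectrum A"
      then have "- (\<i> * of_real s) \<in> spectrum A \<inter> {z. Re z = 0}" by simp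
      then show False using that unfolding assms(3) by simp
    qed
  qed
  have TQ: "bounded_linear (\<lambda>x. T t (Q x))" if "t \<ge> 0" for t
    by (intro bounded_clinear_linear bounded_clinear_compose[OF lin[OF that]] commuting_clinear[OF Q_commuting])
  show ?thesis
  proof (intro conjI allI impI)
    fix \<alpha> \<beta> :: real assume h: "\<alpha> \<ge> 1 \<and> \<beta> > 0 \<and> resolvent_growth A \<alpha> \<beta>"
    then have a: "\<alpha> \<ge> 1" and b: "\<beta> > 0" by auto
    obtain C where C: "C \<ge> 0" "\<And>s x. s \<noteq> 0 \<Longrightarrow> \<bar>s\<bar> \<le> 1 \<Longrightarrow> norm (R s x) \<le> C * \<bar>s\<bar> powr - \<alpha> * norm x"
      "\<And>s x. \<bar>s\<bar> \<ge> 1 \<Longrightarrow> norm (R s x) \<le> C * \<bar>s\<bar> powr \<beta> * norm x"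
      by (rule resolvent_growth_bound[OF r, of \<alpha> \<beta>]) (use h in auto)
    note prod = frac_power_product[OF a b]
    have Bc: "bounded_clinear (\<lambda>y. binom_op \<alpha> 1 (K 1 \<beta> y))"
      by (rule bounded_clinear_compose[OF commuting_clinear[OF binom_op_commuting] commuting_clinear[OF K_commuting]])
        (use a b in auto)
    show "bounded_operator (frac_power A \<alpha> \<odot> frac_power (op_shift 1 A) (- (\<alpha> + \<beta>)))"
      unfolding prod bounded_operator_def using Bc by blast
    obtain L where L: "L \<ge> 0" "\<And>t x. t > 0 \<Longrightarrow> norm (T t (binom_op \<alpha> 1 (K 1 \<beta> x))) \<le> L / t * norm x"
      using fractional_decay[OF a b r C] by blast
    show "(\<lambda>t. op_norm (graph_of (T t) \<odot> frac_power A \<alpha> \<odot> frac_power (op_shift 1 A) (- (\<alpha> + \<beta>))))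
        \<in> O[at_top](\<lambda>t. 1 / t)"
    proof (rule bigoI[of _ L])
      show "\<forall>\<^sub>F t in at_top. norm (op_norm (graph_of (T t) \<odot> frac_power A \<alpha> \<odot>
          frac_power (op_shift 1 A) (- (\<alpha> + \<beta>)))) \<le> L * norm (1 / t)"
        using eventually_gt_at_top[of 0]
      proof eventually_elim
        case (elim t)
        have "bounded_linear (\<lambda>x. T t (binom_op \<alpha> 1 (K 1 \<beta> x)))"
          using elim by (intro bounded_clinear_linear bounded_clinear_compose[OF lin Bc]) simp
        then have "0 \<le> onorm (\<lambda>x. T t (binom_op \<alpha> 1 (K 1 \<beta> x)))" by (rule onorm_pos_le)
        moreover have "onorm (\<lambda>x. T t (binom_op \<alpha> 1 (K 1 \<beta> x))) \<le> L / t"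
          using L elim by (intro onorm_le_of_bound) auto
        ultimately show ?case using elim unfolding prod by simp
      qed
    qed
    define \<gamma> where "\<gamma> = max \<alpha> \<beta>"
    have g: "\<gamma> \<ge> 1" "\<alpha> \<le> \<gamma>" "\<beta> \<le> \<gamma>" using a by (auto simp: \<gamma>_def)
    have low: "norm (R s x) \<le> C * \<bar>s\<bar> powr - \<gamma> * norm x" if "s \<noteq> 0" "\<bar>s\<bar> \<le> 1" for s x
    proof -
      have "norm (R s x) \<le> C * \<bar>s\<bar> powr - \<alpha> * norm x" by (rule C(2)[OF that])
      also have "\<dots> \<le> C * \<bar>s\<bar> powr - \<gamma> * norm x"
        using C(1) g that by (intro mult_right_mono mult_left_mono powr_mono') auto
      finally show ?thesis .
    qed
    have high: "norm (R s x) \<le> C * \<bar>s\<bar> powr \<gamma> * norm x" if "\<bar>s\<bar> \<ge> 1" for s x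
    proof -
      have "norm (R s x) \<le> C * \<bar>s\<bar> powr \<beta> * norm x" by (rule C(3)[OF that])
      also have "\<dots> \<le> C * \<bar>s\<bar> powr \<gamma> * norm x"
        using C(1) g that by (intro mult_right_mono mult_left_mono powr_mono) auto
      finally show ?thesis .
    qed
    obtain L' where L': "L' \<ge> 0" "\<And>t x. t \<ge> 1 \<Longrightarrow> norm (T t (Q x)) \<le> L' * t powr (- 1 / \<gamma>) * norm x"
      using decay_of_resolvent_growth[OF r g(1) C(1) low high] by blast
    show "(\<lambda>t. op_norm (graph_of (T t) \<odot> A \<odot> ((op_shift 1 A)\<inverse> ^^ 2)))
        \<in> O[at_top](\<lambda>t. t powr (- 1 / max \<alpha> \<beta>))"
    proof (rule bigoI[of _ L'])
      show "\<forall>\<^sub>F t in at_top. norm (op_norm (graph_of (T t) \<odot> A \<odot> ((op_shift 1 A)\<inverse> ^^ 2)))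
          \<le> L' * norm (t powr (- 1 / max \<alpha> \<beta>))"
        using eventually_ge_at_top[of 1]
      proof eventually_elim
        case (elim t)
        have "0 \<le> onorm (\<lambda>x. T t (Q x))" using elim by (intro onorm_pos_le TQ) simp
        moreover have "onorm (\<lambda>x. T t (Q x)) \<le> L' * t powr (- 1 / \<gamma>)"
          using L' elim by (intro onorm_le_of_bound) auto
        ultimately show ?case unfolding T_Q_graph op_norm_graph_of \<gamma>_def by simp
      qed
    qed
  next
    fix \<gamma> :: real
    assume g: "\<gamma> > 0" and O: "(\<lambda>t. op_norm (graph_of (T t) \<odot> A \<odot> ((op_shift 1 A)\<inverse> ^^ 2)))
        \<in> O[at_top](\<lambda>t. t powr (- 1 / \<gamma>))"
    obtain c where c: "c > 0" "\<forall>\<^sub>F t in at_top. norm (onorm (\<lambda>x. T t (Q x))) \<le> c * norm (t powr (- 1 / \<gamma>))"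
      using landau_o.bigE[OF O[unfolded T_Q_graph op_norm_graph_of]] by blast
    then obtain t1 where t1: "\<And>t. t \<ge> t1 \<Longrightarrow> norm (onorm (\<lambda>x. T t (Q x))) \<le> c * norm (t powr (- 1 / \<gamma>))"
      unfolding eventually_at_top_linorder by blast
    define t0 where "t0 = max t1 1"
    have decay: "norm (T t (Q x)) \<le> c * t powr (- 1 / \<gamma>) * norm x" if "t \<ge> t0" for t x
    proof -
      have t: "t \<ge> t1" "t \<ge> 0" using that by (auto simp: t0_def)
      have "norm (T t (Q x)) \<le> onorm (\<lambda>x. T t (Q x)) * norm x" by (rule onorm[OF TQ[OF t(2)]])
      also have "\<dots> \<le> c * t powr (- 1 / \<gamma>) * norm x"
        using t1[OF t(1)] by (intro mult_right_mono) auto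
      finally show ?thesis .
    qed
    have "t0 > 0" by (simp add: t0_def)
    from resolvent_growth_of_decay[OF r g c(1) this decay]
    obtain L where L: "L \<ge> 0"
      "\<And>s x. s \<noteq> 0 \<Longrightarrow> \<bar>s\<bar> \<le> 1 \<Longrightarrow> norm (R s x) \<le> L * \<bar>s\<bar> powr (- max 1 \<gamma>) * norm x"
      "\<And>s x. \<bar>s\<bar> \<ge> 1 \<Longrightarrow> norm (R s x) \<le> L * \<bar>s\<bar> powr \<gamma> * norm x"
      by blast
    have nonneg: "0 \<le> op_norm ((op_shift (\<i> * of_real s) A)\<inverse>)" if "s \<noteq> 0" for s
      unfolding op_norm_R[OF r[OF that]]
      by (rule onorm_pos_le[OF bounded_clinear_linear[OF resolvable_graph(2)[OF r[OF that]]]])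
    have le: "op_norm ((op_shift (\<i> * of_real s) A)\<inverse>) \<le> B" if "s \<noteq> 0" "\<And>x. norm (R s x) \<le> B * norm x" "0 \<le> B" for s B
      unfolding op_norm_R[OF r[OF that(1)]] by (rule onorm_le_of_bound[OF that(2,3)])
    show "resolvent_growth A (max 1 \<gamma>) \<gamma>"
      unfolding resolvent_growth_def
    proof (intro conjI bigoI[of _ L])
      have "\<forall>\<^sub>F s::real in at 0. \<bar>s\<bar> \<le> 1 \<and> s \<noteq> 0"
        unfolding eventually_at by (intro exI[of _ 1]) (auto simp: dist_real_def)
      then show "\<forall>\<^sub>F s in at 0. norm (op_norm ((op_shift (\<i> * of_real s) A)\<inverse>))
          \<le> L * norm (\<bar>s\<bar> powr - max 1 \<gamma>)"
      proof eventually_elim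
        case (elim s)
        then show ?case using nonneg[of s] le[of s "L * \<bar>s\<bar> powr - max 1 \<gamma>"] L by simp
      qed
      have "\<forall>\<^sub>F s::real in at_infinity. \<bar>s\<bar> \<ge> 1"
        unfolding eventually_at_infinity by (intro exI[of _ 1]) auto
      then show "\<forall>\<^sub>F s in at_infinity. norm (op_norm ((op_shift (\<i> * of_real s) A)\<inverse>))
          \<le> L * norm (\<bar>s\<bar> powr \<gamma>)"
      proof eventually_elim
        case (elim s)
        then have "s \<noteq> 0" by auto
        then show ?case using elim nonneg[of s] le[of s "L * \<bar>s\<bar> powr \<gamma>"] L by simp
      qed
    qed
  qed
qed

end
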